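(* Let $k=k(n)$, $c=c(n)$ be integer parameters with $3\le c\le k-1<\frac{n}{2\ln n}$. Then for all $n$ there is an unsatisfiable $4$-CNF formula $F$ of size linear in its number of variables, with between $2k^2n^{c+1}$ and $40k^2(2n)^{c+1}$ variables, which has a resolution refutation of width $k+3$ and size $O(k^2(4n)^k)$, but for which every resolution refutation of width at most $k+c$ has depth at least $\Omega(n^k)$.
   Context: A clause is a disjunction of literals over distinct variables; its width is its number of literals; a $4$-CNF is a set of clauses of width at most $4$, and its size is the sum of its clause widths. A resolution refutation of $F$ is a sequence of clauses ending in the empty clause, each in $F$ or derived from earlier $C\lor x$, $D\lor\neg x$ as $C\lor D$. Size = number of clauses; width = maximum clause width; depth = number of edges on a longest path in the DAG with edges from premises to derived clauses. *)

theory Defs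
  imports Complex_Main
begin

datatype 'v literal = Pos 'v | Neg 'v

fun var :: "'v literal \<Rightarrow> 'v" where
  "var (Pos x) = x"
| "var (Neg x) = x"

type_synonym 'v clause = "'v literal set"

definition is_clause :: "'v clause \<Rightarrow> bool" where
  "is_clause C \<longleftrightarrow> finite C \<and> inj_on var C"

definition is_cnf :: "nat \<Rightarrow> 'v clause set \<Rightarrow> bool" where
  "is_cnf w F \<longleftrightarrow> finite F \<and> (\<forall>C\<in>F. is_clause C \<and> card C \<le> w)"

definition formula_size :: "'v clause set \<Rightarrow> nat" where
  "formula_size F = (\<Sum>C\<in>F. card C)"

definition formula_vars :: "'v clause set \<Rightarrow> 'v set" where
  "formula_vars F = var ` \<Union>F"

fun lit_true :: "('v \<Rightarrow> bool) \<Rightarrow> 'v literal \<Rightarrow> bool" where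
  "lit_true \<alpha> (Pos x) = \<alpha> x"
| "lit_true \<alpha> (Neg x) = (\<not> \<alpha> x)"

definition satisfiable :: "'v clause set \<Rightarrow> bool" where
  "satisfiable F \<longleftrightarrow> (\<exists>\<alpha>. \<forall>C\<in>F. \<exists>l\<in>C. lit_true \<alpha> l)"

(* The side conditions express that the pivot literal is not repeated inside C or D, which
   "literals over distinct variables" requires of the premises C \<or> x and D \<or> \<not>x. *)
definition resolvent :: "'v clause \<Rightarrow> 'v clause \<Rightarrow> 'v clause \<Rightarrow> bool" where
  "resolvent A B R \<longleftrightarrow> (\<exists>x C D. A = insert (Pos x) C \<and> Pos x \<notin> C \<and>
      B = insert (Neg x) D \<and> Neg x \<notin> D \<and> R = C \<union> D)"

(* A sequence of clauses alone does not determine the proof DAG, so each clause records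
   whether it was taken from F or which two earlier positions it was derived from. *)
datatype justification = Axiom | Resolved nat nat

type_synonym 'v derivation = "('v clause \<times> justification) list"

definition valid_step :: "'v clause set \<Rightarrow> 'v derivation \<Rightarrow> nat \<Rightarrow> bool" where
  "valid_step F \<pi> m \<longleftrightarrow> is_clause (fst (\<pi> ! m)) \<and>
     (case snd (\<pi> ! m) of
        Axiom \<Rightarrow> fst (\<pi> ! m) \<in> F
      | Resolved i j \<Rightarrow> i < m \<and> j < m \<and>
          resolvent (fst (\<pi> ! i)) (fst (\<pi> ! j)) (fst (\<pi> ! m)))"

definition refutation :: "'v clause set \<Rightarrow> 'v derivation \<Rightarrow> bool" where
  "refutation F \<pi> \<longleftrightarrow>
     \<pi> \<noteq> [] \<and> fst (last \<pi>) = {} \<and> (\<forall>m < length \<pi>. valid_step F \<pi> m)"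

definition res_size :: "'v derivation \<Rightarrow> nat" where
  "res_size \<pi> = length \<pi>"

definition res_width :: "'v derivation \<Rightarrow> nat" where
  "res_width \<pi> = Max ((\<lambda>s. card (fst s)) ` set \<pi>)"

definition res_edges :: "'v derivation \<Rightarrow> (nat \<times> nat) set" where
  "res_edges \<pi> = {(p, m). m < length \<pi> \<and>
     (\<exists>i j. snd (\<pi> ! m) = Resolved i j \<and> (p = i \<or> p = j))}"

(* The relational power R ^^ d relates the endpoints of walks with d edges.  In a refutation
   every edge goes from a smaller to a larger position, so walks are paths and the set is
   finite; it contains 0. *)
definition res_depth :: "'v derivation \<Rightarrow> nat" where
  "res_depth \<pi> = Max {d. \<exists>i m. (i, m) \<in> res_edges \<pi> ^^ d}"

end

theory Submission
  imports Defs "HOL-Number_Theory.Number_Theory" "HOL-Analysis.Analysis" "HOL-Real_Asymp.Real_Asymp"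
begin

text \<open>
  The formula is a system of parity constraints on a long cylinder made of \<open>K = k + 2\<close> rows of
  faces. Its variables are the edges between faces of consecutive rows, and the constraints say that
  the sum of the edges along a closed curve around the cylinder (the flux) does not depend on the
  position of the curve, while it is 0 at one end and 1 at the other. Sweeping a curve of \<open>K\<close> edges
  from one end to the other refutes the system in width \<open>K + 1\<close>.

  In the middle of the cylinder, the edges between two consecutive rows are identified modulo the
  product of \<open>c\<close> out of \<open>K\<close> primes between \<open>n\<close> and \<open>2n\<close>, each prime being used in \<open>c\<close> consecutive rows.
  If the variables \<open>U\<close> of two successive clauses (at most \<open>k + c + 1\<close> of them) determine the flux,
  then \<open>U\<close> meets every row and at least \<open>K - c + 1\<close> rows just once. So every prime belongs to some
  row that \<open>U\<close> meets just once, and by the Chinese remainder theorem \<open>U\<close> has a position along the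
  cylinder, which moves by \<open>O(K\<^sup>2)\<close> in a resolution step. The adversary keeps an assignment that
  violates a single constraint, at the end of the cylinder far from this position.

  That there are enough primes follows from the factorisation of the central binomial coefficient.
\<close>

section \<open>Primes between \<open>n\<close> and \<open>2n\<close>\<close>

text \<open>The middle segment has \<open>N = 64 * K\<^sup>2 * int n ^ k\<close> positions; for
  \<open>c\<close> well below \<open>k\<close>, a separate variable for each edge would exceed the
  permitted number by far. Identification modulo only \<open>c\<close> primes leaves of order k^2
  (2n)^c variables, while the product of all \<open>K\<close> primes, times \<open>L\<close>, still
  exceeds the length, so a set that is seen by every prime has an unambiguous position. A cell
  touches two rows of edges and thereby \<open>c + 1\<close> primes, so the bound on the number of
  constraints is larger than that on the number of variables by a factor of order n. Padding
  variables, forced by unit clauses, make the size linear again; they account for the exponent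
  \<open>c + 1\<close>. The ends stay uncompressed: there an edge is one variable, so a change of
  the assignment can be cut off without being repeated elsewhere. The hypothesis on \<open>k\<close>
  asks for slightly more than n/(2 ln n) primes. The most direct estimate of the central binomial
  coefficient misses the factor 1/2, hence the finer splitting of the range of prime powers.\<close>

definition psi :: "nat \<Rightarrow> real" where
  "psi n = (\<Sum>d=1..n. mangoldt d)"

lemma psi_mono: "m \<le> n \<Longrightarrow> psi m \<le> psi n"
  unfolding psi_def by (intro sum_mono2) (auto intro: mangoldt_nonneg)

lemma psi_Suc: "psi (Suc n) = psi n + mangoldt (Suc n)"
  by (simp add: psi_def)

lemma psi_diff: "m \<le> n \<Longrightarrow> psi n - psi m = (\<Sum>d\<in>{m<..n}. mangoldt d)"
proof -
  assume "m \<le> n"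
  then have "{1..n} = {1..m} \<union> {m<..n}" by auto
  then have "psi n = psi m + (\<Sum>d\<in>{m<..n}. mangoldt d)"
    unfolding psi_def by (simp only:) (rule sum.union_disjoint, auto)
  then show ?thesis by simp
qed

text \<open>Legendre's formula in logarithmic form. The free upper limit \<open>M\<close> allows the
  factorials of \<open>n\<close> and of \<open>2 * n\<close> to be summed over one range.\<close>

lemma ln_fact_eq_sum_mangoldt:
  "n \<le> M \<Longrightarrow> ln (fact n :: real) = (\<Sum>d=1..M. mangoldt d * real (n div d))"
proof (induction n)
  case 0
  then show ?case by simp
next
  case (Suc n)
  have "ln (fact (Suc n) :: real) = ln (real (Suc n)) + ln (fact n)"
    by (simp add: ln_mult)
  also have "ln (real (Suc n)) = (\<Sum>d | d dvd Suc n. mangoldt d)"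
    by (subst mangoldt_sum) auto
  also have "\<dots> = (\<Sum>d=1..M. mangoldt d * (if d dvd Suc n then 1 else 0))"
  proof -
    have "d \<in> {1..M}" if "d dvd Suc n" for d
      using dvd_imp_le[OF that] dvd_pos_nat[OF _ that] Suc.prems by auto
    then show ?thesis
      by (intro sum.mono_neutral_cong_left) auto
  qed
  also have "ln (fact n :: real) = (\<Sum>d=1..M. mangoldt d * real (n div d))"
    using Suc by simp
  also have "(\<Sum>d=1..M. mangoldt d * (if d dvd Suc n then 1 else 0)) +
      (\<Sum>d=1..M. mangoldt d * real (n div d)) = (\<Sum>d=1..M. mangoldt d * real (Suc n div d))"
    unfolding sum.distrib[symmetric]
  proof (rule sum.cong)
    fix d assume "d \<in> {1..M}"
    have "Suc n div d = n div d + (if d dvd Suc n then 1 else 0)"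
      by (simp add: div_Suc dvd_eq_mod_eq_0)
    then show "mangoldt d * (if d dvd Suc n then 1 else 0) + mangoldt d * real (n div d)
        = mangoldt d * real (Suc n div d)"
      by (simp add: distrib_left)
  qed simp
  finally show ?case .
qed

lemma ln_central_binomial:
  "ln (real (2 * n choose n)) = (\<Sum>d=1..2*n. mangoldt d * (real (2 * n div d) - 2 * real (n div d)))"
proof -
  have "real (2 * n choose n) = fact (2 * n) / (fact n * fact n)"
    by (subst binomial_fact) (auto simp: mult_2)
  then have "ln (real (2 * n choose n)) = ln (fact (2 * n)) - 2 * ln (fact n :: real)"
    by (simp add: ln_div ln_mult)
  also have "\<dots> = (\<Sum>d=1..2*n. mangoldt d * real (2 * n div d)) -
      2 * (\<Sum>d=1..2*n. mangoldt d * real (n div d))"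
    using ln_fact_eq_sum_mangoldt[of "2 * n" "2 * n"] ln_fact_eq_sum_mangoldt[of n "2 * n"] by simp
  finally show ?thesis
    by (simp add: sum_subtractf sum_distrib_left algebra_simps)
qed

lemma double_div_diff:
  fixes n d :: nat
  assumes "d > 0"
  shows "2 * (n div d) \<le> 2 * n div d" "2 * n div d \<le> 2 * (n div d) + 1"
proof -
  have "2 * n = 2 * (n mod d) + d * (2 * (n div d))"
    by (subst (1) mod_mult_div_eq[of n d, symmetric]) (simp only: distrib_left mult.left_commute)
  then have e: "2 * n div d = 2 * (n div d) + (2 * (n mod d)) div d"
    using assms by (metis add.commute div_mult_self2 less_irrefl)
  have "2 * (n mod d) < d * 2"
    using mod_less_divisor[OF assms, of n] by simp
  then have "2 * (n mod d) div d < 2"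
    by (simp add: less_mult_imp_div_less mult.commute)
  with e show "2 * (n div d) \<le> 2 * n div d" "2 * n div d \<le> 2 * (n div d) + 1" by auto
qed

text \<open>In \<open>ln_central_binomial\<close> the coefficient is 1 on the range from
  \<open>n + 1\<close> to \<open>2 * n\<close> and nonnegative elsewhere, and the binomial
  coefficient is at most 4^n.\<close>

lemma psi_double_le: "psi (2 * n) - psi n \<le> 2 * real n * ln 2"
proof -
  have "psi (2 * n) - psi n = (\<Sum>d\<in>{n<..2*n}. mangoldt d)"
    by (simp add: psi_diff)
  also have "\<dots> = (\<Sum>d\<in>{n<..2*n}. mangoldt d * (real (2 * n div d) - 2 * real (n div d)))"
  proof (rule sum.cong)
    fix d assume d: "d \<in> {n<..2*n}"
    then have "2 * n div d = 1" by (auto simp: div_nat_eqI)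
    with d show "mangoldt d = mangoldt d * (real (2 * n div d) - 2 * real (n div d))" by simp
  qed simp
  also have "\<dots> \<le> (\<Sum>d=1..2*n. mangoldt d * (real (2 * n div d) - 2 * real (n div d)))"
  proof (rule sum_mono2)
    fix d assume "d \<in> {1..2*n} - {n<..2*n}"
    then have "2 * (n div d) \<le> 2 * n div d" using double_div_diff(1)[of d n] by simp
    then have "2 * real (n div d) \<le> real (2 * n div d)" by linarith
    then show "0 \<le> mangoldt d * (real (2 * n div d) - 2 * real (n div d))"
      by (simp add: mangoldt_nonneg)
  qed auto
  also have "\<dots> = ln (real (2 * n choose n))" by (simp add: ln_central_binomial)
  also have "\<dots> \<le> ln (2 ^ (2 * n))"
    using binomial_le_pow2[of "2 * n" n]
    by (subst ln_le_cancel_iff) (auto simp: of_nat_le_iff[of _ "2^(2*n)", where ?'a=real, simplified])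
  finally show ?thesis by (simp add: ln_realpow)
qed

text \<open>Repeated halving. The slope 7/5 lies just above 2 * 25/36, twice the bound for ln 2; the
  difference pays for rounding n/2 up as soon as n is at least 251, so the threshold 400 is
  ample.\<close>

lemma psi_le: "psi n \<le> 7/5 * real n + psi 400"
proof (induction n rule: less_induct)
  case (less n)
  show ?case
  proof (cases "n \<le> 400")
    case True
    then show ?thesis using psi_mono[of n 400] by simp
  next
    case False
    define m where "m = (n + 1) div 2"
    have m: "m < n" "n \<le> 2 * m" "2 * m \<le> n + 1" using False by (auto simp: m_def)
    have "psi n \<le> psi (2 * m)" using m by (intro psi_mono)
    also have "\<dots> \<le> psi m + 2 * real m * ln 2" using psi_double_le[of m] by simp
    also have "\<dots> \<le> 7/5 * real m + psi 400 + 2 * real m * (25/36)"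
      using less[OF m(1)] ln2_le_25_over_36 by (intro add_mono mult_left_mono) auto
    also have "\<dots> \<le> 7/5 * real n + psi 400"
      using m False by (simp add: field_simps)
    finally show ?thesis .
  qed
qed

lemma ln2_gt: "(69/100 :: real) \<le> ln 2"
proof -
  have "exp (69/100 :: real) ^ 100 = exp 1 ^ 69"
    by (simp flip: exp_of_nat_mult)
  also have "\<dots> \<le> (272/100) ^ 69"
    by (intro power_mono) (use e_less_272 in auto)
  also have "\<dots> \<le> 2 ^ 100" by (simp add: power_divide field_simps)
  finally have "exp (69/100 :: real) \<le> 2"
    by (subst (asm) power_mono_iff) auto
  then show ?thesis by (subst ln_ge_iff) auto
qed

text \<open>In \<open>ln (2n choose n)\<close> the prime powers in \<open>(2n/3, n]\<close> and in \<open>(2n/7, n/3]\<close> have coefficient 0.\<close>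

lemma psi_double_ge:
  assumes "n > 0"
  shows "52/100 * real n - 2 * ln (2 * real n) - psi 400 \<le> psi (2 * n) - psi n"
proof -
  define m where "m = n div 3"
  let ?g = "\<lambda>d. mangoldt d * (real (2 * n div d) - 2 * real (n div d)) :: real"
  \<comment> \<open>Estimating the whole range up to 2n/3 by \<open>psi_le\<close> would leave 2 *
    69/100 - 14/15 < 1/2 as the coefficient of n. Treating \<open>?B\<close> with
    \<open>psi_double_le\<close> and only \<open>?C\<close> with \<open>psi_le\<close> gains enough.
    The limit \<open>2*m+1\<close> is at least the integer part of 2n/3.\<close>
  let ?A = "{n<..2*n}" and ?B = "{m<..2*m+1}" and ?C = "{1..2*n div 7}"
  have "ln (real (2 * n choose n)) = (\<Sum>d=1..2*n. ?g d)"
    by (rule ln_central_binomial)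
  also have "\<dots> \<le> (\<Sum>d=1..2*n. mangoldt d * of_bool (d \<in> ?A) + mangoldt d * of_bool (d \<in> ?B)
      + mangoldt d * of_bool (d \<in> ?C))"
  proof (rule sum_mono)
    fix d assume d: "d \<in> {1..2*n}"
    have le1: "real (2 * n div d) - 2 * real (n div d) \<le> 1"
      using double_div_diff(2)[of d n] d by simp
    show "?g d \<le> mangoldt d * of_bool (d \<in> ?A) + mangoldt d * of_bool (d \<in> ?B)
      + mangoldt d * of_bool (d \<in> ?C)"
    proof (cases "d \<in> ?A \<or> d \<in> ?B \<or> d \<in> ?C")
      case True
      have "?g d \<le> mangoldt d * 1"
        using le1 by (intro mult_left_mono mangoldt_nonneg)
      also have "\<dots> \<le> mangoldt d * (of_bool (d \<in> ?A) + of_bool (d \<in> ?B) + of_bool (d \<in> ?C))"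
        using True by (intro mult_left_mono mangoldt_nonneg) auto
      finally show ?thesis by (simp add: algebra_simps)
    next
      case False
      have "2 * n div d = 2 * (n div d)"
      proof (cases "3 * d > 2 * n")
        case True
        then have "n div d = 1" "2 * n div d = 2" using False d
          by (auto intro!: div_nat_eqI)
        then show ?thesis by simp
      next
        case f2: False
        then have "3 * d \<le> n" "7 * d > 2 * n" using False d by (auto simp: m_def)
        then have "n div d = 3" "2 * n div d = 6"
          by (auto intro!: div_nat_eqI)
        then show ?thesis by simp
      qed
      with False show ?thesis by (simp add: mangoldt_nonneg)
    qed
  qed
  also have "\<dots> = (\<Sum>d\<in>?A. mangoldt d) + (\<Sum>d\<in>?B \<inter> {1..2*n}. mangoldt d) + (\<Sum>d\<in>?C. mangoldt d)"
  proof -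
    have "(\<Sum>d=1..2*n. mangoldt d * of_bool (d \<in> X)) = (\<Sum>d\<in>X \<inter> {1..2*n}. mangoldt d :: real)" for X
      by (intro sum.mono_neutral_cong_right) auto
    moreover have "?A \<inter> {1..2*n} = ?A" "?C \<inter> {1..2*n} = ?C" by auto
    ultimately show ?thesis by (simp only: sum.distrib)
  qed
  also have "(\<Sum>d\<in>?B \<inter> {1..2*n}. mangoldt d :: real) \<le> (\<Sum>d\<in>?B. mangoldt d)"
    by (intro sum_mono2) (auto intro: mangoldt_nonneg)
  also have "(\<Sum>d\<in>?B. mangoldt d :: real) = psi (Suc (2*m)) - psi m"
    by (subst psi_diff) auto
  also have "\<dots> \<le> 2 * real m * ln 2 + ln (2 * real n)"
  proof -
    have "mangoldt (Suc (2 * m)) \<le> ln (real (Suc (2 * m)))" by (intro mangoldt_le) auto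
    also have "\<dots> \<le> ln (2 * real n)" using assms by (intro ln_mono) (auto simp: m_def)
    finally show ?thesis using psi_double_le[of m] by (simp add: psi_Suc)
  qed
  also have "(\<Sum>d\<in>?C. mangoldt d :: real) = psi (2 * n div 7)" by (simp add: psi_def)
  also have "\<dots> \<le> 7/5 * real (2 * n div 7) + psi 400" by (rule psi_le)
  also have "real (2 * n div 7) \<le> 2 * real n / 7" using of_nat_div_le_of_nat[of "2*n" 7, where ?'a=real] by simp
  also have "(\<Sum>d\<in>?A. mangoldt d :: real) = psi (2 * n) - psi n" by (simp add: psi_diff)
  finally have 1: "ln (real (2 * n choose n)) \<le> psi (2 * n) - psi n + (2 * real m * ln 2 + ln (2 * real n))
     + (7 / 5 * (2 * real n / 7) + psi 400)" by simp
  have "2 * real n * ln 2 - ln (2 * real n) = ln (4 ^ n / (2 * real n))"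
  proof -
    have "(4::real) ^ n = 2 ^ (2 * n)" by (simp add: power_mult)
    then show ?thesis using assms by (simp add: ln_div ln_realpow)
  qed
  also have "\<dots> \<le> ln (real (2 * n choose n))"
    using central_binomial_lower_bound[OF assms] assms by (intro ln_mono) auto
  finally have 2: "2 * real n * ln 2 - ln (2 * real n) \<le> ln (real (2 * n choose n))" .
  \<comment> \<open>The linear terms add up to (2 - 2/3) * 69/100 - 2/5 = 52/100.\<close>
  define x y where "x = real n * ln 2" and "y = real m * ln 2"
  have "y \<le> (real n / 3) * ln 2"
    unfolding m_def y_def using of_nat_div_le_of_nat[of n 3, where ?'a=real]
    by (intro mult_right_mono) auto
  then have "y \<le> x / 3" by (simp add: x_def)
  moreover have "real n * (69/100) \<le> x" unfolding x_def by (intro mult_left_mono ln2_gt) auto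
  moreover have "2 * real n * ln 2 = 2 * x" "2 * real m * ln 2 = 2 * y" by (simp_all add: x_def y_def)
  ultimately show ?thesis using 1 2 by simp
qed

text \<open>Proper prime powers in the range are few: the base is at most the square root of
  \<open>2 * n\<close>, and each base occurs once because the next power is at least twice as
  large.\<close>

lemma card_primes_ge:
  assumes "n > 0"
  shows "psi (2 * n) - psi n \<le>
    (real (card {p. prime p \<and> n < p \<and> p \<le> 2 * n}) + sqrt (2 * real n)) * ln (2 * real n)"
proof -
  let ?P = "{p. prime p \<and> n < p \<and> p \<le> 2 * n}"
  let ?Q = "{q. primepow q \<and> \<not> prime q \<and> n < q \<and> q \<le> 2 * n}"
  have finQ: "finite ?Q" by (rule finite_subset[of _ "{..2*n}"]) auto
  have finP: "finite ?P" by (rule finite_subset[of _ "{..2*n}"]) auto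
  have "psi (2 * n) - psi n = (\<Sum>d\<in>{n<..2*n}. mangoldt d)"
    by (simp add: psi_diff)
  also have "\<dots> = (\<Sum>d\<in>?P \<union> ?Q. mangoldt d)"
    by (intro sum.mono_neutral_right) (auto simp: mangoldt_def)
  also have "\<dots> \<le> (\<Sum>d\<in>?P \<union> ?Q. ln (2 * real n))"
  proof (rule sum_mono)
    fix d assume d: "d \<in> ?P \<union> ?Q"
    then have "mangoldt d \<le> ln (real d)" using assms by (intro mangoldt_le) auto
    also have "\<dots> \<le> ln (2 * real n)" using d by (intro ln_mono) auto
    finally show "mangoldt d \<le> ln (2 * real n)" .
  qed
  also have "\<dots> = real (card (?P \<union> ?Q)) * ln (2 * real n)" by simp
  also have "card (?P \<union> ?Q) = card ?P + card ?Q" using finP finQ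
    by (intro card_Un_disjoint) auto
  finally have eq: "psi (2 * n) - psi n \<le> real (card ?P + card ?Q) * ln (2 * real n)" .
  have "real (card ?Q) \<le> sqrt (2 * real n)"
  proof -
    have form: "\<exists>p j. prime p \<and> 2 \<le> j \<and> q = p ^ j \<and> aprimedivisor q = p" if "q \<in> ?Q" for q
    proof -
      from that obtain p j where "prime p" "j > 0" "q = p ^ j"
        by (auto simp: primepow_def)
      moreover have "j \<noteq> 1" using that calculation by auto
      ultimately show ?thesis
        by (intro exI[of _ p] exI[of _ j]) (auto simp: aprimedivisor_prime_power)
    qed
    have inj: "inj_on aprimedivisor ?Q"
    proof (rule inj_onI)
      fix q q' assume q: "q \<in> ?Q" "q' \<in> ?Q" and eq: "aprimedivisor q = aprimedivisor q'"
      obtain p j where 1: "prime p" "q = p ^ j" "aprimedivisor q = p" using form[OF q(1)] by blast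
      obtain p' j' where 2: "prime p'" "q' = p' ^ j'" "aprimedivisor q' = p'" using form[OF q(2)] by blast
      have pp: "p' = p" using 1 2 eq by simp
      have no: "\<not> i < i'" if "n < p ^ i" "p ^ i' \<le> 2 * n" for i i'
      proof
        assume "i < i'"
        then have "p ^ Suc i \<le> p ^ i'" using 1(1) prime_ge_1_nat[OF 1(1)] by (intro power_increasing) auto
        moreover have "2 * p ^ i \<le> p ^ Suc i" using prime_ge_2_nat[OF 1(1)] by simp
        ultimately show False using that by linarith
      qed
      have "j = j'" using no[of j j'] no[of j' j] q 1 2 pp by (metis (no_types, lifting) mem_Collect_eq not_less_iff_gr_or_eq)
      then show "q = q'" using 1 2 pp by simp
    qed
    have sub: "aprimedivisor ` ?Q \<subseteq> {1..nat \<lfloor>sqrt (2 * real n)\<rfloor>}"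
    proof
      fix p assume "p \<in> aprimedivisor ` ?Q"
      then obtain q j where q: "prime p" "2 \<le> j" "q = p ^ j" "q \<in> ?Q" using form by blast
      have "p ^ 2 \<le> p ^ j" using q prime_ge_1_nat[OF q(1)] by (intro power_increasing) auto
      then have "p ^ 2 \<le> 2 * n" using q by auto
      then have "real p ^ 2 \<le> 2 * real n" by (metis of_nat_le_iff of_nat_mult of_nat_numeral of_nat_power)
      then have "real p \<le> sqrt (2 * real n)" by (simp add: real_le_rsqrt)
      then show "p \<in> {1..nat \<lfloor>sqrt (2 * real n)\<rfloor>}"
        using prime_ge_1_nat[OF q(1)] by (auto simp: le_nat_floor)
    qed
    have "card ?Q = card (aprimedivisor ` ?Q)" using inj by (simp add: card_image)
    also have "\<dots> \<le> nat \<lfloor>sqrt (2 * real n)\<rfloor>" using card_mono[OF _ sub] by simp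
    finally show ?thesis by (simp add: le_floor_iff le_nat_iff)
  qed
  then have Q: "real (card ?Q) \<le> sqrt (2 * real n)" .
  have "real (card ?P + card ?Q) * ln (2 * real n)
      \<le> (real (card ?P) + sqrt (2 * real n)) * ln (2 * real n)"
    using Q assms by (intro mult_right_mono) auto
  with eq show ?thesis by simp
qed

text \<open>52/100 exceeds 1/2, and all other terms are of lower order. The summand 4 covers the
  \<open>k + 2\<close> moduli that are needed when \<open>k - 1\<close> is below the
  quotient.\<close>

lemma eventually_many_primes:
  "\<forall>\<^sub>F n in sequentially. real n / (2 * ln (real n)) + 4 \<le>
     real (card {p. prime p \<and> n < p \<and> p \<le> 2 * n})"
proof -
  define C where "C = psi 400"
  have "\<forall>\<^sub>F n in sequentially. (real n / (2 * ln (real n)) + 4 + sqrt (2 * real n)) * ln (2 * real n)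
     \<le> 52/100 * real n - 2 * ln (2 * real n) - C"
    by real_asymp
  moreover have "\<forall>\<^sub>F n in sequentially. (n::nat) > 0" by (rule eventually_gt_at_top)
  ultimately show ?thesis
  proof eventually_elim
    case (elim n)
    have "(real n / (2 * ln (real n)) + 4 + sqrt (2 * real n)) * ln (2 * real n) \<le>
      (real (card {p. prime p \<and> n < p \<and> p \<le> 2 * n}) + sqrt (2 * real n)) * ln (2 * real n)"
      using elim(1) psi_double_ge[OF elim(2)] card_primes_ge[OF elim(2)] unfolding C_def by linarith
    moreover have "ln (2 * real n) > 0" using elim(2) by (intro ln_gt_zero) auto
    ultimately show ?case by simp
  qed
qed

section \<open>Resolution and parity constraints\<close>

text \<open>Stating derivability for a set of clauses at once hides the positions in the sequence
  and counts a clause only once even if it serves as a premise many times.\<close>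

definition derives :: "'v clause set \<Rightarrow> nat \<Rightarrow> nat \<Rightarrow> 'v clause set \<Rightarrow> bool" where
  "derives F w n S \<longleftrightarrow> (\<exists>\<pi>. (\<forall>m < length \<pi>. valid_step F \<pi> m) \<and> length \<pi> \<le> n \<and>
     (\<forall>s \<in> set \<pi>. card (fst s) \<le> w) \<and> S \<subseteq> fst ` set \<pi>)"

lemma valid_step_append:
  assumes "m < length \<pi>"
  shows "valid_step F (\<pi> @ \<rho>) m \<longleftrightarrow> valid_step F \<pi> m"
  using assms unfolding valid_step_def
  by (auto simp: nth_append split: justification.splits)

lemma derives_empty: "derives F w 0 {}"
  unfolding derives_def by (intro exI[of _ "[]"]) auto

lemma derives_mono: "derives F w n S \<Longrightarrow> n \<le> n' \<Longrightarrow> S' \<subseteq> S \<Longrightarrow> derives F w n' S'"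
  unfolding derives_def by (meson le_trans subset_trans)

lemma derives_insert:
  assumes "derives F w n S" "is_clause D" "card D \<le> w"
    and "D \<in> F \<or> (\<exists>A\<in>S. \<exists>B\<in>S. resolvent A B D)"
  shows "derives F w (Suc n) (insert D S)"
proof -
  obtain \<pi> where \<pi>: "\<forall>m < length \<pi>. valid_step F \<pi> m" "length \<pi> \<le> n"
    "\<forall>s \<in> set \<pi>. card (fst s) \<le> w" "S \<subseteq> fst ` set \<pi>"
    using assms(1) unfolding derives_def by blast
  have "\<exists>j. valid_step F (\<pi> @ [(D, j)]) (length \<pi>)"
  proof (cases "D \<in> F")
    case True
    then show ?thesis using assms(2)
      by (intro exI[of _ Axiom]) (simp add: valid_step_def)
  next
    case False
    then obtain A B where AB: "A \<in> S" "B \<in> S" "resolvent A B D" using assms(4) by blast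
    then have "A \<in> fst ` set \<pi>" "B \<in> fst ` set \<pi>" using \<pi>(4) by auto
    then obtain i j where "i < length \<pi>" "fst (\<pi> ! i) = A" "j < length \<pi>" "fst (\<pi> ! j) = B"
      by (auto simp: in_set_conv_nth)
    then show ?thesis using assms(2) AB(3)
      by (intro exI[of _ "Resolved i j"]) (simp add: valid_step_def nth_append)
  qed
  then obtain j where j: "valid_step F (\<pi> @ [(D, j)]) (length \<pi>)" ..
  have "valid_step F (\<pi> @ [(D, j)]) m" if "m < Suc (length \<pi>)" for m
    using \<pi>(1) j that by (cases "m = length \<pi>") (auto simp: valid_step_append)
  then show ?thesis
    unfolding derives_def using \<pi> assms(3)
    by (intro exI[of _ "\<pi> @ [(D, j)]"]) auto
qed

lemma derives_Un:
  assumes "finite E" "derives F w n S"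
    and "\<And>D. D \<in> E \<Longrightarrow> is_clause D \<and> card D \<le> w \<and>
           (D \<in> F \<or> (\<exists>A\<in>S. \<exists>B\<in>S. resolvent A B D))"
  shows "derives F w (n + card E) (S \<union> E)"
  using assms(1,3)
proof (induction E rule: finite_induct)
  case empty
  then show ?case using assms(2) by simp
next
  case (insert D E)
  have "derives F w (Suc (n + card E)) (insert D (S \<union> E))"
    using insert.IH insert.prems by (intro derives_insert) blast+
  then show ?case using insert.hyps by simp
qed

text \<open>The empty clause need not come last, so its justification is repeated at the end; this
  is the extra 1 in the size. The clause \<open>D\<close> makes the width exactly \<open>w\<close>
  instead of at most \<open>w\<close>.\<close>

lemma derives_imp_refutation:
  assumes "derives F w n S" "{} \<in> S" "D \<in> S" "card D = w"
  shows "\<exists>\<pi>. refutation F \<pi> \<and> res_width \<pi> = w \<and> res_size \<pi> \<le> Suc n"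
proof -
  obtain \<pi> where \<pi>: "\<forall>m < length \<pi>. valid_step F \<pi> m" "length \<pi> \<le> n"
    "\<forall>s \<in> set \<pi>. card (fst s) \<le> w" "S \<subseteq> fst ` set \<pi>"
    using assms(1) unfolding derives_def by blast
  have "{} \<in> fst ` set \<pi>" using \<pi>(4) assms(2) by auto
  then obtain m where m: "m < length \<pi>" "fst (\<pi> ! m) = {}"
    by (auto simp: in_set_conv_nth)
  define \<rho> where "\<rho> = \<pi> @ [({}, snd (\<pi> ! m))]"
  have last: "valid_step F \<rho> (length \<pi>)"
    using \<pi>(1) m unfolding valid_step_def \<rho>_def
    by (fastforce simp: nth_append split: justification.splits)
  have "valid_step F \<rho> i" if "i < length \<rho>" for i
    using \<pi>(1) last that by (cases "i = length \<pi>") (auto simp: valid_step_append \<rho>_def)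
  then have "refutation F \<rho>" by (simp add: refutation_def \<rho>_def)
  moreover have "res_width \<rho> = w"
  proof -
    have "D \<in> fst ` set \<rho>" using assms(3) \<pi>(4) by (auto simp: \<rho>_def)
    then have "w \<in> (\<lambda>s. card (fst s)) ` set \<rho>" using assms(4) by force
    moreover have "x \<le> w" if "x \<in> (\<lambda>s. card (fst s)) ` set \<rho>" for x
      using that \<pi>(3) by (auto simp: \<rho>_def)
    ultimately show ?thesis unfolding res_width_def by (intro Max_eqI) auto
  qed
  ultimately show ?thesis using \<pi>(2) by (intro exI[of _ \<rho>]) (simp add: res_size_def \<rho>_def)
qed

section \<open>Soundness and lower bounds on depth\<close>

lemma refutation_sound:
  assumes "refutation F \<pi>"
  shows "\<not> satisfiable F"
proof
  assume "satisfiable F"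
  then obtain \<alpha> where \<alpha>: "\<forall>C\<in>F. \<exists>l\<in>C. lit_true \<alpha> l" unfolding satisfiable_def by blast
  have "\<exists>l\<in>fst (\<pi> ! m). lit_true \<alpha> l" if "m < length \<pi>" for m
    using that
  proof (induction m rule: less_induct)
    case (less m)
    then have v: "valid_step F \<pi> m" using assms by (simp add: refutation_def)
    show ?case
    proof (cases "snd (\<pi> ! m)")
      case Axiom
      then show ?thesis using v \<alpha> by (simp add: valid_step_def)
    next
      case (Resolved i j)
      then have ij: "i < m" "j < m" "resolvent (fst (\<pi> ! i)) (fst (\<pi> ! j)) (fst (\<pi> ! m))"
        using v by (auto simp: valid_step_def)
      then have "\<exists>l\<in>fst (\<pi> ! i). lit_true \<alpha> l" "\<exists>l\<in>fst (\<pi> ! j). lit_true \<alpha> l"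
        using less by auto
      then show ?thesis using ij(3) unfolding resolvent_def by auto
    qed
  qed
  moreover have "\<pi> \<noteq> []" "fst (last \<pi>) = {}" using assms by (auto simp: refutation_def)
  ultimately show False by (metis empty_iff last_conv_nth length_greater_0_conv diff_less zero_less_one)
qed

lemma res_edges_relpow_bound:
  assumes "refutation F \<pi>" "(i, m) \<in> res_edges \<pi> ^^ d"
  shows "i + d \<le> m \<and> (d > 0 \<longrightarrow> m < length \<pi>)"
  using assms(2)
proof (induction d arbitrary: m)
  case 0
  then show ?case by simp
next
  case (Suc d)
  then obtain k where k: "(i, k) \<in> res_edges \<pi> ^^ d" "(k, m) \<in> res_edges \<pi>" by auto
  then have "m < length \<pi>" by (auto simp: res_edges_def)
  moreover have "valid_step F \<pi> m" using assms(1) calculation by (simp add: refutation_def)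
  then have "k < m" using k(2) by (auto simp: res_edges_def valid_step_def)
  ultimately show ?case using Suc.IH[OF k(1)] by auto
qed

lemma res_depth_ge:
  assumes "refutation F \<pi>" "(i, m) \<in> res_edges \<pi> ^^ d"
  shows "d \<le> res_depth \<pi>"
proof -
  have "{d. \<exists>i m. (i, m) \<in> res_edges \<pi> ^^ d} \<subseteq> {..length \<pi>}"
  proof
    fix d assume "d \<in> {d. \<exists>i m. (i, m) \<in> res_edges \<pi> ^^ d}"
    then obtain i m where "(i, m) \<in> res_edges \<pi> ^^ d" by blast
    then show "d \<in> {..length \<pi>}" using res_edges_relpow_bound[OF assms(1)] by fastforce
  qed
  then have "finite {d. \<exists>i m. (i, m) \<in> res_edges \<pi> ^^ d}" by (rule finite_subset) simp
  then show ?thesis unfolding res_depth_def using assms(2) by (intro Max_ge) auto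
qed

lemma card_var_image: "is_clause C \<Longrightarrow> card (var ` C) = card C"
  by (simp add: is_clause_def card_image)

lemma lit_true_cong: "\<alpha> (var l) = \<beta> (var l) \<Longrightarrow> lit_true \<alpha> l = lit_true \<beta> l"
  by (cases l) auto

text \<open>A walk from the empty clause towards the axioms along falsified clauses.
  \<open>S\<close> holds the variables of the current clause and \<open>r\<close> the number of
  steps still guaranteed. The adversary may change the assignment outside \<open>S\<close>; since
  the premise is not known in advance, the invariant is required for every narrow subset of
  \<open>insert x S\<close>. By \<open>sat\<close> the walk cannot stop at an axiom.\<close>

lemma res_depth_adversary:
  fixes F :: "'v clause set"
  assumes ref: "refutation F \<pi>" and width: "res_width \<pi> \<le> w"
    and init: "Inv r {} \<alpha>0"
    and step: "\<And>r S \<alpha> x. Inv (Suc r) S \<alpha> \<Longrightarrow> finite S \<Longrightarrow> card S \<le> w \<Longrightarrow>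
       \<exists>\<beta>. (\<forall>v\<in>S. \<beta> v = \<alpha> v) \<and> (\<forall>S'. S' \<subseteq> insert x S \<longrightarrow> card S' \<le> w \<longrightarrow> Inv r S' \<beta>)"
    and sat: "\<And>r S \<alpha> C. Inv r S \<alpha> \<Longrightarrow> C \<in> F \<Longrightarrow> var ` C \<subseteq> S \<Longrightarrow> \<exists>l\<in>C. lit_true \<alpha> l"
  shows "r \<le> res_depth \<pi>"
proof -
  have valid: "valid_step F \<pi> m" if "m < length \<pi>" for m using ref that by (simp add: refutation_def)
  have cl: "is_clause (fst (\<pi> ! m))" "card (fst (\<pi> ! m)) \<le> w" if "m < length \<pi>" for m
  proof -
    show "is_clause (fst (\<pi> ! m))" using valid[OF that] by (simp add: valid_step_def)
    have "card (fst (\<pi> ! m)) \<le> res_width \<pi>"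
      unfolding res_width_def using that by (intro Max_ge) auto
    then show "card (fst (\<pi> ! m)) \<le> w" using width by simp
  qed
  have path: "\<exists>i. (i, m) \<in> res_edges \<pi> ^^ r"
    if "m < length \<pi>" "Inv r (var ` fst (\<pi> ! m)) \<alpha>" "\<forall>l\<in>fst (\<pi> ! m). \<not> lit_true \<alpha> l" for r m \<alpha>
    using that
  proof (induction r arbitrary: m \<alpha>)
    case 0
    then show ?case by auto
  next
    case (Suc r)
    let ?C = "fst (\<pi> ! m)"
    have "?C \<notin> F" using sat[OF Suc.prems(2)] Suc.prems(3) by blast
    then obtain i j where ij: "snd (\<pi> ! m) = Resolved i j" "i < m" "j < m"
      "resolvent (fst (\<pi> ! i)) (fst (\<pi> ! j)) ?C"
      using valid[OF Suc.prems(1)] by (auto simp: valid_step_def split: justification.splits)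
    then obtain x A B where AB: "fst (\<pi> ! i) = insert (Pos x) A" "fst (\<pi> ! j) = insert (Neg x) B"
      "?C = A \<union> B" unfolding resolvent_def by blast
    have C: "finite (var ` ?C)" "card (var ` ?C) \<le> w"
      using cl[OF Suc.prems(1)] card_var_image[OF cl(1)[OF Suc.prems(1)]]
      by (auto simp: is_clause_def)
    from step[OF Suc.prems(2) C, of x]
    obtain \<beta> where \<beta>: "\<forall>v\<in>var ` ?C. \<beta> v = \<alpha> v"
      "\<forall>S'. S' \<subseteq> insert x (var ` ?C) \<longrightarrow> card S' \<le> w \<longrightarrow> Inv r S' \<beta>"
      by (elim exE conjE) (rule that)
    have false: "\<not> lit_true \<beta> l" if "l \<in> ?C" for l
      using Suc.prems(3) \<beta>(1) that lit_true_cong[of \<beta> l \<alpha>] by blast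
    \<comment> \<open>The value of the pivot under \<open>\<beta>\<close> selects the premise that
      is falsified.\<close>
    have "\<exists>k. (k = i \<or> k = j) \<and> (\<forall>l\<in>fst (\<pi> ! k). \<not> lit_true \<beta> l) \<and> var ` fst (\<pi> ! k) \<subseteq> insert x (var ` ?C)"
    proof (cases "\<beta> x")
      case True
      then show ?thesis using AB false by (intro exI[of _ j]) auto
    next
      case False
      then show ?thesis using AB false by (intro exI[of _ i]) auto
    qed
    then obtain k where k: "k = i \<or> k = j" "\<forall>l\<in>fst (\<pi> ! k). \<not> lit_true \<beta> l"
      "var ` fst (\<pi> ! k) \<subseteq> insert x (var ` ?C)" by blast
    have kl: "k < length \<pi>" using k(1) ij Suc.prems(1) by auto
    have "Inv r (var ` fst (\<pi> ! k)) \<beta>"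
      using \<beta>(2) k(3) cl[OF kl] card_var_image by metis
    then obtain p where p: "(p, k) \<in> res_edges \<pi> ^^ r" using Suc.IH[OF kl _ k(2)] by blast
    have "(k, m) \<in> res_edges \<pi>" using k(1) ij Suc.prems(1) by (auto simp: res_edges_def)
    with p show ?case by auto
  qed
  have "\<pi> \<noteq> []" "fst (last \<pi>) = {}" using ref by (auto simp: refutation_def)
  then have "length \<pi> - 1 < length \<pi>" "fst (\<pi> ! (length \<pi> - 1)) = {}"
    by (auto simp: last_conv_nth)
  then obtain i where "(i, length \<pi> - 1) \<in> res_edges \<pi> ^^ r"
    using path[of "length \<pi> - 1" r \<alpha>0] init by auto
  then show ?thesis by (rule res_depth_ge[OF ref])
qed

text \<open>This settles the finitely many small \<open>n\<close>, for which there may be too few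
  primes and the claimed depth is at most 1.\<close>

lemma res_depth_pos:
  assumes "refutation F \<pi>" "{} \<notin> F"
  shows "1 \<le> res_depth \<pi>"
proof -
  let ?m = "length \<pi> - 1"
  have m: "?m < length \<pi>" "fst (\<pi> ! ?m) = {}" "valid_step F \<pi> ?m"
    using assms(1) by (auto simp: refutation_def last_conv_nth)
  then obtain i j where "snd (\<pi> ! ?m) = Resolved i j"
    using assms(2) by (auto simp: valid_step_def split: justification.splits)
  then have "(i, ?m) \<in> res_edges \<pi> ^^ 1" using m(1) by (auto simp: res_edges_def)
  then show ?thesis by (rule res_depth_ge[OF assms(1)])
qed

section \<open>Linear equations modulo 2 as clauses\<close>

text \<open>The clause over \<open>X\<close> that is falsified precisely by the assignments whose
  true variables in \<open>X\<close> are those of \<open>Y\<close>.\<close>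

definition lits :: "'v set \<Rightarrow> 'v set \<Rightarrow> 'v clause" where
  "lits X Y = Neg ` (X \<inter> Y) \<union> Pos ` (X - Y)"

text \<open>The canonical CNF of a parity equation with right-hand side \<open>p\<close>: one clause
  for each violating assignment.\<close>

definition xor_clauses :: "'v set \<Rightarrow> bool \<Rightarrow> 'v clause set" where
  "xor_clauses X p = lits X ` {Y. Y \<subseteq> X \<and> odd (card Y) \<noteq> p}"

lemma var_lits: "var ` lits X Y = X"
  by (force simp: lits_def image_Un image_image)

lemma is_clause_lits: "finite X \<Longrightarrow> is_clause (lits X Y)"
  by (auto simp: is_clause_def lits_def inj_on_def)

lemma card_lits: "finite X \<Longrightarrow> card (lits X Y) = card X"
  using card_var_image[OF is_clause_lits, of X Y] by (simp add: var_lits)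

lemma lits_false_iff: "(\<forall>l\<in>lits X Y. \<not> lit_true \<alpha> l) \<longleftrightarrow> (\<forall>x\<in>X. \<alpha> x \<longleftrightarrow> x \<in> Y)"
proof -
  have "(\<forall>l\<in>lits X Y. \<not> lit_true \<alpha> l) \<longleftrightarrow> (\<forall>x\<in>X \<inter> Y. \<alpha> x) \<and> (\<forall>x\<in>X - Y. \<not> \<alpha> x)"
    by (simp add: lits_def ball_Un)
  then show ?thesis by blast
qed

lemma xor_clauses_satisfied:
  assumes "C \<in> xor_clauses X p" "odd (card {x\<in>X. \<alpha> x}) = p"
  shows "\<exists>l\<in>C. lit_true \<alpha> l"
proof (rule ccontr)
  assume "\<not> ?thesis"
  then obtain Y where Y: "Y \<subseteq> X" "odd (card Y) \<noteq> p" "\<forall>x\<in>X. \<alpha> x \<longleftrightarrow> x \<in> Y"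
    using assms(1) by (auto simp: xor_clauses_def lits_false_iff[symmetric])
  then have "{x\<in>X. \<alpha> x} = Y" by auto
  then show False using Y(2) assms(2) by simp
qed

lemma finite_xor_clauses: "finite X \<Longrightarrow> finite (xor_clauses X p)"
  by (auto simp: xor_clauses_def)

lemma card_lits_image: "finite X \<Longrightarrow> T \<subseteq> Pow X \<Longrightarrow> card (lits X ` T) \<le> 2 ^ card X"
  by (metis card_Pow card_image_le card_mono finite_Pow_iff finite_subset le_trans)

lemma card_xor_clauses: "finite X \<Longrightarrow> card (xor_clauses X p) \<le> 2 ^ card X"
  unfolding xor_clauses_def by (rule card_lits_image) auto

lemma resolvent_lits:
  assumes "u \<in> X" "u \<in> Y" "u \<notin> A" "u \<in> B"
    and "\<And>x. x \<in> X \<Longrightarrow> x \<noteq> u \<Longrightarrow> x \<in> A \<longleftrightarrow> x \<in> Z" "\<And>x. x \<in> Y \<Longrightarrow> x \<noteq> u \<Longrightarrow> x \<in> B \<longleftrightarrow> x \<in> Z"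
  shows "resolvent (lits X A) (lits Y B) (lits (X \<union> Y - {u}) Z)"
  unfolding resolvent_def
  using assms
  by (intro exI[of _ u] exI[of _ "lits (X - {u}) Z"] exI[of _ "lits (Y - {u}) Z"])
     (auto simp: lits_def)

lemma odd_card_insert_Int:
  assumes "finite Z" "v \<notin> Z"
  shows "odd (card (insert v Z \<inter> X)) \<longleftrightarrow> (odd (card (Z \<inter> X)) \<noteq> (v \<in> X))"
  using assms by (cases "v \<in> X") auto

text \<open>Addition of two equations with one or two common variables. Resolving on
  \<open>u\<close> yields clauses in which a second common variable \<open>v\<close> still occurs
  although it has cancelled; resolving the two clauses that differ only in \<open>v\<close> removes
  it. Each round costs at most 2^w clauses. The last conjunct exhibits a clause of the largest
  width, for later use in an exact width.\<close>

lemma derives_xor_step: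
  assumes der: "derives F w n S" "xor_clauses X p \<subseteq> S" "xor_clauses Y q \<subseteq> S"
    and fin: "finite X" "finite Y" and u: "u \<in> X" "u \<in> Y" and XY: "X \<inter> Y \<subseteq> {u, v}"
    and w: "card (X \<union> Y) \<le> Suc w"
  shows "\<exists>S'. S \<subseteq> S' \<and> derives F w (n + 2 * 2 ^ w) S' \<and>
     xor_clauses ((X - Y) \<union> (Y - X)) (p \<noteq> q) \<subseteq> S' \<and>
     (X \<noteq> Y \<longrightarrow> (\<exists>D\<in>S'. card D = card (X \<union> Y) - 1))"
proof -
  define W where "W = X \<union> Y - {u}"
  define T where "T = (X - Y) \<union> (Y - X)"
  \<comment> \<open>Parities are taken on \<open>Z \<inter> X\<close> and
    \<open>Z \<inter> Y\<close> separately, so that a common \<open>v\<close> counts twice and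
    cancels.\<close>
  define E where "E = lits W ` {Z. Z \<subseteq> W \<and> (odd (card (Z \<inter> X)) \<noteq> odd (card (Z \<inter> Y))) \<noteq> (p \<noteq> q)}"
  have finW: "finite W" "finite T" using fin by (auto simp: W_def T_def)
  have cW: "card W = card (X \<union> Y) - 1" using u fin by (simp add: W_def)
  then have cWw: "card W \<le> w" using w by simp
  have resE: "\<exists>A\<in>S. \<exists>B\<in>S. resolvent A B D" if "D \<in> E" for D
  proof -
    obtain Z where Z: "Z \<subseteq> W" "(odd (card (Z \<inter> X)) \<noteq> odd (card (Z \<inter> Y))) \<noteq> (p \<noteq> q)" "D = lits W Z"
      using \<open>D \<in> E\<close> by (auto simp: E_def)
    have uZ: "u \<notin> Z" "finite Z" using Z(1) finW finite_subset by (auto simp: W_def)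
    define A B where "A = Z \<inter> X" and "B = Z \<inter> Y"
    have fAB: "finite A" "finite B" "u \<notin> A" "u \<notin> B" using uZ by (auto simp: A_def B_def)
    \<comment> \<open>\<open>Z\<close> leaves \<open>u\<close> open. Exactly one value of
      \<open>u\<close> violates the equation of \<open>X\<close>, and by the parity condition on
      \<open>Z\<close> the opposite value violates that of \<open>Y\<close>; these are the two
      premises.\<close>
    show ?thesis
    proof (cases "odd (card A) \<noteq> p")
      case True
      then have "odd (card (insert u B)) \<noteq> q" using Z(2) fAB by (auto simp: A_def B_def)
      then have "lits X A \<in> S" "lits Y (insert u B) \<in> S"
        using True der u by (auto simp: xor_clauses_def A_def B_def)
      moreover have "resolvent (lits X A) (lits Y (insert u B)) (lits (X \<union> Y - {u}) Z)"
        using u fAB by (intro resolvent_lits) (auto simp: A_def B_def)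
      ultimately show ?thesis using Z(3) by (auto simp: W_def)
    next
      case False
      then have "odd (card (insert u A)) \<noteq> p" "odd (card B) \<noteq> q" using Z(2) fAB by (auto simp: A_def B_def)
      then have "lits X (insert u A) \<in> S" "lits Y B \<in> S"
        using der u by (auto simp: xor_clauses_def A_def B_def)
      moreover have "resolvent (lits Y B) (lits X (insert u A)) (lits (Y \<union> X - {u}) Z)"
        using u fAB by (intro resolvent_lits) (auto simp: A_def B_def)
      ultimately show ?thesis using Z(3) by (auto simp: W_def Un_commute)
    qed
  qed
  have cE: "card E \<le> 2 ^ w" and finE: "finite E"
  proof -
    have "card E \<le> 2 ^ card W" unfolding E_def using finW by (intro card_lits_image) auto
    also have "\<dots> \<le> 2 ^ w" using cWw by (intro power_increasing) auto
    finally show "card E \<le> 2 ^ w" .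
    show "finite E" unfolding E_def using finW by auto
  qed
  have derE: "derives F w (n + card E) (S \<union> E)"
    using finE der(1)
  proof (rule derives_Un)
    fix D assume "D \<in> E"
    then show "is_clause D \<and> card D \<le> w \<and> (D \<in> F \<or> (\<exists>A\<in>S. \<exists>B\<in>S. resolvent A B D))"
      using resE[OF \<open>D \<in> E\<close>] finW cWw by (auto simp: E_def is_clause_lits card_lits)
  qed
  have parT: "odd (card Z) \<longleftrightarrow> odd (card (Z \<inter> X)) \<noteq> odd (card (Z \<inter> Y))" if "Z \<subseteq> T" for Z
  proof -
    have "finite Z" using finite_subset[OF that finW(2)] .
    moreover have "Z = (Z \<inter> X) \<union> (Z \<inter> Y)" "(Z \<inter> X) \<inter> (Z \<inter> Y) = {}" using that by (auto simp: T_def)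
    ultimately have "card Z = card (Z \<inter> X) + card (Z \<inter> Y)"
      by (metis card_Un_disjoint finite_Int)
    then show ?thesis by simp
  qed
  have wide: "\<exists>D\<in>E. card D = card (X \<union> Y) - 1" if ne: "X \<noteq> Y"
  proof -
    obtain z where z: "z \<in> T" "z \<noteq> u" using ne u by (auto simp: T_def)
    have TW: "T \<subseteq> W" using u by (auto simp: T_def W_def)
    have "\<exists>Z \<in> {{}, {z}}. odd (card Z) \<noteq> (p \<noteq> q)" by (cases "p \<noteq> q") auto
    then obtain Z where "Z \<in> {{}, {z}}" and Z2: "odd (card Z) \<noteq> (p \<noteq> q)" by blast
    then have Z: "Z \<subseteq> T" "odd (card Z) \<noteq> (p \<noteq> q)" using z(1) by auto
    then have "lits W Z \<in> E" using parT[OF Z(1)] TW by (auto simp: E_def)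
    then show ?thesis using card_lits[OF finW(1), of Z] cW by force
  qed
  define E2 where "E2 = (if v \<in> X \<inter> Y \<and> v \<noteq> u then xor_clauses T (p \<noteq> q) else {})"
  have res2: "\<exists>A\<in>S \<union> E. \<exists>B\<in>S \<union> E. resolvent A B D" if "D \<in> E2" for D
  proof -
    have v: "v \<in> X" "v \<in> Y" "v \<noteq> u" using that by (auto simp: E2_def split: if_splits)
    have "D \<in> xor_clauses T (p \<noteq> q)" using that v by (simp add: E2_def)
    then obtain Z where Z: "Z \<subseteq> T" "odd (card Z) \<noteq> (p \<noteq> q)" "D = lits T Z"
      unfolding xor_clauses_def by blast
    have vZ: "v \<notin> Z" "finite Z" using Z(1) v finW finite_subset by (auto simp: T_def)
    have TW: "T = W \<union> W - {v}" using XY v u by (auto simp: T_def W_def)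
    have "lits W Z \<in> E" using Z(1,2) parT[OF Z(1)] TW by (auto simp: E_def)
    moreover have "lits W (insert v Z) \<in> E"
      unfolding E_def
    proof (rule imageI, rule CollectI, rule conjI)
      show "insert v Z \<subseteq> W" using Z(1) v TW by (auto simp: W_def)
      show "(odd (card (insert v Z \<inter> X)) \<noteq> odd (card (insert v Z \<inter> Y))) \<noteq> (p \<noteq> q)"
        unfolding odd_card_insert_Int[OF vZ(2,1)] using Z(2) parT[OF Z(1)] v by blast
    qed
    moreover have "resolvent (lits W Z) (lits W (insert v Z)) (lits (W \<union> W - {v}) Z)"
      using v vZ by (intro resolvent_lits) (auto simp: W_def)
    ultimately show ?thesis using Z(3) TW by auto
  qed
  have TWsub: "card T \<le> card W" using u finW by (intro card_mono) (auto simp: T_def W_def)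
  have cE2: "card E2 \<le> 2 ^ w" and finE2: "finite E2"
  proof -
    have "card E2 \<le> 2 ^ card T" unfolding E2_def using finW by (auto intro: card_xor_clauses)
    also have "\<dots> \<le> 2 ^ w" using cWw TWsub by (intro power_increasing) auto
    finally show "card E2 \<le> 2 ^ w" .
    show "finite E2" unfolding E2_def using finW by (auto intro: finite_xor_clauses)
  qed
  have derE2: "derives F w (n + card E + card E2) (S \<union> E \<union> E2)"
    using finE2 derE
  proof (rule derives_Un)
    fix D assume D: "D \<in> E2"
    then have "is_clause D \<and> card D \<le> w" using finW cWw TWsub
      by (auto simp: E2_def xor_clauses_def is_clause_lits card_lits split: if_splits)
    then show "is_clause D \<and> card D \<le> w \<and> (D \<in> F \<or> (\<exists>A\<in>S \<union> E. \<exists>B\<in>S \<union> E. resolvent A B D))"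
      using res2[OF D] by blast
  qed
  have "xor_clauses T (p \<noteq> q) \<subseteq> S \<union> E \<union> E2"
  proof (cases "v \<in> X \<inter> Y \<and> v \<noteq> u")
    case True
    then show ?thesis by (auto simp: E2_def)
  next
    case False
    then have "T = W" using XY u by (auto simp: T_def W_def)
    then have "xor_clauses T (p \<noteq> q) \<subseteq> E" using parT by (auto simp: xor_clauses_def E_def)
    then show ?thesis by auto
  qed
  moreover have "derives F w (n + 2 * 2 ^ w) (S \<union> E \<union> E2)"
    using derE2 by (rule derives_mono) (use cE cE2 in auto)
  ultimately show ?thesis using wide unfolding T_def[symmetric]
    by (intro exI[of _ "S \<union> E \<union> E2"]) auto
qed

section \<open>The compressed cylinder\<close>

locale lattice =
  fixes K c N :: int and p :: "int \<Rightarrow> int"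
  assumes c_ge: "3 \<le> c" and c_le: "c \<le> K - 3"
    and N_pos: "0 < N" and K_dvd_N: "K dvd N"
    and p_pos: "\<And>t. 1 \<le> p t"
begin

text \<open>A factor of every modulus, larger than \<open>4 * D\<close> and
  \<open>2 * (H + D)\<close>: offsets known modulo \<open>L\<close> are then known exactly. As a
  multiple of \<open>K\<close> it makes the identification respect rows.\<close>

definition L :: int where "L = 32 * K\<^sup>2"
text \<open>Each end holds \<open>2 * K\<close> disjoint blocks of \<open>2 * K\<close> positions,
  so fewer than \<open>2 * K\<close> variables leave one block untouched.\<close>

definition H :: int where "H = 4 * K\<^sup>2"
text \<open>Bounds the displacement along a path: at most \<open>2 * K + 1\<close> rounds of at most
  \<open>K\<close> each, and one more edge, give 2K^2 + 2K.\<close>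

definition D :: int where "D = 3 * K\<^sup>2"

text \<open>A prime belongs to \<open>c - 1\<close> consecutive rows of faces; the \<open>c\<close>
  rows of edges incident with these faces form its edge window. Hence identified edges have
  identified ends, and a walk from one edge row of the window to another, inside the window, passes
  only through faces that carry the prime.\<close>

definition face_window :: "int \<Rightarrow> int \<Rightarrow> bool" where
  "face_window t r \<longleftrightarrow> (r - t) mod K < c - 1"

definition edge_window :: "int \<Rightarrow> int \<Rightarrow> bool" where
  "edge_window t i \<longleftrightarrow> (i - t + 1) mod K < c"

definition face_mod :: "int \<Rightarrow> int" where
  "face_mod r = (\<Prod>t | t \<in> {0..<K} \<and> face_window t r. p t)"

definition edge_mod :: "int \<Rightarrow> int" where
  "edge_mod i = (\<Prod>t | t \<in> {0..<K} \<and> edge_window t i. p t)"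

text \<open>
  Faces are numbered along a helix: face \<open>z\<close> lies in row \<open>z mod K\<close>. The edge of kind \<open>e\<close> at position \<open>s\<close>
  joins face \<open>s\<close> to face \<open>head s e\<close> of the next row. An edge outside the middle segment is a variable
  of its own. Edges get even numbers; the odd ones are left for padding variables.
\<close>

definition mid :: "int \<Rightarrow> bool" where "mid s \<longleftrightarrow> 0 \<le> s \<and> s < N"

definition edge :: "int \<Rightarrow> bool \<Rightarrow> nat" where
  "edge s e = 2 * to_nat (e, mid s, if mid s then s mod (L * edge_mod s) else s)"

definition present :: "int \<Rightarrow> bool" where "present s \<longleftrightarrow> - H \<le> s \<and> s < N + H"

definition head :: "int \<Rightarrow> bool \<Rightarrow> int" where "head s e = (if e then s + 1 - K else s + 1)"

definition edges :: "(int \<times> bool) set \<Rightarrow> nat set" where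
  "edges A = (\<lambda>(s, e). edge s e) ` {(s, e) \<in> A. present s}"

text \<open>The four-cycle through the faces \<open>s\<close>, \<open>s + 1\<close>,
  \<open>s + K\<close>, \<open>s + K - 1\<close>. Every function on faces changes an even number of
  times around it.\<close>

definition cell :: "int \<Rightarrow> (int \<times> bool) set" where
  "cell s = {(s, False), (s + K, True), (s + K - 1, False), (s + K - 1, True)}"

text \<open>Each present edge position lies in two cells of the range used in \<open>grid\<close>,
  so with a single odd cell the constraints add up to 0 = 1.\<close>

definition charge :: "int \<Rightarrow> bool" where "charge s \<longleftrightarrow> s = N + H - K"

definition grid :: "nat clause set" where
  "grid = (\<Union>s\<in>{- H - K..<N + H}. xor_clauses (edges (cell s)) (charge s))"

lemma K_ge: "6 \<le> K" using c_ge c_le by simp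
lemma K_pos: "0 < K" using K_ge by simp
lemma H_ge: "24 * K \<le> H" using K_ge by (simp add: H_def power2_eq_square)
lemma L_pos: "0 < L" using K_ge by (simp add: L_def)
lemma K_dvd_L: "K dvd L" by (simp add: L_def power2_eq_square)
lemma K_dvd_H: "K dvd H" by (simp add: H_def power2_eq_square)

lemma face_window_cong:
  assumes "r mod K = r' mod K"
  shows "face_window t r \<longleftrightarrow> face_window t r'"
proof -
  have "(r - t) mod K = (r' - t) mod K" using assms by (simp add: mod_eq_dvd_iff)
  then show ?thesis by (simp add: face_window_def)
qed

lemma edge_window_cong:
  assumes "r mod K = r' mod K"
  shows "edge_window t r \<longleftrightarrow> edge_window t r'"
proof -
  have "(r - t + 1) mod K = (r' - t + 1) mod K" using assms by (simp add: mod_eq_dvd_iff)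
  then show ?thesis by (simp add: edge_window_def)
qed

lemma face_mod_cong: "r mod K = r' mod K \<Longrightarrow> face_mod r = face_mod r'"
  unfolding face_mod_def by (simp only: face_window_cong[of r r'])

lemma edge_mod_cong: "r mod K = r' mod K \<Longrightarrow> edge_mod r = edge_mod r'"
  unfolding edge_mod_def by (simp only: edge_window_cong[of r r'])

lemma p_gt_0: "0 < p t" using p_pos[of t] by linarith

lemma edge_mod_pos: "0 < edge_mod i"
  unfolding edge_mod_def by (intro prod_pos p_gt_0)

lemma succ_mod_cases: "(x + 1) mod K = (if x mod K = K - 1 then 0 else x mod K + 1)"
proof -
  have "(x + 1) mod K = (x mod K + 1) mod K" by (simp add: mod_simps)
  also have "\<dots> = (if x mod K = K - 1 then 0 else x mod K + 1)"
  proof (cases "x mod K = K - 1")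
    case True
    then show ?thesis by simp
  next
    case False
    then have "x mod K + 1 < K" "0 \<le> x mod K" using pos_mod_bound[OF K_pos, of x] pos_mod_sign[OF K_pos, of x] by auto
    then show ?thesis using False by (simp add: mod_pos_pos_trivial)
  qed
  finally show ?thesis .
qed

lemma face_window_imp_edge_window:
  "face_window t r \<Longrightarrow> edge_window t r"
  "face_window t (r + 1) \<Longrightarrow> edge_window t r"
proof -
  assume "face_window t r"
  then have "(r - t) mod K < c - 1" by (simp add: face_window_def)
  then show "edge_window t r"
    using succ_mod_cases[of "r - t"] c_le c_ge by (auto simp: edge_window_def)
next
  assume "face_window t (r + 1)"
  then show "edge_window t r" by (simp add: face_window_def edge_window_def algebra_simps)
qed

lemma finite_windows [simp]: "finite {t. 0 \<le> t \<and> t < K \<and> P t}"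
  by (rule finite_subset[of _ "{0..<K}"]) auto

lemma face_mod_dvd_edge_mod: "face_mod r dvd edge_mod r" "face_mod (r + 1) dvd edge_mod r"
  unfolding face_mod_def edge_mod_def
  using face_window_imp_edge_window by (auto intro!: prod_dvd_prod_subset)

lemma p_dvd_face_mod: "t \<in> {0..<K} \<Longrightarrow> face_window t r \<Longrightarrow> p t dvd face_mod r"
  unfolding face_mod_def by (intro dvd_prodI) auto

lemma p_dvd_edge_mod: "t \<in> {0..<K} \<Longrightarrow> edge_window t r \<Longrightarrow> p t dvd edge_mod r"
  unfolding edge_mod_def by (intro dvd_prodI) auto

lemma head_mod: "head s e mod K = (s + 1) mod K"
proof -
  have "(s + 1 - K) mod K = (s + 1) mod K" by (simp add: mod_eq_dvd_iff)
  then show ?thesis by (simp add: head_def)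
qed

lemma face_mod_head: "face_mod (head s e) = face_mod (s + 1)"
  by (rule face_mod_cong[OF head_mod])

lemma edge_eqD:
  assumes "edge s e = edge s' e'"
  shows "e = e'" "mid s \<longleftrightarrow> mid s'" "\<not> mid s \<Longrightarrow> s = s'"
    "s mod K = s' mod K" "L * edge_mod s dvd s - s'"
proof -
  have eq: "e = e'" "mid s \<longleftrightarrow> mid s'"
    "(if mid s then s mod (L * edge_mod s) else s) = (if mid s' then s' mod (L * edge_mod s') else s')"
    using assms by (auto simp: edge_def)
  show "e = e'" "mid s \<longleftrightarrow> mid s'" "\<not> mid s \<Longrightarrow> s = s'" using eq by auto
  have "s mod K = s' mod K \<and> L * edge_mod s dvd s - s'"
  proof (cases "mid s")
    case True
    then have m: "s mod (L * edge_mod s) = s' mod (L * edge_mod s')" using eq by simp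
    have mm: "x mod (L * y) mod K = x mod K" for x y
      using K_dvd_L by (simp add: mod_mod_cancel)
    have r: "s mod K = s' mod K" using arg_cong[OF m, of "\<lambda>x. x mod K"] by (simp only: mm)
    then have "edge_mod s' = edge_mod s" using edge_mod_cong[of s s'] by simp
    then show ?thesis using m r by (simp add: mod_eq_dvd_iff)
  next
    case False
    then show ?thesis using eq by auto
  qed
  then show "s mod K = s' mod K" "L * edge_mod s dvd s - s'" by auto
qed

text \<open>The identification of faces induced by that of edges. It is imposed at the ends as well,
  where edges are not identified.\<close>

definition face_eq :: "int \<Rightarrow> int \<Rightarrow> bool" where
  "face_eq z w \<longleftrightarrow> z mod K = w mod K \<and> L * face_mod w dvd z - w"

lemma face_eq_refl: "face_eq z z" by (simp add: face_eq_def)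

lemma face_eq_sym: "face_eq z w \<Longrightarrow> face_eq w z"
  unfolding face_eq_def using face_mod_cong[of z w] by (auto simp: dvd_diff_commute)

lemma face_eq_trans: "face_eq z w \<Longrightarrow> face_eq w x \<Longrightarrow> face_eq z x"
  unfolding face_eq_def using face_mod_cong[of w x] dvd_add[of "L * face_mod x" "z - w" "w - x"] by auto

lemma edge_eq_faces:
  assumes "edge s e = edge s' e'"
  shows "face_eq s s'" "face_eq (head s e) (head s' e')"
proof -
  note * = edge_eqD[OF assms]
  have em: "edge_mod s = edge_mod s'" using *(4) by (rule edge_mod_cong)
  have d: "L * face_mod s' dvd L * edge_mod s" "L * face_mod (s' + 1) dvd L * edge_mod s"
    unfolding em by (intro mult_dvd_mono dvd_refl face_mod_dvd_edge_mod)+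
  show "face_eq s s'" unfolding face_eq_def using *(4,5) d(1) dvd_trans by blast
  have "head s e - head s' e' = s - s'" using *(1) by (simp add: head_def)
  moreover have "(s + 1) mod K = (s' + 1) mod K" using *(4) by (simp add: succ_mod_cases)
  ultimately show "face_eq (head s e) (head s' e')"
    unfolding face_eq_def head_mod face_mod_head using *(5) d(2) dvd_trans by metis
qed

section \<open>Coboundaries, the seam and the flux\<close>

definition periodic :: "(int \<Rightarrow> bool) \<Rightarrow> bool" where
  "periodic h \<longleftrightarrow> (\<forall>z w. face_eq z w \<longrightarrow> h z = h w)"

definition cob :: "(int \<Rightarrow> bool) \<Rightarrow> int \<Rightarrow> bool \<Rightarrow> bool" where
  "cob h s e \<longleftrightarrow> h s \<noteq> h (head s e)"

text \<open>Row 0 is the seam: a closed curve once around the cylinder crosses it an odd number of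
  times, while a coboundary (\<open>cob h\<close>) sums to 0 along any closed curve. If the two
  agree on \<open>U\<close>, their sum is a change of the flux that \<open>U\<close> does not
  notice, and periodicity makes it a change of variables in the middle segment.\<close>

definition switchable :: "nat set \<Rightarrow> bool" where
  "switchable U \<longleftrightarrow> (\<exists>h. periodic h \<and>
     (\<forall>s e. present s \<longrightarrow> edge s e \<in> U \<longrightarrow> cob h s e = (s mod K = 0)))"

definition below :: "int \<Rightarrow> int \<Rightarrow> bool" where
  "below i z \<longleftrightarrow> 1 \<le> z mod K \<and> z mod K \<le> i"

lemma cob_below:
  assumes "0 \<le> i" "i < K"
  shows "cob (below i) s e = ((s mod K = 0) \<noteq> (s mod K = i))"
proof -
  define r where "r = s mod K"
  have "0 \<le> r" "r < K" using K_pos by (auto simp: r_def)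
  then show ?thesis
    using assms unfolding cob_def below_def head_mod succ_mod_cases r_def[symmetric] by auto
qed

text \<open>Adding the indicator of the rows \<open>1, \<dots>, i\<close> moves the seam from row 0 to row \<open>i\<close>.\<close>

lemma switchableI:
  assumes "0 \<le> i" "i < K" "periodic h"
    and "\<And>s e. present s \<Longrightarrow> edge s e \<in> U \<Longrightarrow> cob h s e = (s mod K = i)"
  shows "switchable U"
  unfolding switchable_def
proof (intro exI[of _ "\<lambda>z. h z \<noteq> below i z"] conjI allI impI)
  show "periodic (\<lambda>z. h z \<noteq> below i z)"
    unfolding periodic_def
  proof (intro allI impI)
    fix z w assume zw: "face_eq z w"
    then have "below i z = below i w" by (simp add: face_eq_def below_def)
    moreover have "h z = h w" using assms(3) zw unfolding periodic_def by blast
    ultimately show "(h z \<noteq> below i z) = (h w \<noteq> below i w)" by simp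
  qed
  fix s e assume "present s" "edge s e \<in> U"
  then have "cob h s e = (s mod K = i)" by (rule assms(4))
  moreover have "cob (\<lambda>z. h z \<noteq> below i z) s e = (cob h s e \<noteq> cob (below i) s e)"
    unfolding cob_def by argo
  ultimately show "cob (\<lambda>z. h z \<noteq> below i z) s e = (s mod K = 0)"
    unfolding cob_below[OF assms(1,2)] by argo
qed

definition crossing :: "nat set \<Rightarrow> int \<Rightarrow> nat set" where
  "crossing U i = {x \<in> U. \<exists>s e. present s \<and> s mod K = i \<and> x = edge s e}"

definition uniq :: "nat set \<Rightarrow> int \<Rightarrow> bool" where
  "uniq U i \<longleftrightarrow> 0 \<le> i \<and> i < K \<and> card (crossing U i) = 1"

text \<open>A common \<open>\<delta>\<close> for all the primes of a row: then the positions can be compared modulo \<open>L\<close> first,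
  where the small offsets cannot wrap around, and afterwards modulo each prime.\<close>

definition located :: "nat set \<Rightarrow> int \<Rightarrow> bool" where
  "located U a \<longleftrightarrow> (\<forall>i. uniq U i \<longrightarrow> (\<exists>\<delta>. \<bar>\<delta>\<bar> \<le> D \<and>
     (\<forall>s e t. present s \<longrightarrow> s mod K = i \<longrightarrow> edge s e \<in> U \<longrightarrow> t \<in> {0..<K} \<longrightarrow>
        edge_window t i \<longrightarrow> L * p t dvd s - a - \<delta>)))"

text \<open>A seam put into a row without variables of \<open>U\<close> is invisible to
  \<open>U\<close>.\<close>

lemma crossing_nonempty:
  assumes "\<not> switchable U" "0 \<le> i" "i < K"
  shows "crossing U i \<noteq> {}"
proof
  assume e: "crossing U i = {}"
  have "switchable U"
    by (rule switchableI[OF assms(2,3), of "\<lambda>_. False"]) (use e in \<open>auto simp: periodic_def cob_def crossing_def\<close>)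
  then show False using assms(1) by simp
qed

lemma uniq_edge_eq:
  assumes "uniq U i" "present s" "s mod K = i" "edge s e \<in> U" "present s'" "s' mod K = i" "edge s' e' \<in> U"
  shows "edge s e = edge s' e'"
proof -
  have "edge s e \<in> crossing U i" "edge s' e' \<in> crossing U i" using assms by (auto simp: crossing_def)
  moreover obtain x where "crossing U i = {x}" using assms(1) by (auto simp: uniq_def card_1_singleton_iff)
  ultimately show ?thesis by simp
qed

lemma switchable_mono:
  assumes "switchable U" "S \<subseteq> U"
  shows "switchable S"
proof -
  obtain h where "periodic h" "\<forall>s e. present s \<longrightarrow> edge s e \<in> U \<longrightarrow> cob h s e = (s mod K = 0)"
    using assms(1) by (auto simp: switchable_def)
  then show ?thesis unfolding switchable_def using assms(2) by (intro exI[of _ h]) auto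
qed

lemma uniq_subset:
  assumes "uniq U i" "S \<subseteq> U" "\<not> switchable S"
  shows "uniq S i"
proof -
  have i: "0 \<le> i" "i < K" "card (crossing U i) = 1" using assms(1) by (auto simp: uniq_def)
  then obtain x where "crossing U i = {x}" by (auto simp: card_1_singleton_iff)
  moreover have "crossing S i \<subseteq> crossing U i" using assms(2) by (auto simp: crossing_def)
  moreover have "crossing S i \<noteq> {}" using crossing_nonempty[OF assms(3) i(1,2)] .
  ultimately have "crossing S i = {x}" by (metis subset_singletonD)
  then show ?thesis using i by (simp add: uniq_def)
qed

section \<open>Walks inside a sector of rows\<close>

text \<open>The face rows i + 1, ..., j in cyclic order, that is, those between the edge rows
  \<open>i\<close> and \<open>j\<close>.\<close>

definition sector :: "int \<Rightarrow> int \<Rightarrow> int \<Rightarrow> bool" where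
  "sector i j r \<longleftrightarrow> (r - i - 1) mod K < (j - i) mod K"

lemma sector_cong:
  assumes "r mod K = r' mod K"
  shows "sector i j r = sector i j r'"
proof -
  have "(r - i - 1) mod K = (r' - i - 1) mod K" using assms by (simp add: mod_eq_dvd_iff)
  then show ?thesis by (simp add: sector_def)
qed

lemma diff_mod_eq_0: "(x - y) mod K = 0 \<longleftrightarrow> x mod K = y mod K"
  by (simp add: mod_eq_dvd_iff dvd_eq_mod_eq_0)

lemma sector_ends:
  assumes "0 \<le> i" "i < K" "0 \<le> j" "j < K" "i \<noteq> j"
  shows "\<not> sector i j i" "sector i j (i + 1)" "sector i j j" "\<not> sector i j (j + 1)"
proof -
  have ne: "(j - i) mod K \<noteq> 0"
    using assms by (simp add: diff_mod_eq_0)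
  moreover have b: "0 \<le> (j - i) mod K" "(j - i) mod K < K" using K_pos by auto
  moreover have m1: "(- 1 :: int) mod K = K - 1" using K_ge by (simp add: zmod_minus1)
  have "(j - i - 1 + 1) mod K = (j - i) mod K" by simp
  then have "(j - i - 1) mod K = (j - i) mod K - 1"
    using succ_mod_cases[of "j - i - 1"] ne by (auto split: if_splits)
  ultimately show "\<not> sector i j i" "sector i j (i + 1)" "sector i j j" "\<not> sector i j (j + 1)"
    unfolding sector_def using m1 by (auto simp: algebra_simps)
qed

lemma sector_step:
  assumes "0 \<le> i" "i < K" "0 \<le> j" "j < K" "i \<noteq> j" "r mod K \<noteq> i" "r mod K \<noteq> j"
  shows "sector i j r = sector i j (r + 1)"
proof -
  let ?w = "(r - i - 1) mod K"
  have b: "0 \<le> ?w" "?w < K" "0 \<le> (j - i) mod K" "(j - i) mod K < K" using K_pos by auto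
  have s: "(r - i) mod K = (if ?w = K - 1 then 0 else ?w + 1)"
    using succ_mod_cases[of "r - i - 1"] by simp
  have 1: "(r - i) mod K \<noteq> 0"
    using assms by (simp add: diff_mod_eq_0)
  have 2: "(r - i) mod K \<noteq> (j - i) mod K"
  proof
    assume "(r - i) mod K = (j - i) mod K"
    then have "r mod K = j mod K" by (simp add: mod_eq_dvd_iff)
    then show False using assms by simp
  qed
  have "sector i j (r + 1) \<longleftrightarrow> (r - i) mod K < (j - i) mod K" by (simp add: sector_def algebra_simps)
  then show ?thesis unfolding sector_def using s 1 2 b by (auto split: if_splits)
qed

text \<open>Breadth-first search in the quotient graph, along edges of \<open>U\<close> with both
  ends in the sector. Rounds are counted because they bound the displacement.\<close>

primrec reach :: "nat set \<Rightarrow> int \<Rightarrow> int \<Rightarrow> int \<Rightarrow> nat \<Rightarrow> int set" where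
  "reach U i j z0 0 = {z. face_eq z z0}"
| "reach U i j z0 (Suc n) = reach U i j z0 n \<union>
     {z. \<exists>s e. present s \<and> edge s e \<in> U \<and> sector i j s \<and> sector i j (s + 1) \<and>
        (s \<in> reach U i j z0 n \<and> face_eq z (head s e) \<or> head s e \<in> reach U i j z0 n \<and> face_eq z s)}"

lemma reach_mono: "n \<le> n' \<Longrightarrow> reach U i j z0 n \<subseteq> reach U i j z0 n'"
  by (rule lift_Suc_mono_le) auto

lemma reach_SucE:
  assumes "z \<in> reach U i j z0 (Suc n)"
  obtains "z \<in> reach U i j z0 n"
  | s e where "present s" "edge s e \<in> U" "sector i j s" "sector i j (s + 1)"
      "s \<in> reach U i j z0 n" "face_eq z (head s e)"
  | s e where "present s" "edge s e \<in> U" "sector i j s" "sector i j (s + 1)"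
      "head s e \<in> reach U i j z0 n" "face_eq z s"
  using assms unfolding reach.simps(2) by blast

lemma reach_SucI:
  assumes "present s" "edge s e \<in> U" "sector i j s" "sector i j (s + 1)"
  shows "s \<in> reach U i j z0 n \<Longrightarrow> face_eq z (head s e) \<Longrightarrow> z \<in> reach U i j z0 (Suc n)"
    and "head s e \<in> reach U i j z0 n \<Longrightarrow> face_eq z s \<Longrightarrow> z \<in> reach U i j z0 (Suc n)"
  using assms unfolding reach.simps(2) by blast+

lemma reach_both:
  assumes "present s" "edge s e \<in> U" "sector i j s" "sector i j (s + 1)"
    and "s \<in> reach U i j z0 n \<or> head s e \<in> reach U i j z0 n"
  shows "s \<in> reach U i j z0 (Suc n) \<and> head s e \<in> reach U i j z0 (Suc n)"
  using assms(5)
proof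
  assume *: "s \<in> reach U i j z0 n"
  show ?thesis
    using reach_SucI(1)[OF assms(1-4) * face_eq_refl] * by simp
next
  assume *: "head s e \<in> reach U i j z0 n"
  show ?thesis
    using reach_SucI(2)[OF assms(1-4) * face_eq_refl] * by simp
qed

lemma reach_face_eq: "z \<in> reach U i j z0 n \<Longrightarrow> face_eq z' z \<Longrightarrow> z' \<in> reach U i j z0 n"
proof (induction n arbitrary: z z')
  case 0
  then show ?case using face_eq_trans by simp
next
  case (Suc n)
  from Suc.prems(1) show ?case
  proof (cases rule: reach_SucE)
    case 1
    then show ?thesis using Suc.IH[OF 1 Suc.prems(2)] by simp
  next
    case (2 s e)
    show ?thesis by (rule reach_SucI(1)[OF 2(1-5)]) (rule face_eq_trans[OF Suc.prems(2) 2(6)])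
  next
    case (3 s e)
    show ?thesis by (rule reach_SucI(2)[OF 3(1-5)]) (rule face_eq_trans[OF Suc.prems(2) 3(6)])
  qed
qed

lemma sector_face_eq: "face_eq z w \<Longrightarrow> sector i j z = sector i j w"
  by (rule sector_cong) (simp add: face_eq_def)

lemma sector_head: "sector i j (head s e) = sector i j (s + 1)"
  by (rule sector_cong[OF head_mod])

lemma reach_sector:
  assumes "sector i j z0" "z \<in> reach U i j z0 n"
  shows "sector i j z"
  using assms(2)
proof (induction n arbitrary: z)
  case 0
  then show ?case using assms(1) sector_face_eq by simp
next
  case (Suc n)
  from Suc.prems show ?case
  proof (cases rule: reach_SucE)
    case 1
    then show ?thesis by (rule Suc.IH)
  next
    case (2 s e)
    then show ?thesis using sector_face_eq[OF 2(6)] sector_head by simp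
  next
    case (3 s e)
    then show ?thesis using sector_face_eq[OF 3(6)] by simp
  qed
qed

text \<open>Passing to an identified face inside the sector shifts by a multiple of
  \<open>L * q\<close>; only the at most \<open>n\<close> edges contribute to \<open>d\<close>, each
  at most \<open>K\<close>.\<close>

lemma reach_displacement:
  assumes q: "\<And>r. sector i j r \<Longrightarrow> q dvd face_mod r" and z0: "sector i j z0"
    and z: "z \<in> reach U i j z0 n"
  shows "\<exists>d. \<bar>d\<bar> \<le> int n * K \<and> L * q dvd z - z0 - d"
  using z
proof (induction n arbitrary: z)
  case 0
  then have "L * face_mod z0 dvd z - z0" by (simp add: face_eq_def)
  then have "L * q dvd z - z0" using q[OF z0] by (meson dvd_trans mult_dvd_mono dvd_refl)
  then show ?case by (intro exI[of _ 0]) auto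
next
  case (Suc n)
  have ex: "\<exists>d. \<bar>d\<bar> \<le> int (Suc n) * K \<and> L * q dvd z - z0 - d"
    if y: "y \<in> reach U i j z0 n" and yw: "\<bar>w - y\<bar> \<le> K" and zw: "face_eq z w" "sector i j w" for y w
  proof -
    obtain d where d: "\<bar>d\<bar> \<le> int n * K" "L * q dvd y - z0 - d" using Suc.IH[OF y] by blast
    have "L * q dvd z - w" using zw q[OF zw(2)] unfolding face_eq_def
      by (meson dvd_trans mult_dvd_mono dvd_refl)
    then have "L * q dvd (z - w) + (y - z0 - d)" using d(2) by (rule dvd_add)
    then have "L * q dvd z - z0 - (d + (w - y))" by (simp add: algebra_simps)
    moreover have "\<bar>d + (w - y)\<bar> \<le> int (Suc n) * K" using d(1) yw by (simp add: algebra_simps)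
    ultimately show ?thesis by blast
  qed
  from Suc.prems show ?case
  proof (cases rule: reach_SucE)
    case 1
    show ?thesis
      by (rule ex[OF 1 _ face_eq_refl reach_sector[OF z0 1]]) (use K_pos in simp)
  next
    case (2 s e)
    show ?thesis
      by (rule ex[OF 2(5) _ 2(6)]) (use K_ge 2(4) sector_head in \<open>auto simp: head_def\<close>)
  next
    case (3 s e)
    show ?thesis
      by (rule ex[OF 3(5) _ 3(6,3)]) (use K_ge in \<open>auto simp: head_def\<close>)
  qed
qed

text \<open>The number of variables touched by \<^term>\<open>reach\<close> bounds the number of rounds until it stabilises.\<close>

lemma reach_stable:
  assumes fin: "finite U"
  shows "\<exists>n \<le> card U. reach U i j z0 (Suc (Suc n)) = reach U i j z0 (Suc n)"
proof -
  define T where "T n = {x \<in> U. \<exists>s e. x = edge s e \<and> sector i j s \<and> sector i j (s + 1) \<and>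
     (s \<in> reach U i j z0 n \<or> head s e \<in> reach U i j z0 n)}" for n
  have TU: "T n \<subseteq> U" for n by (auto simp: T_def)
  have Tmono: "T n \<subseteq> T (Suc n)" for n unfolding T_def using reach_mono[of n "Suc n"] by auto
  have "\<exists>n \<le> card U. T (Suc n) = T n"
  proof (rule ccontr)
    assume "\<not> ?thesis"
    then have strict: "T n \<subset> T (Suc n)" if "n \<le> card U" for n using that Tmono by blast
    have "n \<le> card (T n)" if "n \<le> Suc (card U)" for n
      using that
    proof (induction n)
      case (Suc n)
      have "card (T n) < card (T (Suc n))"
        using strict[of n] Suc.prems finite_subset[OF TU fin] by (intro psubset_card_mono) auto
      then show ?case using Suc by simp
    qed simp
    from this[of "Suc (card U)"] show False using card_mono[OF fin TU[of "Suc (card U)"]] by simp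
  qed
  then obtain n where n: "n \<le> card U" "T (Suc n) = T n" by blast
  have both: "s \<in> reach U i j z0 (Suc n) \<and> head s e \<in> reach U i j z0 (Suc n)"
    if s: "present s" "edge s e \<in> U" "sector i j s" "sector i j (s + 1)"
      and r: "s \<in> reach U i j z0 (Suc n) \<or> head s e \<in> reach U i j z0 (Suc n)" for s e
  proof -
    have "edge s e \<in> T (Suc n)" using s r unfolding T_def by blast
    then have "edge s e \<in> T n" using n by simp
    then obtain s' e' where s': "edge s e = edge s' e'"
      "s' \<in> reach U i j z0 n \<or> head s' e' \<in> reach U i j z0 n"
      unfolding T_def by blast
    from s'(2) have "s \<in> reach U i j z0 n \<or> head s e \<in> reach U i j z0 n"
    proof
      assume "s' \<in> reach U i j z0 n"
      then show ?thesis using reach_face_eq[OF _ edge_eq_faces(1)[OF s'(1)]] by simp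
    next
      assume "head s' e' \<in> reach U i j z0 n"
      then show ?thesis using reach_face_eq[OF _ edge_eq_faces(2)[OF s'(1)]] by simp
    qed
    then show ?thesis by (rule reach_both[OF s])
  qed
  have "z \<in> reach U i j z0 (Suc n)" if z: "z \<in> reach U i j z0 (Suc (Suc n))" for z
    using z
  proof (cases rule: reach_SucE)
    case 1
    then show ?thesis .
  next
    case (2 s e)
    then have "head s e \<in> reach U i j z0 (Suc n)" using both[OF 2(1-4)] by blast
    then show ?thesis by (rule reach_face_eq[OF _ 2(6)])
  next
    case (3 s e)
    then have "s \<in> reach U i j z0 (Suc n)" using both[OF 3(1-4)] by blast
    then show ?thesis by (rule reach_face_eq[OF _ 3(6)])
  qed
  then have "reach U i j z0 (Suc (Suc n)) = reach U i j z0 (Suc n)"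
    using reach_mono[OF le_SucI[OF order_refl], of U i j z0 "Suc n"] by blast
  then show ?thesis using n(1) by blast
qed

text \<open>If the two ends could not be joined inside the sector, the indicator of the faces reached from
  one end would move the seam through the unique crossing, so that nothing in \<^term>\<open>U\<close> fixes the
  flux.\<close>

lemma unique_crossings_connected:
  assumes fin: "finite U" and card: "card U \<le> nat (2 * K)" and ns: "\<not> switchable U"
    and i: "uniq U i" and j: "uniq U j" and ij: "i \<noteq> j"
    and s: "present s" "s mod K = i" "edge s e \<in> U"
    and s': "present s'" "s' mod K = j" "edge s' e' \<in> U"
    and q: "\<And>r. sector i j r \<Longrightarrow> q dvd face_mod r"
  shows "\<exists>d. \<bar>d\<bar> \<le> D \<and> L * q dvd s' - s - d"
proof -
  have ib: "0 \<le> i" "i < K" "0 \<le> j" "j < K" using i j by (auto simp: uniq_def)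
  note ends = sector_ends[OF ib ij]
  have sector_mod: "sector i j r \<longleftrightarrow> sector i j (r mod K)" for r by (rule sector_cong) simp
  have sector_at: "sector i j r \<longleftrightarrow> False" "sector i j (r + 1)" if "r mod K = i" for r
    using ends(1,2) that sector_cong[of r i] sector_cong[of "r + 1" "i + 1"] ib by (auto simp: succ_mod_cases)
  have sector_at': "sector i j r" "\<not> sector i j (r + 1)" if "r mod K = j" for r
    using ends(3,4) that sector_cong[of r j] sector_cong[of "r + 1" "j + 1"] ib by (auto simp: succ_mod_cases)
  define z0 where "z0 = head s e"
  have z0: "sector i j z0" using sector_at(2)[OF s(2)] sector_cong[OF head_mod] by (simp add: z0_def)
  obtain n where n: "n \<le> card U" and stable: "reach U i j z0 (Suc (Suc n)) = reach U i j z0 (Suc n)"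
    using reach_stable[OF fin] by blast
  define R where "R = reach U i j z0 (Suc n)"
  have step: "s \<in> R \<longleftrightarrow> head s e \<in> R" if "present s" "edge s e \<in> U" "sector i j s" "sector i j (s + 1)" for s e
  proof -
    have "s \<in> R \<or> head s e \<in> R \<Longrightarrow> s \<in> R \<and> head s e \<in> R"
      using reach_both[OF that, of z0 "Suc n"] unfolding stable R_def[symmetric] .
    then show ?thesis by blast
  qed
  have R_sector: "sector i j z" if "z \<in> R" for z
    using reach_sector[OF z0 that[unfolded R_def]] .
  have "s' \<in> R"
  proof (rule ccontr)
    assume no: "s' \<notin> R"
    have "switchable U"
    proof (rule switchableI[OF ib(1,2), of "\<lambda>z. z \<in> R"])
      show "periodic (\<lambda>z. z \<in> R)"
        unfolding periodic_def R_def
        using reach_face_eq[of _ U i j z0 "Suc n"] face_eq_sym by metis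
      fix r f assume r: "present r" "edge r f \<in> U"
      have head_sector: "head r f \<in> R \<Longrightarrow> sector i j (r + 1)" using R_sector sector_cong[OF head_mod] by blast
      consider "r mod K = i" | "r mod K = j" | "r mod K \<noteq> i" "r mod K \<noteq> j" by blast
      then show "cob (\<lambda>z. z \<in> R) r f = (r mod K = i)"
      proof cases
        case 1
        have "face_eq (head r f) z0"
          unfolding z0_def using edge_eq_faces(2) uniq_edge_eq[OF i r(1) 1 r(2) s] by blast
        then have "head r f \<in> reach U i j z0 0" by simp
        then have "head r f \<in> R" unfolding R_def using reach_mono[OF le0[of "Suc n"], of U i j z0] by blast
        moreover have "r \<notin> R" using R_sector sector_at(1)[OF 1] by blast
        ultimately show ?thesis using 1 by (simp add: cob_def)
      next
        case 2
        have "face_eq s' r"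
          using edge_eq_faces(1) uniq_edge_eq[OF j s' r(1) 2 r(2)] by blast
        then have "r \<notin> R" using no reach_face_eq unfolding R_def by blast
        moreover have "head r f \<notin> R" using head_sector sector_at'(2)[OF 2] by blast
        ultimately show ?thesis using 2 ij by (simp add: cob_def)
      next
        case 3
        have "sector i j r = sector i j (r + 1)" using sector_step[OF ib ij 3] .
        then have "r \<in> R \<longleftrightarrow> head r f \<in> R" using step[OF r] R_sector head_sector by blast
        then show ?thesis using 3 by (simp add: cob_def)
      qed
    qed
    then show False using ns by simp
  qed
  then obtain d where d: "\<bar>d\<bar> \<le> int (Suc n) * K" "L * q dvd s' - z0 - d"
    using reach_displacement[OF q z0] unfolding R_def by blast
  have "int (Suc n) * K \<le> (2 * K + 1) * K" using n card K_pos by (intro mult_right_mono) auto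
  moreover have "\<bar>z0 - s\<bar> \<le> K" using K_ge by (auto simp: z0_def head_def)
  moreover have "(2 * K + 1) * K + K \<le> D" using K_ge by (simp add: D_def power2_eq_square algebra_simps)
  ultimately have "\<bar>d + (z0 - s)\<bar> \<le> D" using d(1) by linarith
  moreover have "L * q dvd s' - s - (d + (z0 - s))" using d(2) by (simp add: algebra_simps)
  ultimately show ?thesis by blast
qed

end

section \<open>Positions of flux-determining sets\<close>

lemma prod_dvd_of_pairwise_coprime:
  fixes f :: "'a \<Rightarrow> int"
  assumes "finite A" "\<And>x y. x \<in> A \<Longrightarrow> y \<in> A \<Longrightarrow> x \<noteq> y \<Longrightarrow> coprime (f x) (f y)"
    and "\<And>x. x \<in> A \<Longrightarrow> f x dvd z"
  shows "prod f A dvd z"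
  using assms
proof (induction A rule: finite_induct)
  case (insert a A)
  have "coprime (f a) (prod f A)"
    by (rule prod_coprime_right) (use insert in auto)
  then show ?case using insert by (simp add: divides_mult)
qed simp

lemma small_multiple_eq_0:
  fixes x :: int
  assumes "m dvd x" "\<bar>x\<bar> < m"
  shows "x = 0"
  using assms dvd_imp_le_int[of x m] by (cases "x = 0") auto

lemma shift_bound:
  fixes d d' M N X :: int
  assumes "\<bar>d\<bar> \<le> X" "\<bar>d'\<bar> \<le> X" "2 * X < N" "N + 2 * X < M"
  shows "\<bar>N + (d' - d)\<bar> < M" "N + (d' - d) \<noteq> 0"
  using assms by linarith+

context lattice
begin

lemma D_bounds: "4 * D < L" "2 * (H + D) < L" "0 < D" "0 < H"
  using K_ge by (simp_all add: D_def L_def H_def)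

text \<open>As \<open>c < K\<close>, offsets inside a window do not wrap around, so the arc from the
  earlier edge row to the later one consists of face rows of the same window.\<close>

lemma window_order:
  assumes i: "edge_window t i" and j: "edge_window t j"
    and lt: "(i - t + 1) mod K < (j - t + 1) mod K" and r: "sector i j r"
  shows "face_window t r"
proof -
  define a b w where "a = (i - t + 1) mod K" and "b = (j - t + 1) mod K" and "w = (r - i - 1) mod K"
  have bd: "0 \<le> a" "b < c" "0 \<le> w" "a < b"
    using K_pos j lt by (auto simp: a_def b_def w_def edge_window_def)
  have "(j - i) mod K = ((j - t + 1) - (i - t + 1)) mod K" by simp
  also have "\<dots> = (b - a) mod K" unfolding a_def b_def by (rule mod_diff_eq[symmetric])
  also have "\<dots> = b - a" using bd c_le by (intro mod_pos_pos_trivial) auto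
  finally have "w < b - a" using r by (simp add: sector_def w_def)
  have "(r - t) mod K = ((r - i - 1) + (i - t + 1)) mod K" by simp
  also have "\<dots> = (w + a) mod K" unfolding a_def w_def by (rule mod_add_eq[symmetric])
  also have "\<dots> = w + a" using bd c_le \<open>w < b - a\<close> by (intro mod_pos_pos_trivial) auto
  finally show ?thesis using bd \<open>w < b - a\<close> by (simp add: face_window_def)
qed

lemma window_sector:
  assumes "edge_window t i" "edge_window t j" "0 \<le> i" "i < K" "0 \<le> j" "j < K" "i \<noteq> j"
  shows "(\<forall>r. sector i j r \<longrightarrow> face_window t r) \<or> (\<forall>r. sector j i r \<longrightarrow> face_window t r)"
proof -
  have "(i - t + 1) mod K \<noteq> (j - t + 1) mod K"
  proof
    assume "(i - t + 1) mod K = (j - t + 1) mod K"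
    then have "i mod K = j mod K" by (simp add: mod_eq_dvd_iff)
    then show False using assms by simp
  qed
  then show ?thesis using window_order assms(1,2) by (meson linorder_neqE)
qed

lemma card_edge_window: "c \<le> int (card {i \<in> {0..<K}. edge_window t i})"
proof -
  let ?f = "\<lambda>j. (t - 1 + j) mod K"
  have "inj_on ?f {0..<c}"
  proof (rule inj_onI)
    fix x y assume *: "x \<in> {0..<c}" "y \<in> {0..<c}" "?f x = ?f y"
    then have "K dvd x - y" by (simp add: mod_eq_dvd_iff)
    moreover have "\<bar>x - y\<bar> < K" using * c_le by auto
    ultimately show "x = y" using small_multiple_eq_0 by fastforce
  qed
  moreover have "?f ` {0..<c} \<subseteq> {i \<in> {0..<K}. edge_window t i}"
  proof
    fix i assume "i \<in> ?f ` {0..<c}"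
    then obtain j where j: "j \<in> {0..<c}" "i = ?f j" by blast
    have "(i - t + 1) mod K = (?f j + (1 - t)) mod K" using j by (simp add: algebra_simps)
    also have "\<dots> = (t - 1 + j + (1 - t)) mod K" by (rule mod_add_left_eq)
    also have "\<dots> = j" using j c_le by (simp add: mod_pos_pos_trivial)
    finally show "i \<in> {i \<in> {0..<K}. edge_window t i}"
      using j K_pos by (auto simp: edge_window_def)
  qed
  ultimately have "card {0..<c} \<le> card {i \<in> {0..<K}. edge_window t i}"
    by (intro card_inj_on_le[of ?f]) auto
  then show ?thesis by simp
qed

text \<open>Every row is met. If none of the \<open>c\<close> rows of a window were met just once,
  this would take \<open>K + c\<close> variables, one more than allowed. The bound
  \<open>K + c - 1\<close> is the width \<open>k + c\<close> plus one pivot.\<close>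

lemma window_hit:
  assumes fin: "finite U" and card: "card U \<le> nat (K + c - 1)" and ns: "\<not> switchable U"
  shows "\<exists>i. uniq U i \<and> edge_window t i"
proof (rule ccontr)
  assume no: "\<not> ?thesis"
  have fc: "finite (crossing U i)" for i using fin by (simp add: crossing_def)
  have ge: "1 + of_bool (edge_window t i) \<le> int (card (crossing U i))" if i: "i \<in> {0..<K}" for i
  proof -
    have "card (crossing U i) \<noteq> 0" using crossing_nonempty[OF ns] i fc[of i] by auto
    moreover have "edge_window t i \<Longrightarrow> card (crossing U i) \<noteq> 1" using no i by (auto simp: uniq_def)
    ultimately show ?thesis by (cases "edge_window t i") auto
  qed
  have "K + c \<le> (\<Sum>i\<in>{0..<K}. 1 + of_bool (edge_window t i))"
    using card_edge_window[of t] K_pos by (simp add: sum.distrib sum_of_bool_eq Int_def)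
  also have "\<dots> \<le> (\<Sum>i\<in>{0..<K}. int (card (crossing U i)))" using ge by (rule sum_mono)
  also have "\<dots> = int (\<Sum>i\<in>{0..<K}. card (crossing U i))" by simp
  also have "(\<Sum>i\<in>{0..<K}. card (crossing U i)) = card (\<Union>i\<in>{0..<K}. crossing U i)"
  proof (rule card_UN_disjoint[symmetric])
    show "\<forall>i\<in>{0..<K}. \<forall>j\<in>{0..<K}. i \<noteq> j \<longrightarrow> crossing U i \<inter> crossing U j = {}"
      unfolding crossing_def using edge_eqD(4) by fastforce
  qed (use fc in auto)
  also have "\<dots> \<le> card U" using fin by (intro card_mono) (auto simp: crossing_def)
  finally show False using card K_pos c_ge by linarith
qed

end

locale coprime_lattice = lattice +
  assumes coprime_p: "\<And>t t'. t \<in> {0..<K} \<Longrightarrow> t' \<in> {0..<K} \<Longrightarrow> t \<noteq> t' \<Longrightarrow> coprime (p t) (p t')"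
begin

section \<open>Combining the primes into one position\<close>

definition P :: int where "P = (\<Prod>t\<in>{0..<K}. p t)"

lemma chinese_remainder: "\<exists>x. \<forall>t\<in>{0..<K}. p t dvd x - u t"
proof -
  have "\<exists>x. \<forall>t\<in>{0..<K}. [x = nat (u t mod p t)] (mod nat (p t))"
  proof (rule chinese_remainder_nat)
    show "\<forall>t\<in>{0..<K}. \<forall>t'\<in>{0..<K}. t \<noteq> t' \<longrightarrow> coprime (nat (p t)) (nat (p t'))"
      using coprime_p p_gt_0 by (simp add: coprime_int_iff[symmetric] less_imp_le)
  qed simp
  then obtain x where x: "\<forall>t\<in>{0..<K}. [x = nat (u t mod p t)] (mod nat (p t))" by blast
  have "p t dvd int x - u t" if "t \<in> {0..<K}" for t
  proof -
    have "[int x = int (nat (u t mod p t))] (mod int (nat (p t)))"      by (rule iffD2[OF cong_int_iff]) (rule bspec[OF x that])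
    then have "[int x = u t mod p t] (mod p t)"
      using p_gt_0[of t] pos_mod_sign[OF p_gt_0[of t], of "u t"] by (simp only: int_nat_eq less_imp_le if_True)
    then have "[int x = u t] (mod p t)" by (simp add: cong_def)
    then show ?thesis by (simp add: cong_iff_dvd_diff)
  qed
  then show ?thesis by blast
qed

lemma LP_dvd:
  assumes "\<And>t. t \<in> {0..<K} \<Longrightarrow> L * p t dvd z"
  shows "L * P dvd z"
proof -
  have "L * p 0 dvd z" using assms[of 0] K_pos by simp
  then obtain y where y: "z = L * y" by (metis dvd_def mult.assoc)
  have "p t dvd y" if "t \<in> {0..<K}" for t using assms[OF that] L_pos unfolding y by simp
  then have "P dvd y" unfolding P_def using coprime_p by (intro prod_dvd_of_pairwise_coprime) auto
  then show ?thesis unfolding y by simp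
qed

lemma uniq_edge:
  assumes "uniq U i"
  obtains s e where "present s" "s mod K = i" "edge s e \<in> U"
proof -
  obtain x where "crossing U i = {x}" using assms by (auto simp: uniq_def card_1_singleton_iff)
  then have "x \<in> crossing U i" by simp
  then obtain s e where "x \<in> U" "present s" "s mod K = i" "x = edge s e"
    unfolding crossing_def by blast
  then show thesis using that[of s e] by simp
qed

text \<open>Unique crossings are joined by short paths in \<open>U\<close>. Their offsets are first
  fixed modulo \<open>L\<close>, for all pairs of rows. For a prime \<open>t\<close>, two crossings
  in its window are joined by a path that also keeps track of \<open>p t\<close>, and the offset
  must be the one already fixed. What remains is one condition per prime.\<close>

lemma located_exists:
  assumes fin: "finite U" and card: "card U \<le> nat (K + c - 1)" and ns: "\<not> switchable U"
  shows "\<exists>a. located U a"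
proof -
  define \<sigma> where "\<sigma> i = (SOME s. present s \<and> s mod K = i \<and> (\<exists>e. edge s e \<in> U))" for i
  have \<sigma>: "present (\<sigma> i) \<and> \<sigma> i mod K = i \<and> (\<exists>e. edge (\<sigma> i) e \<in> U)" if i: "uniq U i" for i
  proof -
    obtain s e where "present s" "s mod K = i" "edge s e \<in> U" by (rule uniq_edge[OF i])
    then have "\<exists>s. present s \<and> s mod K = i \<and> (\<exists>e. edge s e \<in> U)" by blast
    then show ?thesis unfolding \<sigma>_def by (rule someI_ex)
  qed
  have card2: "card U \<le> nat (2 * K)"
    by (rule order_trans[OF card]) (use c_le in auto)
  have conn: "\<exists>d. \<bar>d\<bar> \<le> D \<and> L * q dvd \<sigma> j - \<sigma> i - d"
    if ij: "uniq U i" "uniq U j" "i \<noteq> j" and q: "\<And>r. sector i j r \<Longrightarrow> q dvd face_mod r" for i j q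
  proof -
    obtain e e' where e: "edge (\<sigma> i) e \<in> U" "edge (\<sigma> j) e' \<in> U"
      using \<sigma>[OF ij(1)] \<sigma>[OF ij(2)] by blast
    have s: "present (\<sigma> i)" "\<sigma> i mod K = i" "present (\<sigma> j)" "\<sigma> j mod K = j"
      using \<sigma>[OF ij(1)] \<sigma>[OF ij(2)] by blast+
    show ?thesis
      by (rule unique_crossings_connected[OF fin card2 ns ij s(1,2) e(1) s(3,4) e(2) q])
  qed
  obtain i0 where i0: "uniq U i0" using window_hit[OF fin card ns] by blast
  \<comment> \<open>Offsets from the base crossing \<open>\<sigma> i0\<close>. Through an arbitrary
    sector only \<open>q = 1\<close> is available, so they are determined modulo \<open>L\<close>
    alone.\<close>
  define d where "d i = (SOME d. \<bar>d\<bar> \<le> D \<and> L dvd \<sigma> i - \<sigma> i0 - d)" for i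
  have d: "\<bar>d i\<bar> \<le> D \<and> L dvd \<sigma> i - \<sigma> i0 - d i" if i: "uniq U i" for i
  proof -
    have "\<exists>d. \<bar>d\<bar> \<le> D \<and> L dvd \<sigma> i - \<sigma> i0 - d"
    proof (cases "i = i0")
      case True
      then show ?thesis using D_bounds by (intro exI[of _ 0]) auto
    next
      case False
      then show ?thesis using conn[OF i0 i, of 1] by simp
    qed
    then show ?thesis unfolding d_def by (rule someI_ex)
  qed
  have tracked1: "L * p t dvd (\<sigma> j - d j) - (\<sigma> i - d i)"
    if ij: "uniq U i" "uniq U j" "i \<noteq> j" and t: "t \<in> {0..<K}" "\<forall>r. sector i j r \<longrightarrow> face_window t r" for i j t
  proof -
    have "p t dvd face_mod r" if "sector i j r" for r
      using t(2) that p_dvd_face_mod[OF t(1)] by blast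
    from conn[OF ij this] obtain d' where d': "\<bar>d'\<bar> \<le> D" "L * p t dvd \<sigma> j - \<sigma> i - d'"
      by blast
    have "L dvd \<sigma> j - \<sigma> i - d'" using d'(2) by (rule dvd_mult_left)
    moreover have "L dvd \<sigma> i - \<sigma> i0 - d i" "L dvd \<sigma> j - \<sigma> i0 - d j"
      using d[OF ij(1)] d[OF ij(2)] by blast+
    ultimately have "L dvd (\<sigma> j - \<sigma> i0 - d j) - (\<sigma> i - \<sigma> i0 - d i) - (\<sigma> j - \<sigma> i - d')"
      by (simp only: dvd_diff)
    then have "L dvd d i + d' - d j" by (simp add: algebra_simps)
    \<comment> \<open>Three offsets of size at most \<open>D\<close> sum to less than
      \<open>L\<close>, so the congruence becomes an equality: the offset that is valid for
      \<open>p t\<close> is \<open>d j - d i\<close>.\<close>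
    moreover have "\<bar>d i + d' - d j\<bar> < L"
      using d[OF ij(1)] d[OF ij(2)] d'(1) D_bounds(1) by linarith
    ultimately have "d' = d j - d i" using small_multiple_eq_0 by fastforce
    then have eq: "\<sigma> j - \<sigma> i - d' = (\<sigma> j - d j) - (\<sigma> i - d i)" by linarith
    show ?thesis using d'(2) unfolding eq .
  qed
  have tracked: "L * p t dvd (\<sigma> j - d j) - (\<sigma> i - d i)"
    if ij: "uniq U i" "uniq U j" and t: "t \<in> {0..<K}" "edge_window t i" "edge_window t j" for i j t
  proof (cases "i = j")
    case False
    have b: "0 \<le> i" "i < K" "0 \<le> j" "j < K" using ij by (auto simp: uniq_def)
    from window_sector[OF t(2,3) b False] show ?thesis
    proof
      assume "\<forall>r. sector i j r \<longrightarrow> face_window t r"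
      then show ?thesis by (rule tracked1[OF ij False t(1)])
    next
      assume "\<forall>r. sector j i r \<longrightarrow> face_window t r"
      then have "L * p t dvd (\<sigma> i - d i) - (\<sigma> j - d j)"
        by (rule tracked1[OF ij(2,1) False[symmetric] t(1)])
      then show ?thesis by (simp add: dvd_diff_commute)
    qed
  qed simp
  define w where "w t = (SOME i. uniq U i \<and> edge_window t i)" for t
  have w: "uniq U (w t) \<and> edge_window t (w t)" for t
    unfolding w_def by (rule someI_ex[OF window_hit[OF fin card ns]])
  \<comment> \<open>\<open>L\<close> may share factors with the primes, so the Chinese remainder
    theorem is applied to the quotients by \<open>L\<close> of positions that already agree modulo
    \<open>L\<close>.\<close>
  define u where "u t = (\<sigma> (w t) - \<sigma> i0 - d (w t)) div L" for t
  have u: "\<sigma> (w t) - d (w t) = \<sigma> i0 + L * u t" for t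
  proof -
    have "L dvd \<sigma> (w t) - \<sigma> i0 - d (w t)" using d w by blast
    then have "L * u t = \<sigma> (w t) - \<sigma> i0 - d (w t)" unfolding u_def by simp
    then show ?thesis by linarith
  qed
  obtain x where x: "\<And>t. t \<in> {0..<K} \<Longrightarrow> p t dvd x - u t" using chinese_remainder[of u] by blast
  define a where "a = \<sigma> i0 + L * x"
  have a: "L * p t dvd (\<sigma> (w t) - d (w t)) - a" if "t \<in> {0..<K}" for t
  proof -
    have "L * p t dvd L * (x - u t)" using x[OF that] by simp
    then have "L * p t dvd - (L * (x - u t))" by simp
    moreover have "- (L * (x - u t)) = (\<sigma> (w t) - d (w t)) - a" unfolding a_def u by (simp add: algebra_simps)
    ultimately show ?thesis by simp
  qed
  have "located U a"
    unfolding located_def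
  proof (intro allI impI)
    fix i assume i: "uniq U i"
    show "\<exists>\<delta>. \<bar>\<delta>\<bar> \<le> D \<and> (\<forall>s e t. present s \<longrightarrow> s mod K = i \<longrightarrow> edge s e \<in> U \<longrightarrow> t \<in> {0..<K} \<longrightarrow>
        edge_window t i \<longrightarrow> L * p t dvd s - a - \<delta>)"
    proof (intro exI[of _ "d i"] conjI allI impI)
      show "\<bar>d i\<bar> \<le> D" using d[OF i] by blast
      fix s e t assume s: "present s" "s mod K = i" "edge s e \<in> U" and t: "t \<in> {0..<K}" "edge_window t i"
      obtain e' where "edge (\<sigma> i) e' \<in> U" using \<sigma>[OF i] by blast
      then have "edge s e = edge (\<sigma> i) e'" using \<sigma>[OF i] by (intro uniq_edge_eq[OF i s]) blast+
      then have "L * edge_mod s dvd s - \<sigma> i" by (rule edge_eqD(5))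
      moreover have "s mod K = i mod K" unfolding s(2)[symmetric] by simp
      then have "edge_window t s" using t(2) edge_window_cong[of s i t] by simp
      then have "L * p t dvd L * edge_mod s" using p_dvd_edge_mod[OF t(1)] by simp
      ultimately have 1: "L * p t dvd s - \<sigma> i" by (rule dvd_trans[rotated])
      have 2: "L * p t dvd (\<sigma> i - d i) - (\<sigma> (w t) - d (w t))"
        by (rule tracked[OF conjunct1[OF w] i t(1) conjunct2[OF w] t(2)])
      have "L * p t dvd (s - \<sigma> i) + ((\<sigma> i - d i) - (\<sigma> (w t) - d (w t))) + ((\<sigma> (w t) - d (w t)) - a)"
        by (intro dvd_add 1 2 a t(1))
      then show "L * p t dvd s - a - d i" by (simp add: algebra_simps)
    qed
  qed
  then show ?thesis by blast
qed

lemma locatedE: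
  assumes "located U a" "uniq U i"
  obtains \<delta> where "\<bar>\<delta>\<bar> \<le> D"
    "\<And>s e t. present s \<Longrightarrow> s mod K = i \<Longrightarrow> edge s e \<in> U \<Longrightarrow> t \<in> {0..<K} \<Longrightarrow>
       edge_window t i \<Longrightarrow> L * p t dvd s - a - \<delta>"
  using assms unfolding located_def by blast

text \<open>The offsets for different primes agree modulo \<open>L\<close> and are smaller than half
  of it, hence are one integer; with a common offset the divisibilities can be combined.\<close>

lemma common_residue:
  assumes "\<And>t. t \<in> {0..<K} \<Longrightarrow> \<exists>d. \<bar>d\<bar> \<le> B \<and> L * p t dvd z - d" and B: "2 * B < L"
  shows "\<exists>d. \<bar>d\<bar> \<le> B \<and> L * P dvd z - d"
proof -
  obtain d where d: "\<And>t. t \<in> {0..<K} \<Longrightarrow> \<bar>d t\<bar> \<le> B \<and> L * p t dvd z - d t" using assms(1) by metis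
  have 0: "0 \<in> {0..<K}" using K_pos by simp
  have "d t = d 0" if t: "t \<in> {0..<K}" for t
  proof -
    have "L dvd z - d t" "L dvd z - d 0" using d[OF t] d[OF 0] dvd_mult_left by blast+
    then have "L dvd (z - d 0) - (z - d t)" by (rule dvd_diff[rotated])
    then have "L dvd d t - d 0" by simp
    moreover have "\<bar>d t - d 0\<bar> < L" using d[OF t] d[OF 0] B by linarith
    ultimately show ?thesis using small_multiple_eq_0 by fastforce
  qed
  then have "L * P dvd z - d 0" using d by (intro LP_dvd) metis
  then show ?thesis using d[OF 0] by blast
qed

text \<open>For each prime, some row of its window is met just once by \<open>U\<close>, and then by
  \<open>S\<close> as well, in the same variable. This variable measures both positions with error
  at most \<open>D\<close>.\<close>

lemma located_close:
  assumes fin: "finite U" and card: "card U \<le> nat (K + c - 1)" and SU: "S \<subseteq> U"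
    and ns: "\<not> switchable S" and a: "located S a" and b: "located U b"
  shows "\<exists>d. \<bar>d\<bar> \<le> 2 * D \<and> L * P dvd b - a - d"
proof (rule common_residue)
  fix t assume t: "t \<in> {0..<K}"
  have nsU: "\<not> switchable U" using switchable_mono SU ns by blast
  obtain i where i: "uniq U i" "edge_window t i" using window_hit[OF fin card nsU] by blast
  have iS: "uniq S i" using uniq_subset[OF i(1) SU ns] .
  obtain s e where s: "present s" "s mod K = i" "edge s e \<in> S" using uniq_edge[OF iS] .
  obtain \<delta> where \<delta>: "\<bar>\<delta>\<bar> \<le> D" "L * p t dvd s - a - \<delta>"
    using locatedE[OF a iS] s t i(2) by metis
  have sU: "edge s e \<in> U" using s(3) SU by blast
  obtain \<epsilon> where \<epsilon>: "\<bar>\<epsilon>\<bar> \<le> D" "L * p t dvd s - b - \<epsilon>"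
    using locatedE[OF b i(1)] s(1,2) sU t i(2) by metis
  have "L * p t dvd (s - a - \<delta>) - (s - b - \<epsilon>)" using \<delta>(2) \<epsilon>(2) by (rule dvd_diff)
  then have "L * p t dvd b - a - (\<delta> - \<epsilon>)" by (simp add: algebra_simps)
  moreover have "\<bar>\<delta> - \<epsilon>\<bar> \<le> 2 * D" using \<delta>(1) \<epsilon>(1) by linarith
  ultimately show "\<exists>d. \<bar>d\<bar> \<le> 2 * D \<and> L * p t dvd b - a - d" by blast
qed (use D_bounds in simp)

text \<open>\<open>r\<close> counts the steps still to be played. One step moves a position by at
  most \<open>4 * D\<close>, namely \<open>2 * D\<close> from the old clause to the union and
  \<open>2 * D\<close> from there to the new clause. The radius left for \<open>r = 0\<close> is the
  one required by \<open>free_pair\<close>.\<close>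

definition near :: "int \<Rightarrow> nat \<Rightarrow> int \<Rightarrow> bool" where
  "near B r a \<longleftrightarrow> (\<exists>d. L * P dvd a - B - d \<and> \<bar>d\<bar> \<le> H + D + 4 * D * int r)"

lemma near_shift:
  assumes "near B r a" "L * P dvd b - a - d" "\<bar>d\<bar> \<le> 4 * D"
  shows "near B (Suc r) b"
proof -
  obtain d' where d': "L * P dvd a - B - d'" "\<bar>d'\<bar> \<le> H + D + 4 * D * int r"
    using assms(1) by (auto simp: near_def)
  have "L * P dvd (b - a - d) + (a - B - d')" using assms(2) d'(1) by (rule dvd_add)
  then have "L * P dvd b - B - (d + d')" by (simp add: algebra_simps)
  moreover have "\<bar>d + d'\<bar> \<le> H + D + 4 * D * int (Suc r)" using assms(3) d'(2) by (simp add: algebra_simps)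
  ultimately show ?thesis unfolding near_def by blast
qed

lemma near_mono:
  assumes "near B r a" "r \<le> r'"
  shows "near B r' a"
proof -
  have "4 * D * int r \<le> 4 * D * int r'" using assms(2) D_bounds(3) by (intro mult_left_mono) auto
  then have "x \<le> H + D + 4 * D * int r'" if "x \<le> H + D + 4 * D * int r" for x using that by linarith
  then show ?thesis using assms(1) unfolding near_def by blast
qed

lemma not_near_both:
  assumes "2 * (H + D + 4 * D * int r) < N" "N + 2 * (H + D + 4 * D * int r) < L * P"
    and "near 0 r a" "near N r a"
  shows False
proof -
  obtain d d' where d: "L * P dvd a - 0 - d" "\<bar>d\<bar> \<le> H + D + 4 * D * int r"
    "L * P dvd a - N - d'" "\<bar>d'\<bar> \<le> H + D + 4 * D * int r"
    using assms(3,4) unfolding near_def by blast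
  have "L * P dvd (a - 0 - d) - (a - N - d')" using d(1,3) by (rule dvd_diff)
  then have "L * P dvd N + (d' - d)" by (simp add: algebra_simps)
  then have "N + (d' - d) = 0"
    by (rule small_multiple_eq_0) (rule shift_bound(1)[OF d(2,4) assms(1,2)])
  then show False using shift_bound(2)[OF d(2,4) assms(1,2)] by simp
qed

text \<open>If every row had a variable of \<open>U\<close> close to \<open>B\<close>, then for each
  prime a uniquely met row would place \<open>U\<close> within \<open>H + D\<close> of
  \<open>B\<close>. The free row will carry the seam when the violated cell moves inside one
  end.\<close>

lemma free_pair:
  assumes fin: "finite U" and card: "card U \<le> nat (K + c - 1)" and ns: "\<not> switchable U"
    and a: "located U a" and far: "\<not> near B 0 a"
  shows "\<exists>i. 0 \<le> i \<and> i < K \<and> (\<forall>s e. present s \<longrightarrow> \<bar>s - B\<bar> \<le> H \<longrightarrow> s mod K = i \<longrightarrow> edge s e \<notin> U)"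
proof (rule ccontr)
  assume no: "\<not> ?thesis"
  have "\<exists>d. \<bar>d\<bar> \<le> H + D \<and> L * P dvd (a - B) - d"
  proof (rule common_residue)
    fix t assume t: "t \<in> {0..<K}"
    obtain i where i: "uniq U i" "edge_window t i" using window_hit[OF fin card ns] by blast
    then obtain s e where s: "present s" "\<bar>s - B\<bar> \<le> H" "s mod K = i" "edge s e \<in> U"
      using no unfolding uniq_def by blast
    obtain \<delta> where \<delta>: "\<bar>\<delta>\<bar> \<le> D" "L * p t dvd s - a - \<delta>"
      using locatedE[OF a i(1)] s(1,3,4) t i(2) by metis
    have "L * p t dvd - (s - a - \<delta>)" using \<delta>(2) by (simp only: dvd_minus_iff)
    then have "L * p t dvd (a - B) - (s - B - \<delta>)" by (simp add: algebra_simps)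
    moreover have "\<bar>s - B - \<delta>\<bar> \<le> H + D" using s(2) \<delta>(1) by linarith
    ultimately show "\<exists>d. \<bar>d\<bar> \<le> H + D \<and> L * p t dvd a - B - d" by blast
  qed (use D_bounds in simp)
  then show False using far by (auto simp: near_def)
qed

end

section \<open>The adversary\<close>

lemma odd_card_filter_insert:
  assumes "finite A" "a \<notin> A"
  shows "odd (card {x \<in> insert a A. Q x}) \<longleftrightarrow> (Q a \<noteq> odd (card {x \<in> A. Q x}))"
proof -
  have "{x \<in> insert a A. Q x} = (if Q a then insert a {x \<in> A. Q x} else {x \<in> A. Q x})" by auto
  then show ?thesis using assms by simp
qed

lemma odd_card_filter4:
  assumes "distinct [a, b, c, d]"
  shows "odd (card {x \<in> {a, b, c, d}. Q x}) \<longleftrightarrow> ((Q a \<noteq> Q b) \<noteq> (Q c \<noteq> Q d))"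
proof -
  have 1: "odd (card {x \<in> {a, b, c, d}. Q x}) \<longleftrightarrow> (Q a \<noteq> odd (card {x \<in> {b, c, d}. Q x}))"
    by (rule odd_card_filter_insert) (use assms in auto)
  have 2: "odd (card {x \<in> {b, c, d}. Q x}) \<longleftrightarrow> (Q b \<noteq> odd (card {x \<in> {c, d}. Q x}))"
    by (rule odd_card_filter_insert) (use assms in auto)
  have 3: "odd (card {x \<in> {c, d}. Q x}) \<longleftrightarrow> (Q c \<noteq> odd (card {x \<in> {d}. Q x}))"
    by (rule odd_card_filter_insert) (use assms in auto)
  have 4: "odd (card {x \<in> {d}. Q x}) \<longleftrightarrow> (Q d \<noteq> odd (card {x \<in> {}. Q x}))"
    by (rule odd_card_filter_insert) auto
  show ?thesis unfolding 1 2 3 4 by simp argo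
qed

context lattice
begin

section \<open>Moving the violated cell\<close>

definition val :: "(nat \<Rightarrow> bool) \<Rightarrow> int \<Rightarrow> bool \<Rightarrow> bool" where
  "val \<beta> s e \<longleftrightarrow> present s \<and> \<beta> (edge s e)"

definition par :: "(int \<Rightarrow> bool \<Rightarrow> bool) \<Rightarrow> int \<Rightarrow> bool" where
  "par g s \<longleftrightarrow> ((g s False \<noteq> g (s + K) True) \<noteq> (g (s + K - 1) False \<noteq> g (s + K - 1) True))"

lemma par_xor: "par (\<lambda>s e. g s e \<noteq> g' s e) s = (par g s \<noteq> par g' s)"
  unfolding par_def by argo

text \<open>The identification preserves row and kind, so edges that differ in one of them never
  become the same variable.\<close>

lemma edge_inj_on:
  assumes "inj_on (\<lambda>(s, e). (s mod K, e)) A"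
  shows "inj_on (\<lambda>(s, e). edge s e) A"
proof (rule inj_onI)
  fix x y assume xy: "x \<in> A" "y \<in> A" "(\<lambda>(s, e). edge s e) x = (\<lambda>(s, e). edge s e) y"
  obtain s e s' e' where se: "x = (s, e)" "y = (s', e')" by (meson surj_pair)
  then have ee: "edge s e = edge s' e'" using xy(3) by simp
  have "(\<lambda>(s, e). (s mod K, e)) x = (\<lambda>(s, e). (s mod K, e)) y"
    using edge_eqD(1)[OF ee] edge_eqD(4)[OF ee] se by simp
  then show "x = y" by (rule inj_onD[OF assms _ xy(1,2)])
qed

lemma add_mod_K_neq: "0 < d \<Longrightarrow> d < K \<Longrightarrow> (s + d) mod K \<noteq> s mod K"
  using small_multiple_eq_0[of K d] by (auto simp: mod_eq_dvd_iff)

lemma cell_rows: "(s + K) mod K = s mod K" "(s + K - 1) mod K \<noteq> s mod K"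
  using add_mod_K_neq[of "K - 1" s] K_ge by (auto simp: algebra_simps)

lemma inj_on_cell: "inj_on (\<lambda>(s, e). edge s e) (cell s)"
  by (rule edge_inj_on) (use cell_rows[of s] in \<open>auto simp: inj_on_def cell_def\<close>)

lemma odd_card_cell: "odd (card {x \<in> edges (cell s). \<beta> x}) \<longleftrightarrow> par (val \<beta>) s"
proof -
  let ?Q = "\<lambda>x. val \<beta> (fst x) (snd x)"
  have eq: "{x \<in> edges (cell s). \<beta> x} = (\<lambda>(s, e). edge s e) ` {x \<in> cell s. ?Q x}"
    unfolding edges_def val_def by force
  have "card {x \<in> edges (cell s). \<beta> x} = card {x \<in> cell s. ?Q x}"
    unfolding eq by (intro card_image inj_on_subset[OF inj_on_cell]) auto
  moreover have "odd (card {x \<in> cell s. ?Q x}) \<longleftrightarrow> par (val \<beta>) s"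
    unfolding cell_def
    by (subst odd_card_filter4) (use K_ge in \<open>auto simp: par_def\<close>)
  ultimately show ?thesis by simp
qed

text \<open>The range covers the edges affected by cutting a seam or a coboundary at
  \<open>v\<close>, and the edge at \<open>v - K\<close> of the violated cell.\<close>

definition clean :: "nat set \<Rightarrow> int \<Rightarrow> bool" where
  "clean U v \<longleftrightarrow> (\<forall>s e. v - K \<le> s \<longrightarrow> s < v + K \<longrightarrow> edge s e \<notin> U)"

text \<open>For a ring \<open>v\<close>, the two seam edges of the cell \<open>v - K\<close> are at
  \<open>v - K\<close> and \<open>v\<close>, on different sides of a cut at \<open>v\<close>; so
  this is the cell that a truncated seam violates.\<close>

definition robber :: "(nat \<Rightarrow> bool) \<Rightarrow> int \<Rightarrow> bool" where
  "robber \<beta> v \<longleftrightarrow> (\<forall>s. - H - K \<le> s \<longrightarrow> s < N + H \<longrightarrow> (par (val \<beta>) s \<noteq> charge s) = (s = v - K))"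

definition start_ring :: "int \<Rightarrow> bool" where
  "start_ring v \<longleftrightarrow> K dvd v \<and> - H + K \<le> v \<and> v \<le> - K"

definition end_ring :: "int \<Rightarrow> bool" where
  "end_ring v \<longleftrightarrow> K dvd v \<and> N + K \<le> v \<and> v \<le> N + H - K"

lemma clean_mono: "clean U v \<Longrightarrow> S \<subseteq> U \<Longrightarrow> clean S v"
  unfolding clean_def by blast

text \<open>Pigeonhole on \<open>2 * K\<close> disjoint blocks: outside the middle segment a
  variable has only one position and spoils only one block.\<close>

lemma exists_clean:
  assumes fin: "finite U" and card: "card U < nat (2 * K)"
    and fresh: "\<And>s. B \<le> s \<Longrightarrow> s < B + H \<Longrightarrow> \<not> mid s"
  shows "\<exists>j. 0 \<le> j \<and> j < 2 * K \<and> clean U (B + 2 * K * j + K)"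
proof (rule ccontr)
  assume no: "\<not> ?thesis"
  have ex: "\<exists>x. x \<in> U \<and> (\<exists>s e. B + 2 * K * j \<le> s \<and> s < B + 2 * K * j + 2 * K \<and> x = edge s e)"
    if "j \<in> {0..<2 * K}" for j
  proof -
    have "\<not> clean U (B + 2 * K * j + K)" using no that by auto
    then obtain s e where "B + 2 * K * j + K - K \<le> s" "s < B + 2 * K * j + K + K" "edge s e \<in> U"
      unfolding clean_def by blast
    then show ?thesis by (intro exI[of _ "edge s e"]) (auto intro!: exI[of _ s] exI[of _ e])
  qed
  define f where "f j = (SOME x. x \<in> U \<and> (\<exists>s e. B + 2 * K * j \<le> s \<and> s < B + 2 * K * j + 2 * K \<and> x = edge s e))" for j
  have f: "f j \<in> U \<and> (\<exists>s e. B + 2 * K * j \<le> s \<and> s < B + 2 * K * j + 2 * K \<and> f j = edge s e)"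
    if "j \<in> {0..<2 * K}" for j
    unfolding f_def by (rule someI_ex[OF ex[OF that]])
  have less: "B + 2 * K * j + 2 * K \<le> B + 2 * K * j'" if "j < j'" for j j'
  proof -
    have "2 * K * (j + 1) \<le> 2 * K * j'" using that K_pos by (intro mult_left_mono) auto
    then show ?thesis by (simp add: algebra_simps)
  qed
  have "inj_on f {0..<2 * K}"
  proof (rule inj_onI)
    fix j j' assume j: "j \<in> {0..<2 * K}" "j' \<in> {0..<2 * K}" and eq: "f j = f j'"
    obtain s e where s: "B + 2 * K * j \<le> s" "s < B + 2 * K * j + 2 * K" "f j = edge s e" using f[OF j(1)] by blast
    obtain s' e' where s': "B + 2 * K * j' \<le> s'" "s' < B + 2 * K * j' + 2 * K" "f j' = edge s' e'" using f[OF j(2)] by blast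
    have "2 * K * j + 2 * K \<le> H" and j0: "0 \<le> 2 * K * j"
    proof -
      have "2 * K * (j + 1) \<le> 2 * K * (2 * K)" using j(1) K_pos by (intro mult_left_mono) auto
      then show "2 * K * j + 2 * K \<le> H" by (simp add: H_def power2_eq_square algebra_simps)
      show "0 \<le> 2 * K * j" using j(1) K_pos by simp
    qed
    then have "\<not> mid s" using s j0 by (intro fresh) linarith+
    then have "s = s'" using edge_eqD(3) eq s(3) s'(3) by simp
    then show "j = j'" using less[of j j'] less[of j' j] s s' by (cases j j' rule: linorder_cases) auto
  qed
  moreover have "f ` {0..<2 * K} \<subseteq> U" using f by blast
  ultimately have "card {0..<2 * K} \<le> card U" using fin by (intro card_inj_on_le)
  then show False using card by simp
qed

lemma exists_clean_start:
  assumes "finite U" "card U < nat (2 * K)"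
  shows "\<exists>v. start_ring v \<and> clean U v"
proof -
  obtain j where j: "0 \<le> j" "j < 2 * K" "clean U (- H + 2 * K * j + K)"
    using exists_clean[OF assms, of "- H"] by (auto simp: mid_def)
  have "2 * K * (j + 1) \<le> 2 * K * (2 * K)" using j(2) K_pos by (intro mult_left_mono) auto
  then have "2 * K * j + 2 * K \<le> H" by (simp add: H_def power2_eq_square algebra_simps)
  moreover have "0 \<le> 2 * K * j" using j(1) K_pos by simp
  ultimately have "start_ring (- H + 2 * K * j + K)" using K_dvd_H by (simp add: start_ring_def)
  then show ?thesis using j(3) by blast
qed

lemma exists_clean_end:
  assumes "finite U" "card U < nat (2 * K)"
  shows "\<exists>v. end_ring v \<and> clean U v"
proof -
  obtain j where j: "0 \<le> j" "j < 2 * K" "clean U (N + 2 * K * j + K)"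
    using exists_clean[OF assms, of N] by (auto simp: mid_def)
  have "2 * K * (j + 1) \<le> 2 * K * (2 * K)" using j(2) K_pos by (intro mult_left_mono) auto
  then have "2 * K * j + 2 * K \<le> H" by (simp add: H_def power2_eq_square algebra_simps)
  moreover have "0 \<le> 2 * K * j" using j(1) K_pos by simp
  ultimately have "end_ring (N + 2 * K * j + K)" using K_dvd_N by (simp add: end_ring_def)
  then show ?thesis using j(3) by blast
qed

text \<open>A flip moves the violated cell between two rings: the truncated coboundary leaves all cells
  alone, and the truncated seam changes the parity at its two ends only.\<close>

definition flip :: "(int \<Rightarrow> bool) \<Rightarrow> int \<Rightarrow> int \<Rightarrow> int \<Rightarrow> bool \<Rightarrow> bool" where
  "flip h v v' s e \<longleftrightarrow> cob (\<lambda>z. h z \<and> v \<le> z \<and> z < v') s e \<noteq> (s mod K = 0 \<and> v \<le> s \<and> s < v')"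

lemma par_cob: "\<not> par (cob h) s"
proof -
  have hd: "head s False = s + 1" "head (s + K) True = s + 1" "head (s + K - 1) False = s + K"
    "head (s + K - 1) True = s" by (auto simp: head_def)
  show ?thesis unfolding par_def cob_def hd by auto
qed

lemma multiple_between:
  assumes "K dvd s" "K dvd v" "v - K \<le> s" "s < v"
  shows "s = v - K"
proof -
  have "K dvd s - (v - K)" using assms by (simp add: dvd_diff)
  then have "s - (v - K) = 0" using assms by (intro small_multiple_eq_0[of K]) auto
  then show ?thesis by simp
qed

lemma par_flip:
  assumes "K dvd v" "K dvd v'" "v < v'"
  shows "par (flip h v v') s \<longleftrightarrow> s = v - K \<or> s = v' - K"
proof -
  let ?m = "\<lambda>s (e::bool). s mod K = 0 \<and> v \<le> s \<and> s < v'"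
  have "par (flip h v v') s = (par (cob (\<lambda>z. h z \<and> v \<le> z \<and> z < v')) s \<noteq> par ?m s)"
    unfolding par_xor[symmetric] by (simp add: flip_def par_def)
  then have "par (flip h v v') s = par ?m s" using par_cob by blast
  also have "\<dots> \<longleftrightarrow> s mod K = 0 \<and> (v \<le> s \<and> s < v') \<noteq> (v \<le> s + K \<and> s + K < v')"
    by (auto simp: par_def)
  also have "\<dots> \<longleftrightarrow> s = v - K \<or> s = v' - K"
  proof
    assume *: "s mod K = 0 \<and> (v \<le> s \<and> s < v') \<noteq> (v \<le> s + K \<and> s + K < v')"
    then have "K dvd s" by auto
    moreover have "v - K \<le> s \<and> s < v \<or> v' - K \<le> s \<and> s < v'" using * K_pos by auto
    ultimately show "s = v - K \<or> s = v' - K" using multiple_between assms by blast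
  next
    have "v + K \<le> v'"
    proof -
      have "K dvd v' - v" using assms by (simp add: dvd_diff)
      then show ?thesis using assms(3) zdvd_imp_le[of K "v' - v"] by simp
    qed
    moreover assume "s = v - K \<or> s = v' - K"
    ultimately show "s mod K = 0 \<and> (v \<le> s \<and> s < v') \<noteq> (v \<le> s + K \<and> s + K < v')"
      using assms K_pos by (auto simp: mod_eq_0_iff_dvd dvd_diff)
  qed
  finally show ?thesis .
qed

lemma flip_range: "flip h v v' s e \<Longrightarrow> v - 1 \<le> s \<and> s < v' + K - 1"
  using K_ge by (auto simp: flip_def cob_def head_def split: if_splits)

text \<open>\<open>wd\<close> turns the flip of edges into a flip of variables. On \<open>U\<close>
  nothing changes: \<open>van\<close> handles the edges strictly between the cuts, cleanness those
  near them.\<close>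

lemma robber_move:
  assumes vv: "K dvd v" "K dvd v'" "v < v'" "- H + K \<le> v" "v' \<le> N + H - K"
    and rob: "robber \<beta> w" and ww: "w = v \<and> w' = v' \<or> w = v' \<and> w' = v"
    and wd: "\<And>s e s' e'. edge s e = edge s' e' \<Longrightarrow> flip h v v' s e \<Longrightarrow> flip h v v' s' e'"
    and van: "\<And>s e. v \<le> s \<Longrightarrow> s < v' \<Longrightarrow> edge s e \<in> U \<Longrightarrow> cob h s e = (s mod K = 0)"
    and cl: "clean U v" "clean U v'"
  shows "\<exists>\<beta>'. robber \<beta>' w' \<and> (\<forall>x\<in>U. \<beta>' x = \<beta> x) \<and> (\<forall>x. (\<forall>s e. x \<noteq> edge s e) \<longrightarrow> \<beta>' x = \<beta> x)"
proof -
  define \<beta>' where "\<beta>' x \<longleftrightarrow> \<beta> x \<noteq> (\<exists>s e. x = edge s e \<and> flip h v v' s e)" for x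
  have \<beta>'_edge: "\<beta>' (edge s e) = (\<beta> (edge s e) \<noteq> flip h v v' s e)" for s e
    unfolding \<beta>'_def using wd[of _ _ s e] by metis
  have "val \<beta>' s e = (val \<beta> s e \<noteq> flip h v v' s e)" for s e
  proof -
    have "flip h v v' s e \<Longrightarrow> present s" using flip_range[of h v v' s e] vv K_ge by (auto simp: present_def)
    then show ?thesis unfolding val_def \<beta>'_edge by blast
  qed
  then have "val \<beta>' = (\<lambda>s e. val \<beta> s e \<noteq> flip h v v' s e)" by (intro ext)
  then have par': "par (val \<beta>') s = (par (val \<beta>) s \<noteq> par (flip h v v') s)" for s
    using par_xor[of "val \<beta>" "flip h v v'" s] by simp
  have "robber \<beta>' w'"
    unfolding robber_def
  proof (intro allI impI)
    fix s assume s: "- H - K \<le> s" "s < N + H"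
    have "(par (val \<beta>) s \<noteq> charge s) = (s = w - K)" using rob s unfolding robber_def by blast
    moreover have "par (flip h v v') s = (s = v - K \<or> s = v' - K)" by (rule par_flip[OF vv(1-3)])
    moreover have "v - K \<noteq> v' - K" using vv(3) by simp
    ultimately show "(par (val \<beta>') s \<noteq> charge s) = (s = w' - K)"
      unfolding par' using ww by auto
  qed
  moreover have "\<beta>' x = \<beta> x" if x: "x \<in> U" for x
  proof -
    have "\<not> flip h v v' s e" if s: "x = edge s e" for s e
    proof
      assume fl: "flip h v v' s e"
      have "\<not> (v - K \<le> s \<and> s < v + K)" "\<not> (v' - K \<le> s \<and> s < v' + K)"
        using cl x s unfolding clean_def by blast+
      then have r: "v + K \<le> s" "s < v' - K" using flip_range[OF fl] K_ge by auto
      then have "v \<le> head s e" "head s e < v'" using K_ge by (auto simp: head_def)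
      then have "cob (\<lambda>z. h z \<and> v \<le> z \<and> z < v') s e = cob h s e" using r K_ge by (simp add: cob_def)
      then show False using fl van[of s e] r x s K_ge by (simp add: flip_def)
    qed
    then show ?thesis unfolding \<beta>'_def by blast
  qed
  moreover have "\<beta>' x = \<beta> x" if "\<forall>s e. x \<noteq> edge s e" for x using that unfolding \<beta>'_def by blast
  ultimately show ?thesis by blast
qed

lemma ring_bounds:
  "start_ring v \<Longrightarrow> K dvd v \<and> - H + K \<le> v \<and> v \<le> N + H - K"
  "end_ring v \<Longrightarrow> K dvd v \<and> - H + K \<le> v \<and> v \<le> N + H - K"
  using N_pos D_bounds H_ge K_ge by (auto simp: start_ring_def end_ring_def)

text \<open>The flip stays inside one end, where identified edges coincide. Hence \<open>h\<close>
  is arbitrary apart from agreeing with the seam on \<open>U\<close> between the two rings.\<close>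

lemma robber_move_within:
  assumes ring: "start_ring w \<and> start_ring w' \<or> end_ring w \<and> end_ring w'"
    and rob: "robber \<beta> w"
    and van: "\<And>s e. min w w' \<le> s \<Longrightarrow> s < max w w' \<Longrightarrow> edge s e \<in> U \<Longrightarrow> cob h s e = (s mod K = 0)"
    and cl: "clean U w" "clean U w'"
  shows "\<exists>\<beta>'. robber \<beta>' w' \<and> (\<forall>x\<in>U. \<beta>' x = \<beta> x) \<and> (\<forall>x. (\<forall>s e. x \<noteq> edge s e) \<longrightarrow> \<beta>' x = \<beta> x)"
proof (cases "w = w'")
  case True
  then show ?thesis using rob by blast
next
  case False
  define v v' where "v = min w w'" and "v' = max w w'"
  have ww: "w = v \<and> w' = v' \<or> w = v' \<and> w' = v" and vlt: "v < v'" using False by (auto simp: v_def v'_def)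
  have bd: "K dvd v" "K dvd v'" "- H + K \<le> v" "v' \<le> N + H - K"
    using ring ring_bounds by (auto simp: v_def v'_def min_def max_def)
  have fresh: "\<not> flip h v v' s e" if "mid s" for s e
  proof -
    have "\<not> (v \<le> s \<and> s < v')" "\<not> (v \<le> head s e \<and> head s e < v')"
      using ring that K_ge by (auto simp: v_def v'_def start_ring_def end_ring_def mid_def head_def)
    then show ?thesis by (auto simp: flip_def cob_def)
  qed
  show ?thesis
  proof (rule robber_move[OF bd(1,2) vlt bd(3,4) rob ww, of h])
    fix s e s' e' assume e: "edge s e = edge s' e'" and fl: "flip h v v' s e"
    have "\<not> mid s" using fl fresh by blast
    then show "flip h v v' s' e'" using fl edge_eqD(1,3)[OF e] by simp
  next
    fix s e assume "v \<le> s" "s < v'" "edge s e \<in> U"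
    then show "cob h s e = (s mod K = 0)" using van by (simp add: v_def v'_def)
  next
    show "clean U v" "clean U v'" using cl by (auto simp: v_def v'_def min_def max_def)
  qed
qed

text \<open>The cuts lie in the ends. On the middle segment the truncation is not felt, and the flip
  is the sum of a periodic coboundary and the seam, both compatible with the identification.\<close>

lemma robber_move_across:
  assumes sr: "start_ring v" and er: "end_ring v'"
    and rob: "robber \<beta> w" and ww: "w = v \<and> w' = v' \<or> w = v' \<and> w' = v"
    and h: "periodic h" and van: "\<And>s e. present s \<Longrightarrow> edge s e \<in> U \<Longrightarrow> cob h s e = (s mod K = 0)"
    and cl: "clean U v" "clean U v'"
  shows "\<exists>\<beta>'. robber \<beta>' w' \<and> (\<forall>x\<in>U. \<beta>' x = \<beta> x) \<and> (\<forall>x. (\<forall>s e. x \<noteq> edge s e) \<longrightarrow> \<beta>' x = \<beta> x)"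
proof -
  have bd: "K dvd v" "K dvd v'" "- H + K \<le> v" "v' \<le> N + H - K" "v \<le> - K" "N + K \<le> v'"
    using ring_bounds(1)[OF sr] ring_bounds(2)[OF er] sr er by (auto simp: start_ring_def end_ring_def)
  have vlt: "v < v'" using bd N_pos K_pos by linarith
  have mid_flip: "flip h v v' s e = (cob h s e \<noteq> (s mod K = 0))" if "mid s" for s e
  proof -
    have "v \<le> s \<and> s < v'" "v \<le> head s e \<and> head s e < v'"
      using that bd K_ge by (auto simp: mid_def head_def)
    then show ?thesis by (simp add: flip_def cob_def)
  qed
  show ?thesis
  proof (rule robber_move[OF bd(1,2) vlt bd(3,4) rob ww, of h])
    fix s e s' e' assume e: "edge s e = edge s' e'" and fl: "flip h v v' s e"
    show "flip h v v' s' e'"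
    proof (cases "mid s")
      case True
      have "h s = h s'" "h (head s e) = h (head s' e')"
        using h edge_eq_faces[OF e] unfolding periodic_def by blast+
      then have "cob h s e = cob h s' e'" by (simp add: cob_def)
      moreover have "mid s'" "s mod K = s' mod K" using edge_eqD(2,4)[OF e] True by auto
      ultimately show ?thesis using fl mid_flip True by simp
    next
      case False
      then show ?thesis using fl edge_eqD(1,3)[OF e] by simp
    qed
  next
    fix s e assume s: "v \<le> s" "s < v'" "edge s e \<in> U"
    have "present s" using s bd K_pos by (simp add: present_def)
    then show "cob h s e = (s mod K = 0)" by (rule van[OF _ s(3)])
  qed (use cl in auto)
qed

lemma robber_move_switchable:
  assumes sw: "switchable U" and rob: "robber \<beta> w"
    and w: "start_ring w \<or> end_ring w" and w': "start_ring w' \<or> end_ring w'"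
    and cl: "clean U w" "clean U w'"
  shows "\<exists>\<beta>'. robber \<beta>' w' \<and> (\<forall>x\<in>U. \<beta>' x = \<beta> x) \<and> (\<forall>x. (\<forall>s e. x \<noteq> edge s e) \<longrightarrow> \<beta>' x = \<beta> x)"
proof -
  obtain h where h: "periodic h"
    and van: "\<And>s e. present s \<Longrightarrow> edge s e \<in> U \<Longrightarrow> cob h s e = (s mod K = 0)"
    using sw unfolding switchable_def by blast
  consider "start_ring w \<and> start_ring w' \<or> end_ring w \<and> end_ring w'"
    | "start_ring w" "end_ring w'" | "end_ring w" "start_ring w'"
    using w w' by blast
  then show ?thesis
  proof cases
    case 1
    show ?thesis
    proof (rule robber_move_within[OF 1 rob _ cl, of h])
      fix s e assume s: "min w w' \<le> s" "s < max w w'" "edge s e \<in> U"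
      have "present s" using s(1,2) 1 ring_bounds[of w] ring_bounds[of w'] K_pos
        by (auto simp: present_def min_def max_def split: if_splits)
      then show "cob h s e = (s mod K = 0)" by (rule van[OF _ s(3)])
    qed
  next
    case 2
    show ?thesis using robber_move_across[OF 2 rob _ h van] cl by blast
  next
    case 3
    show ?thesis using robber_move_across[OF 3(2,1) rob _ h van] cl by blast
  qed
qed

lemma robber_init:
  "\<exists>\<beta> v. robber \<beta> v \<and> start_ring v \<and> (\<forall>x. (\<forall>s e. x \<noteq> edge s e) \<longrightarrow> \<beta> x)"
proof -
  define v where "v = - K"
  \<comment> \<open>A seam from \<open>- K\<close> to the far end breaks parity at its start and at
    the charged cell, where odd parity is what is asked for.\<close>
  define \<beta> where "\<beta> x \<longleftrightarrow> (\<exists>s e. x = edge s e \<and> s mod K = 0 \<and> v \<le> s) \<or> (\<forall>s e. x \<noteq> edge s e)" for x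
  have sr: "start_ring v" using H_ge K_ge by (simp add: v_def start_ring_def)
  have \<beta>_edge: "\<beta> (edge s e) \<longleftrightarrow> s mod K = 0 \<and> v \<le> s" for s e
  proof
    assume "\<beta> (edge s e)"
    then obtain s' e' where s': "edge s e = edge s' e'" "s' mod K = 0" "v \<le> s'" unfolding \<beta>_def by metis
    then show "s mod K = 0 \<and> v \<le> s"
      using edge_eqD(2,3,4)[OF s'(1)] K_pos by (cases "mid s") (auto simp: mid_def v_def)
  next
    assume "s mod K = 0 \<and> v \<le> s"
    then show "\<beta> (edge s e)" unfolding \<beta>_def by metis
  qed
  have "robber \<beta> v"
    unfolding robber_def
  proof (intro allI impI)
    fix s assume s: "- H - K \<le> s" "s < N + H"
    have NH: "K dvd N + H" using K_dvd_N K_dvd_H by simp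
    have "par (val \<beta>) s \<longleftrightarrow> s mod K = 0 \<and> ((v \<le> s \<and> s < N + H) \<noteq> (v \<le> s + K \<and> s + K < N + H))"
      using s sr K_pos by (auto simp: par_def val_def \<beta>_edge present_def start_ring_def)
    also have "\<dots> \<longleftrightarrow> s = v - K \<or> s = N + H - K"
    proof
      assume *: "s mod K = 0 \<and> ((v \<le> s \<and> s < N + H) \<noteq> (v \<le> s + K \<and> s + K < N + H))"
      then have "K dvd s" by auto
      moreover have "v - K \<le> s \<and> s < v \<or> N + H - K \<le> s \<and> s < N + H" using * K_pos s by auto
      ultimately show "s = v - K \<or> s = N + H - K"
        using multiple_between[of s v] multiple_between[of s "N + H"] NH sr by (auto simp: start_ring_def)
    next
      assume "s = v - K \<or> s = N + H - K"
      then show "s mod K = 0 \<and> ((v \<le> s \<and> s < N + H) \<noteq> (v \<le> s + K \<and> s + K < N + H))"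
        using NH N_pos H_ge K_ge by (auto simp: v_def mod_eq_0_iff_dvd dvd_diff)
    qed
    finally show "(par (val \<beta>) s \<noteq> charge s) = (s = v - K)"
      using N_pos H_ge K_ge by (auto simp: charge_def v_def)
  qed
  moreover have "\<forall>x. (\<forall>s e. x \<noteq> edge s e) \<longrightarrow> \<beta> x" by (simp add: \<beta>_def)
  ultimately show ?thesis using sr by blast
qed

text \<open>A clause of the violated cell contains the variable of the edge at \<open>v - K\<close>,
  which a clean \<open>S\<close> excludes; all other cells are satisfied.\<close>

lemma grid_satisfied:
  assumes "robber \<beta> v" "start_ring v \<or> end_ring v" "clean S v" "C \<in> grid" "var ` C \<subseteq> S"
  shows "\<exists>l\<in>C. lit_true \<beta> l"
proof -
  obtain s where s: "- H - K \<le> s" "s < N + H" and C: "C \<in> xor_clauses (edges (cell s)) (charge s)"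
    using assms(4) by (auto simp: grid_def)
  have "s \<noteq> v - K"
  proof
    assume sv: "s = v - K"
    obtain Y where "C = lits (edges (cell s)) Y" using C unfolding xor_clauses_def by blast
    then have "var ` C = edges (cell s)" by (simp only: var_lits)
    moreover have "present s" using sv assms(2) ring_bounds[of v] K_pos by (auto simp: present_def)
    then have "edge s False \<in> edges (cell s)" by (force simp: edges_def cell_def)
    ultimately have "edge s False \<in> S" using assms(5) by blast
    moreover have "v - K \<le> s" "s < v + K" using sv K_pos by auto
    ultimately show False using assms(3) unfolding clean_def by blast
  qed
  then have "par (val \<beta>) s = charge s" using assms(1) s unfolding robber_def by blast
  then show ?thesis using xor_clauses_satisfied[OF C] odd_card_cell by blast
qed

end

context coprime_lattice
begin

section \<open>The invariant of the game\<close>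

definition far :: "int \<Rightarrow> nat \<Rightarrow> nat set \<Rightarrow> bool" where
  "far B r S \<longleftrightarrow> (\<not> switchable S \<longrightarrow> (\<forall>a. located S a \<longrightarrow> \<not> near B r a))"

definition survives :: "nat set \<Rightarrow> nat \<Rightarrow> nat set \<Rightarrow> (nat \<Rightarrow> bool) \<Rightarrow> bool" where
  "survives X r S \<beta> \<longleftrightarrow> finite S \<and> (\<forall>x\<in>X. \<beta> x) \<and>
     2 * (H + D + 4 * D * int r) < N \<and> N + 2 * (H + D + 4 * D * int r) < L * P \<and>
     (\<exists>v. robber \<beta> v \<and> clean S v \<and> (start_ring v \<and> far 0 r S \<or> end_ring v \<and> far N r S))"

text \<open>If \<open>S\<close> is switchable, the violated cell may go to either end, and one of
  the ends suits all subsets of \<open>U\<close>: a position of \<open>U\<close> cannot be near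
  both. Otherwise the end is kept. It remains far because positions move slowly, and a free row at
  this end lets the violated cell evade the new variable \<open>x\<close>.\<close>

lemma survives_step:
  assumes sv: "survives X (Suc r) S \<beta>" and card: "card S \<le> nat (K + c - 2)"
    and X: "\<And>x s e. x \<in> X \<Longrightarrow> x \<noteq> edge s e"
  shows "\<exists>\<beta>'. (\<forall>v\<in>S. \<beta>' v = \<beta> v) \<and> (\<forall>S'. S' \<subseteq> insert x S \<longrightarrow> survives X r S' \<beta>')"
proof -
  define U where "U = insert x S"
  have finS: "finite S" and finU: "finite U" using sv by (auto simp: survives_def U_def)
  have SU: "S \<subseteq> U" by (auto simp: U_def)
  have cardU: "card U \<le> nat (K + c - 1)"
    using card finS c_ge K_ge by (auto simp: U_def card_insert_if)
  have cardS: "card S \<le> nat (K + c - 1)" using card c_ge K_ge by linarith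
  have cardU2: "card U < nat (2 * K)" using cardU c_le K_ge by linarith
  have rr: "4 * D * int r \<le> 4 * D * int (Suc r)" using D_bounds(3) by simp
  have bnd': "2 * (H + D + 4 * D * int (Suc r)) < N" "N + 2 * (H + D + 4 * D * int (Suc r)) < L * P"
    using sv by (simp_all only: survives_def)
  have bnd: "2 * (H + D + 4 * D * int r) < N" "N + 2 * (H + D + 4 * D * int r) < L * P"
    using bnd' rr by (smt (verit))+
  obtain v where v: "robber \<beta> v" "clean S v" "start_ring v \<and> far 0 (Suc r) S \<or> end_ring v \<and> far N (Suc r) S"
    using sv unfolding survives_def by blast
  have close: "near B (Suc r) b"
    if S': "S' \<subseteq> U" "\<not> switchable S'" "located S' a" "near B r a" "located U b" for S' a b B
  proof -
    obtain d where "\<bar>d\<bar> \<le> 2 * D" "L * P dvd b - a - d"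
      using located_close[OF finU cardU S'(1,2,3,5)] by blast
    then show ?thesis using near_shift[OF S'(4)] D_bounds(3) by simp
  qed
  define good where "good B \<longleftrightarrow> (\<forall>S' \<subseteq> U. far B r S')" for B
  have main: "\<exists>\<beta>' v'. robber \<beta>' v' \<and> (\<forall>x\<in>S. \<beta>' x = \<beta> x) \<and> (\<forall>x. (\<forall>s e. x \<noteq> edge s e) \<longrightarrow> \<beta>' x = \<beta> x) \<and>
     clean U v' \<and> (start_ring v' \<and> good 0 \<or> end_ring v' \<and> good N)"
  proof (cases "switchable S")
    case True
    have "good 0 \<or> good N"
    proof (cases "switchable U")
      case True
      then show ?thesis using switchable_mono unfolding good_def far_def by blast
    next
      case False
      then obtain b where b: "located U b" using located_exists[OF finU cardU] by blast
      have "\<not> near 0 (Suc r) b \<or> \<not> near N (Suc r) b" using not_near_both[OF bnd'] by blast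
      then show ?thesis using close[OF _ _ _ _ b] unfolding good_def far_def by blast
    qed
    then obtain v' where v': "clean U v'" "start_ring v' \<and> good 0 \<or> end_ring v' \<and> good N"
      using exists_clean_start[OF finU cardU2] exists_clean_end[OF finU cardU2] by blast
    have "\<exists>\<beta>'. robber \<beta>' v' \<and> (\<forall>x\<in>S. \<beta>' x = \<beta> x) \<and> (\<forall>x. (\<forall>s e. x \<noteq> edge s e) \<longrightarrow> \<beta>' x = \<beta> x)"
      by (rule robber_move_switchable[OF True v(1) _ _ v(2) clean_mono[OF v'(1) SU]]) (use v(3) v'(2) in auto)
    then show ?thesis using v' by blast
  next
    case False
    then have nsU: "\<not> switchable U" using switchable_mono SU by blast
    obtain a where a: "located S a" using located_exists[OF finS cardS False] by blast
    obtain b where b: "located U b" using located_exists[OF finU cardU nsU] by blast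
    obtain d where d: "\<bar>d\<bar> \<le> 2 * D" "L * P dvd b - a - d"
      using located_close[OF finU cardU SU False a b] by blast
    have ba: "near B (Suc r) a" if nb: "near B r b" for B
    proof (rule near_shift[OF nb])
      have "L * P dvd - (b - a - d)" using d(2) by (simp only: dvd_minus_iff)
      then show "L * P dvd a - b - (- d)" by (simp add: algebra_simps)
      show "\<bar>- d\<bar> \<le> 4 * D" using d(1) D_bounds(3) by simp
    qed
    have step: "\<exists>\<beta>' v'. robber \<beta>' v' \<and> (\<forall>x\<in>S. \<beta>' x = \<beta> x) \<and> (\<forall>x. (\<forall>s e. x \<noteq> edge s e) \<longrightarrow> \<beta>' x = \<beta> x) \<and>
       clean U v' \<and> ring v' \<and> good B"
      if ring: "ring = start_ring \<and> B = 0 \<or> ring = end_ring \<and> B = N" and rv: "ring v"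
        and fr: "far B (Suc r) S" and ex: "\<exists>v'. ring v' \<and> clean U v'" for ring B
    proof -
      have nn: "\<not> near B (Suc r) a" using fr False a unfolding far_def by blast
      then have "\<not> near B 0 b" using ba near_mono[of B 0 b r] by blast
      then obtain i where i: "0 \<le> i" "i < K"
        "\<And>s e. present s \<Longrightarrow> \<bar>s - B\<bar> \<le> H \<Longrightarrow> s mod K = i \<Longrightarrow> edge s e \<notin> U"
        using free_pair[OF finU cardU nsU b] by blast
      obtain v' where v': "ring v'" "clean U v'" using ex by blast
      \<comment> \<open>Around this end \<open>U\<close> has no variable in row \<open>i\<close>;
        \<open>below i\<close> moves the seam into that row, so the flip misses
        \<open>S\<close>.\<close>
      have "\<exists>\<beta>'. robber \<beta>' v' \<and> (\<forall>x\<in>S. \<beta>' x = \<beta> x) \<and> (\<forall>x. (\<forall>s e. x \<noteq> edge s e) \<longrightarrow> \<beta>' x = \<beta> x)"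
      proof (rule robber_move_within[OF _ v(1) _ v(2) clean_mono[OF v'(2) SU], of "below i"])
        show "start_ring v \<and> start_ring v' \<or> end_ring v \<and> end_ring v'" using ring rv v'(1) by auto
        fix s e assume s: "min v v' \<le> s" "s < max v v'" "edge s e \<in> S"
        have "present s \<and> \<bar>s - B\<bar> \<le> H"
          using s(1,2) ring rv v'(1) K_pos N_pos D_bounds(4)
          by (auto simp: start_ring_def end_ring_def present_def min_def max_def split: if_splits)
        then have "s mod K \<noteq> i" using i(3) s(3) SU by blast
        then show "cob (below i) s e = (s mod K = 0)" using cob_below[OF i(1,2)] by simp
      qed
      moreover have "good B"
        unfolding good_def far_def
      proof (intro allI impI notI)
        fix S' a' assume S': "S' \<subseteq> U" "\<not> switchable S'" "located S' a'" "near B r a'"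
        obtain d' where d': "\<bar>d'\<bar> \<le> 2 * D" "L * P dvd b - a' - d'"
          using located_close[OF finU cardU S'(1,2,3) b] by blast
        have "near B (Suc r) a"
        proof (rule near_shift[OF S'(4)])
          have "L * P dvd (b - a' - d') - (b - a - d)" using d'(2) d(2) by (rule dvd_diff)
          then show "L * P dvd a - a' - (d' - d)" by (simp add: algebra_simps)
          show "\<bar>d' - d\<bar> \<le> 4 * D" using d(1) d'(1) by linarith
        qed
        then show False using nn by blast
      qed
      ultimately show ?thesis using v' by blast
    qed
    from v(3) show ?thesis
    proof
      assume "start_ring v \<and> far 0 (Suc r) S"
      then show ?thesis using step[of start_ring 0] exists_clean_start[OF finU cardU2] by blast
    next
      assume "end_ring v \<and> far N (Suc r) S"
      then show ?thesis using step[of end_ring N] exists_clean_end[OF finU cardU2] by blast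
    qed
  qed
  then obtain \<beta>' v' where b: "robber \<beta>' v'" "\<forall>x\<in>S. \<beta>' x = \<beta> x"
    "\<forall>x. (\<forall>s e. x \<noteq> edge s e) \<longrightarrow> \<beta>' x = \<beta> x" "clean U v'" "start_ring v' \<and> good 0 \<or> end_ring v' \<and> good N"
    by blast
  have "survives X r S' \<beta>'" if S': "S' \<subseteq> insert x S" for S'
  proof -
    have "S' \<subseteq> U" using S' by (simp add: U_def)
    then have "clean S' v'" "start_ring v' \<and> far 0 r S' \<or> end_ring v' \<and> far N r S'" "finite S'"
      using clean_mono[OF b(4)] b(5) finite_subset[OF _ finU] unfolding good_def by blast+
    moreover have "\<forall>y\<in>X. \<beta>' y" using b(3) X sv unfolding survives_def by metis
    ultimately show ?thesis using b(1) bnd unfolding survives_def by blast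
  qed
  then show ?thesis using b(2) by blast
qed

theorem grid_depth:
  assumes ref: "refutation (grid \<union> (\<lambda>x. {Pos x}) ` X) \<pi>" and width: "res_width \<pi> \<le> nat (K + c - 2)"
    and X: "\<And>x s e. x \<in> X \<Longrightarrow> x \<noteq> edge s e"
    and r: "2 * (H + D + 4 * D * int r) < N" "N + 2 * (H + D + 4 * D * int r) < L * P"
  shows "r \<le> res_depth \<pi>"
proof -
  obtain \<beta> v where b: "robber \<beta> v" "start_ring v" "\<forall>x. (\<forall>s e. x \<noteq> edge s e) \<longrightarrow> \<beta> x"
    using robber_init by blast
  have "switchable {}" unfolding switchable_def by (intro exI[of _ "\<lambda>_. False"]) (auto simp: periodic_def)
  then have "far 0 r {}" by (simp add: far_def)
  moreover have "clean {} v" by (simp add: clean_def)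
  moreover have "\<forall>x\<in>X. \<beta> x" using b(3) X by blast
  ultimately have "survives X r {} \<beta>" unfolding survives_def using b r by blast
  then show ?thesis
  proof (rule res_depth_adversary[OF ref width, where Inv = "survives X"])
    fix r S \<alpha> x assume "survives X (Suc r) S \<alpha>" "finite S" "card S \<le> nat (K + c - 2)"
    from survives_step[OF this(1,3) X, of x]
    show "\<exists>\<beta>. (\<forall>v\<in>S. \<beta> v = \<alpha> v) \<and> (\<forall>S'. S' \<subseteq> insert x S \<longrightarrow> card S' \<le> nat (K + c - 2) \<longrightarrow> survives X r S' \<beta>)"
      by blast
  next
    fix r S \<alpha> C assume sv: "survives X r S \<alpha>" and C: "C \<in> grid \<union> (\<lambda>x. {Pos x}) ` X" and sub: "var ` C \<subseteq> S"
    show "\<exists>l\<in>C. lit_true \<alpha> l"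
    proof (cases "C \<in> grid")
      case True
      obtain v where "robber \<alpha> v" "clean S v" "start_ring v \<or> end_ring v"
        using sv unfolding survives_def by blast
      then show ?thesis using grid_satisfied[of \<alpha> v S C] True sub by blast
    next
      case False
      then obtain x where "x \<in> X" "C = {Pos x}" using C by blast
      then show ?thesis using sv by (simp add: survives_def)
    qed
  qed
qed

end

section \<open>The narrow refutation\<close>

context lattice
begin

lemma mod_K_inj:
  assumes "s mod K = s' mod K" "\<bar>s - s'\<bar> < K"
  shows "s = s'"
  using small_multiple_eq_0[of K "s - s'"] assms by (simp add: mod_eq_dvd_iff)

text \<open>The closed walk through the faces \<tau>, \<tau> + 1, ..., \<tau> + K - 1 and back to
  \<tau>: one edge in every row, the last one of the other kind.\<close>

definition front :: "int \<Rightarrow> (int \<times> bool) set" where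
  "front \<tau> = {\<tau>..\<tau> + K - 2} \<times> {False} \<union> {(\<tau> + K - 1, True)}"

lemma front_Un_cell: "front \<tau> \<union> cell \<tau> = {\<tau>..\<tau> + K - 1} \<times> {False} \<union> {\<tau> + K - 1, \<tau> + K} \<times> {True}"
  using K_ge by (auto simp: front_def cell_def)

lemma front_Int_cell: "front \<tau> \<inter> cell \<tau> = {(\<tau>, False), (\<tau> + K - 1, True)}"
  using K_ge by (auto simp: front_def cell_def)

lemma front_step: "(front \<tau> - cell \<tau>) \<union> (cell \<tau> - front \<tau>) = front (\<tau> + 1)"
  using K_ge by (auto simp: front_def cell_def)

lemma inj_on_front_cell: "inj_on (\<lambda>(s, e). edge s e) (front \<tau> \<union> cell \<tau>)"
  unfolding front_Un_cell
proof (rule edge_inj_on, rule inj_onI)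
  fix x y assume x: "x \<in> {\<tau>..\<tau> + K - 1} \<times> {False} \<union> {\<tau> + K - 1, \<tau> + K} \<times> {True}"
    and y: "y \<in> {\<tau>..\<tau> + K - 1} \<times> {False} \<union> {\<tau> + K - 1, \<tau> + K} \<times> {True}"
    and eq: "(case x of (s, e) \<Rightarrow> (s mod K, e)) = (case y of (s, e) \<Rightarrow> (s mod K, e))"
  obtain s e s' e' where xy: "x = (s, e)" "y = (s', e')" by (meson surj_pair)
  have "e = e'" "s mod K = s' mod K" using eq xy by auto
  moreover have "\<bar>s - s'\<bar> < K" using x y xy \<open>e = e'\<close> K_ge by auto
  ultimately show "x = y" using mod_K_inj xy by blast
qed

lemma edges_Un: "edges (A \<union> B) = edges A \<union> edges B"
  unfolding edges_def by blast

lemma edges_Int_Diff: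
  assumes "inj_on (\<lambda>(s, e). edge s e) (A \<union> B)"
  shows "edges (A \<inter> B) = edges A \<inter> edges B" "edges (A - B) = edges A - edges B"
proof -
  let ?f = "\<lambda>(s, e). edge s e" and ?p = "\<lambda>A. {(s, e) \<in> A. present s}"
  have sub: "?p A \<subseteq> A \<union> B" "?p B \<subseteq> A \<union> B" by auto
  have 1: "?p (A \<inter> B) = ?p A \<inter> ?p B" and 2: "?p (A - B) = ?p A - ?p B" and 3: "?p A - ?p B \<subseteq> A \<union> B"
    by auto
  show "edges (A \<inter> B) = edges A \<inter> edges B"
    unfolding edges_def 1 by (rule inj_on_image_Int[OF assms sub])
  show "edges (A - B) = edges A - edges B"
    unfolding edges_def 2 by (rule inj_on_image_set_diff[OF assms 3 sub(2)])
qed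

lemma edges_symdiff:
  "(edges (front \<tau>) - edges (cell \<tau>)) \<union> (edges (cell \<tau>) - edges (front \<tau>)) = edges (front (\<tau> + 1))"
proof -
  have "inj_on (\<lambda>(s, e). edge s e) (cell \<tau> \<union> front \<tau>)" using inj_on_front_cell by (simp add: Un_commute)
  note diff = edges_Int_Diff(2)[OF inj_on_front_cell, of \<tau>] edges_Int_Diff(2)[OF this]
  show ?thesis unfolding diff[symmetric] edges_Un[symmetric] front_step ..
qed

lemma finite_front_cell: "finite (front \<tau>)" "finite (cell \<tau>)"
  by (auto simp: front_def cell_def)

lemma finite_edges: "finite A \<Longrightarrow> finite (edges A)"
  unfolding edges_def by (intro finite_imageI) (auto intro: finite_subset[of _ A])

lemma finite_edges_cell: "finite (edges (cell s))"
  by (intro finite_edges finite_front_cell)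

lemma card_edges_le: "finite A \<Longrightarrow> card (edges A) \<le> card A"
  unfolding edges_def by (intro order_trans[OF card_image_le] card_mono) (auto intro: finite_subset[of _ A])

lemma card_front_cell: "card (front \<tau> \<union> cell \<tau>) = nat (K + 2)"
proof -
  have "card (front \<tau> \<union> cell \<tau>) = card ({\<tau>..\<tau> + K - 1} \<times> {False}) + card ({\<tau> + K - 1, \<tau> + K} \<times> {True})"
    unfolding front_Un_cell by (rule card_Un_disjoint) auto
  also have "\<dots> = nat (K + 2)" using K_ge by (simp add: card_cartesian_product nat_add_distrib)
  finally show ?thesis .
qed

lemma card_edges_cell: "card (edges (cell s)) \<le> 4"
proof -
  have "card (edges (cell s)) \<le> card (cell s)" by (rule card_edges_le) (rule finite_front_cell)
  also have "\<dots> \<le> 4" unfolding cell_def by (simp add: card_insert_if)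
  finally show ?thesis .
qed

lemma edges_empty: "(\<And>s e. (s, e) \<in> A \<Longrightarrow> \<not> present s) \<Longrightarrow> edges A = {}"
  by (auto simp: edges_def)

lemma card_edges_present:
  assumes "\<And>s e. (s, e) \<in> front \<tau> \<union> cell \<tau> \<Longrightarrow> present s"
  shows "card (edges (front \<tau>) \<union> edges (cell \<tau>)) = nat (K + 2)"
proof -
  have "{(s, e) \<in> front \<tau> \<union> cell \<tau>. present s} = front \<tau> \<union> cell \<tau>" using assms by auto
  then show ?thesis
    using card_image[OF inj_on_front_cell, of \<tau>]
    unfolding edges_Un[symmetric] by (simp add: edges_def card_front_cell)
qed

text \<open>A front and its cell have \<open>K + 2\<close> edges in their union, and the pivot
  disappears, which gives width \<open>K + 1\<close>. Near the ends edges are missing and clauses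
  are narrower; a clause of full width is secured at \<open>\<tau> = 0\<close>, where all edges
  concerned are present.\<close>

lemma derives_front:
  assumes F: "grid \<subseteq> F"
  shows "int j \<le> N + 2 * H + K \<Longrightarrow>
    \<exists>S. derives F (nat (K + 1)) (j * (16 + 2 * 2 ^ nat (K + 1))) S \<and>
      xor_clauses (edges (front (int j - H - K))) (N + H - K < int j - H - K) \<subseteq> S \<and>
      (0 < int j - H - K \<longrightarrow> (\<exists>C\<in>S. card C = nat (K + 1)))"
proof (induction j)
  case 0
  have "edges (front (int 0 - H - K)) = {}"
    by (rule edges_empty) (auto simp: front_def present_def)
  moreover have "\<not> N + H - K < int 0 - H - K" using N_pos D_bounds(4) by simp
  ultimately have "xor_clauses (edges (front (int 0 - H - K))) (N + H - K < int 0 - H - K) = {}"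
    by (auto simp: xor_clauses_def)
  moreover have "\<not> 0 < int 0 - H - K" using D_bounds(4) K_pos by simp
  ultimately show ?case using derives_empty by (intro exI[of _ "{}"]) auto
next
  case (Suc j)
  define \<tau> w where "\<tau> = int j - H - K" and "w = nat (K + 1)"
  have \<tau>: "- H - K \<le> \<tau>" "\<tau> < N + H" using Suc.prems by (auto simp: \<tau>_def)
  have \<tau>': "int (Suc j) - H - K = \<tau> + 1" by (simp add: \<tau>_def)
  obtain S where S: "derives F w (j * (16 + 2 * 2 ^ w)) S"
    "xor_clauses (edges (front \<tau>)) (N + H - K < \<tau>) \<subseteq> S" "0 < \<tau> \<longrightarrow> (\<exists>C\<in>S. card C = w)"
    using Suc unfolding \<tau>_def w_def by auto
  define E where "E = xor_clauses (edges (cell \<tau>)) (charge \<tau>)"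
  have fin: "finite (edges (front \<tau>))" "finite (edges (cell \<tau>))" by (intro finite_edges finite_front_cell)+
  have "E \<subseteq> grid" unfolding E_def grid_def using \<tau> by auto
  then have EF: "E \<subseteq> F" using F by blast
  have finE: "finite E" unfolding E_def by (rule finite_xor_clauses[OF fin(2)])
  have "card E \<le> 2 ^ card (edges (cell \<tau>))" unfolding E_def by (rule card_xor_clauses[OF fin(2)])
  also have "\<dots> \<le> 2 ^ 4" by (intro power_increasing card_edges_cell) auto
  finally have cE: "card E \<le> 16" by simp
  have "derives F w (j * (16 + 2 * 2 ^ w) + card E) (S \<union> E)"
  proof (rule derives_Un[OF finE S(1)])
    fix C assume C: "C \<in> E"
    then obtain Y where Y: "C = lits (edges (cell \<tau>)) Y" by (auto simp: E_def xor_clauses_def)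
    have "card C \<le> w" using Y card_edges_cell[of \<tau>] K_ge by (simp add: card_lits[OF fin(2)] w_def)
    then show "is_clause C \<and> card C \<le> w \<and> (C \<in> F \<or> (\<exists>A\<in>S. \<exists>B\<in>S. resolvent A B C))"
      using Y is_clause_lits[OF fin(2)] C EF by blast
  qed
  then have SE: "derives F w (j * (16 + 2 * 2 ^ w) + 16) (S \<union> E)"
    by (rule derives_mono) (use cE in auto)
  have par: "(N + H - K < \<tau> + 1) = ((N + H - K < \<tau>) \<noteq> charge \<tau>)" by (auto simp: charge_def)
  have "\<exists>S'. S \<union> E \<subseteq> S' \<and> derives F w (j * (16 + 2 * 2 ^ w) + 16 + 2 * 2 ^ w) S' \<and>
     xor_clauses (edges (front (\<tau> + 1))) (N + H - K < \<tau> + 1) \<subseteq> S' \<and>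
     (\<tau> = 0 \<longrightarrow> (\<exists>C\<in>S'. card C = w))"
  \<comment> \<open>The first front is empty and offers no pivot; the constraint of the cell is
    already that of the next front.\<close>
  proof (cases "\<tau> = - H - K")
    case True
    have "edges (front \<tau>) = {}" using True by (intro edges_empty) (auto simp: front_def present_def)
    then have "edges (front (\<tau> + 1)) = edges (cell \<tau>)" using edges_symdiff[of \<tau>] by simp
    moreover have "\<not> N + H - K < \<tau> + 1" "\<tau> \<noteq> 0" "\<not> charge \<tau>"
      using True N_pos D_bounds(4) K_pos by (auto simp: charge_def)
    ultimately show ?thesis using derives_mono[OF SE, of _ "S \<union> E"]
      by (intro exI[of _ "S \<union> E"]) (auto simp: E_def)
  next
    case False
    \<comment> \<open>Near the ends only one of the two common edges may be present; the pivot has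
      to be that one.\<close>
    define u where "u = (if present (\<tau> + K - 1) then edge (\<tau> + K - 1) True else edge \<tau> False)"
    have int: "edges (front \<tau>) \<inter> edges (cell \<tau>) = edges {(\<tau>, False), (\<tau> + K - 1, True)}"
      using edges_Int_Diff(1)[OF inj_on_front_cell] by (simp add: front_Int_cell)
    have "present \<tau> \<or> present (\<tau> + K - 1)" using \<tau> False K_ge N_pos H_ge by (auto simp: present_def)
    then have u: "u \<in> edges {(\<tau>, False), (\<tau> + K - 1, True)}" by (force simp: edges_def u_def)
    have sub: "edges {(\<tau>, False), (\<tau> + K - 1, True)} \<subseteq> {u, edge \<tau> False}"
      by (auto simp: edges_def u_def)
    have card: "card (edges (front \<tau>) \<union> edges (cell \<tau>)) \<le> Suc w"
      unfolding edges_Un[symmetric] using card_edges_le[of "front \<tau> \<union> cell \<tau>"] finite_front_cell K_ge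
      by (simp add: card_front_cell w_def nat_add_distrib)
    have "\<exists>S'. S \<union> E \<subseteq> S' \<and> derives F w (j * (16 + 2 * 2 ^ w) + 16 + 2 * 2 ^ w) S' \<and>
      xor_clauses (edges (front (\<tau> + 1))) ((N + H - K < \<tau>) \<noteq> charge \<tau>) \<subseteq> S' \<and>
      (edges (front \<tau>) \<noteq> edges (cell \<tau>) \<longrightarrow>
        (\<exists>C\<in>S'. card C = card (edges (front \<tau>) \<union> edges (cell \<tau>)) - 1))"
      unfolding edges_symdiff[symmetric]
      by (rule derives_xor_step[OF SE _ _ fin, of _ _ u "edge \<tau> False"])
         (use S(2) u int sub card in \<open>auto simp: E_def\<close>)
    then obtain S' where S': "S \<union> E \<subseteq> S'" "derives F w (j * (16 + 2 * 2 ^ w) + 16 + 2 * 2 ^ w) S'"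
      "xor_clauses (edges (front (\<tau> + 1))) ((N + H - K < \<tau>) \<noteq> charge \<tau>) \<subseteq> S'"
      "edges (front \<tau>) \<noteq> edges (cell \<tau>) \<longrightarrow>
        (\<exists>C\<in>S'. card C = card (edges (front \<tau>) \<union> edges (cell \<tau>)) - 1)" by blast
    have "\<exists>C\<in>S'. card C = w" if "\<tau> = 0"
    proof -
      have "present s" if "(s, e) \<in> front \<tau> \<union> cell \<tau>" for s e
        using that \<open>\<tau> = 0\<close> H_ge K_ge N_pos by (auto simp: front_def cell_def present_def)
      then have c: "card (edges (front \<tau>) \<union> edges (cell \<tau>)) = nat (K + 2)"
        by (rule card_edges_present)
      then have "edges (front \<tau>) \<noteq> edges (cell \<tau>)" using card_edges_cell[of \<tau>] K_ge by auto
      then show ?thesis using S'(4) c K_ge by (auto simp: w_def nat_add_distrib)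
    qed
    then show ?thesis unfolding par using S'(1-3) by blast
  qed
  then obtain S' where S': "S \<union> E \<subseteq> S'" "derives F w (j * (16 + 2 * 2 ^ w) + 16 + 2 * 2 ^ w) S'"
    "xor_clauses (edges (front (\<tau> + 1))) (N + H - K < \<tau> + 1) \<subseteq> S'"
    "\<tau> = 0 \<longrightarrow> (\<exists>C\<in>S'. card C = w)" by blast
  have "0 < \<tau> + 1 \<longrightarrow> (\<exists>C\<in>S'. card C = w)"
  proof
    assume "0 < \<tau> + 1"
    then consider "\<tau> = 0" | "0 < \<tau>" by linarith
    then show "\<exists>C\<in>S'. card C = w" using S(3) S'(1,4) by cases blast+
  qed
  moreover have "j * (16 + 2 * 2 ^ w) + 16 + 2 * 2 ^ w = Suc j * (16 + 2 * 2 ^ w)" by simp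
  then have "derives F w (Suc j * (16 + 2 * 2 ^ w)) S'" using S'(2) by (simp only:)
  ultimately show ?case unfolding \<tau>' w_def[symmetric] using S'(3) by blast
qed

lemma grid_refutation:
  assumes "grid \<subseteq> F"
  shows "\<exists>\<pi>. refutation F \<pi> \<and> res_width \<pi> = nat (K + 1) \<and>
    res_size \<pi> \<le> Suc (nat (N + 2 * H + K) * (16 + 2 * 2 ^ nat (K + 1)))"
proof -
  define j where "j = nat (N + 2 * H + K)"
  have j: "int j = N + 2 * H + K" using N_pos D_bounds(4) K_pos by (simp add: j_def)
  have eq: "int j - H - K = N + H" using j by simp
  obtain S where S: "derives F (nat (K + 1)) (j * (16 + 2 * 2 ^ nat (K + 1))) S"
    "xor_clauses (edges (front (N + H))) (N + H - K < N + H) \<subseteq> S"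
    "0 < N + H \<longrightarrow> (\<exists>C\<in>S. card C = nat (K + 1))"
    using derives_front[OF assms, of j] j unfolding eq by auto
  have "edges (front (N + H)) = {}" by (rule edges_empty) (use K_ge in \<open>auto simp: front_def present_def\<close>)
  moreover have "{} \<in> xor_clauses {} True" unfolding xor_clauses_def lits_def by force
  ultimately have "{} \<in> S" using S(2) K_pos by auto
  moreover obtain C where "C \<in> S" "card C = nat (K + 1)" using S(3) N_pos D_bounds(4) by force
  ultimately show ?thesis using derives_imp_refutation[OF S(1)] unfolding j_def by blast
qed

end

section \<open>The size of the formula\<close>

lemma card_image_factor:
  assumes "finite (g ` M)" "\<And>x y. x \<in> M \<Longrightarrow> y \<in> M \<Longrightarrow> g x = g y \<Longrightarrow> f x = f y"
  shows "card (f ` M) \<le> card (g ` M)"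
proof -
  have "f ` M \<subseteq> (\<lambda>z. f (inv_into M g z)) ` (g ` M)"
  proof
    fix y assume "y \<in> f ` M"
    then obtain x where x: "x \<in> M" "y = f x" by blast
    then have "inv_into M g (g x) \<in> M" "g (inv_into M g (g x)) = g x"
      by (auto intro: inv_into_into f_inv_into_f)
    then have "f (inv_into M g (g x)) = y" using assms(2) x by metis
    then show "y \<in> (\<lambda>z. f (inv_into M g z)) ` (g ` M)" using x by blast
  qed
  then show ?thesis using assms(1) surj_card_le by blast
qed

lemma card_mod_image:
  fixes g :: "int \<Rightarrow> int"
  assumes "\<And>x. x \<in> M \<Longrightarrow> 0 \<le> g x \<and> g x < B"
  shows "finite (g ` M)" "card (g ` M) \<le> nat B"
proof -
  have "g ` M \<subseteq> {0..<B}" using assms by auto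
  then show "finite (g ` M)" "card (g ` M) \<le> nat B"
    using finite_subset card_mono[of "{0..<B}" "g ` M"] by auto
qed

context lattice
begin

lemma card_window_le:
  assumes "0 \<le> d"
  shows "card {t \<in> {0..<K}. (i - t + 1) mod K < d} \<le> nat d"
proof -
  have "inj_on (\<lambda>t. (i - t + 1) mod K) {t \<in> {0..<K}. (i - t + 1) mod K < d}"
  proof (rule inj_onI)
    fix t t' assume t: "t \<in> {t \<in> {0..<K}. (i - t + 1) mod K < d}" "t' \<in> {t \<in> {0..<K}. (i - t + 1) mod K < d}"
      "(i - t + 1) mod K = (i - t' + 1) mod K"
    then have "K dvd t' - t" by (simp add: mod_eq_dvd_iff)
    moreover have "\<bar>t' - t\<bar> < K" using t by auto
    ultimately show "t = t'" using small_multiple_eq_0 by fastforce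
  qed
  moreover have "(\<lambda>t. (i - t + 1) mod K) ` {t \<in> {0..<K}. (i - t + 1) mod K < d} \<subseteq> {0..<d}"
    using K_pos by auto
  ultimately have "card {t \<in> {0..<K}. (i - t + 1) mod K < d} \<le> card {0..<d}"
    by (intro card_inj_on_le) auto
  then show ?thesis by simp
qed

lemma window_prod_le:
  assumes q: "\<And>t. p t \<le> q" and d: "0 \<le> d"
  shows "(\<Prod>t | t \<in> {0..<K} \<and> (i - t + 1) mod K < d. p t) \<le> q ^ nat d"
proof -
  have "1 \<le> q" using p_pos q order_trans by blast
  have "(\<Prod>t | t \<in> {0..<K} \<and> (i - t + 1) mod K < d. p t) \<le> (\<Prod>t | t \<in> {0..<K} \<and> (i - t + 1) mod K < d. q)"
    using p_pos q by (intro prod_mono) (auto intro: order_trans[of 0 1])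
  also have "\<dots> = q ^ card {t \<in> {0..<K}. (i - t + 1) mod K < d}" by simp
  also have "\<dots> \<le> q ^ nat d" using card_window_le[OF d] \<open>1 \<le> q\<close> by (intro power_increasing) auto
  finally show ?thesis .
qed

text \<open>The product over the primes visible in the edge rows \<open>s - 1\<close> and
  \<open>s\<close>: two adjacent windows of length \<open>c\<close> overlap in all but one place
  each, so \<open>c + 1\<close> primes remain.\<close>

definition cell_mod :: "int \<Rightarrow> int" where
  "cell_mod s = (\<Prod>t | t \<in> {0..<K} \<and> (s - t + 1) mod K < c + 1. p t)"

lemma cell_mod_pos: "0 < cell_mod s"
  unfolding cell_mod_def by (intro prod_pos p_gt_0)

lemma cell_mod_cong:
  assumes "s mod K = s' mod K"
  shows "cell_mod s = cell_mod s'"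
proof -
  have "(s - t + 1) mod K = (s' - t + 1) mod K" for t using assms by (simp add: mod_eq_dvd_iff)
  then show ?thesis unfolding cell_mod_def by (simp only:)
qed

lemma edge_mod_dvd_cell_mod: "edge_mod s dvd cell_mod s" "edge_mod (s + K - 1) dvd cell_mod s"
proof -
  show "edge_mod s dvd cell_mod s"
    unfolding edge_mod_def cell_mod_def edge_window_def by (rule prod_dvd_prod_subset) auto
  have "edge_window t (s - 1) \<Longrightarrow> (s - t + 1) mod K < c + 1" for t
    using succ_mod_cases[of "s - t"] c_ge by (auto simp: edge_window_def split: if_splits)
  then have "edge_mod (s - 1) dvd cell_mod s"
    unfolding edge_mod_def cell_mod_def by (intro prod_dvd_prod_subset) auto
  moreover have "(s + K - 1) mod K = (s - 1) mod K" by (simp add: mod_eq_dvd_iff)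
  then have "edge_mod (s + K - 1) = edge_mod (s - 1)" by (rule edge_mod_cong)
  ultimately show "edge_mod (s + K - 1) dvd cell_mod s" by simp
qed

lemma edge_eqI:
  assumes "mid s" "mid s'" "s mod K = s' mod K" "L * edge_mod s dvd s - s'"
  shows "edge s e = edge s' e"
proof -
  have "edge_mod s = edge_mod s'" using assms(3) by (rule edge_mod_cong)
  then have "s mod (L * edge_mod s) = s' mod (L * edge_mod s')" using assms(4) by (simp add: mod_eq_dvd_iff)
  then show ?thesis using assms(1,2) by (simp add: edge_def)
qed

lemma mid_cell_eq:
  assumes s: "0 \<le> s" "s + K < N" "0 \<le> s'" "s' + K < N" "s mod K = s' mod K" "L * cell_mod s dvd s - s'"
  shows "edges (cell s) = edges (cell s')"
proof -
  have d: "L * edge_mod s dvd s - s'" "L * edge_mod (s + K - 1) dvd s - s'"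
    using s(6) edge_mod_dvd_cell_mod by (meson dvd_trans mult_dvd_mono dvd_refl)+
  have ed: "edges (cell r) = {edge r False, edge (r + K) True, edge (r + K - 1) False, edge (r + K - 1) True}"
    if "0 \<le> r" "r + K < N" for r
  proof -
    have "present r" "present (r + K)" "present (r + K - 1)"
      using that K_ge H_ge by (auto simp: present_def)
    then have "{(s, e) \<in> cell r. present s} = cell r" by (auto simp: cell_def)
    then show ?thesis by (simp add: edges_def) (simp add: cell_def)
  qed
  have "edge s False = edge s' False"
    by (rule edge_eqI) (use s d K_pos in \<open>auto simp: mid_def\<close>)
  moreover have "edge (s + K) True = edge (s' + K) True"
  proof (rule edge_eqI)
    have "edge_mod (s + K) = edge_mod s" by (rule edge_mod_cong) simp
    then show "L * edge_mod (s + K) dvd s + K - (s' + K)" using d(1) by simp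
  qed (use s K_pos in \<open>auto simp: mid_def\<close>)
  moreover have "edge (s + K - 1) e = edge (s' + K - 1) e" for e
  proof (rule edge_eqI)
    show "(s + K - 1) mod K = (s' + K - 1) mod K" using s(5) by (simp add: mod_eq_dvd_iff)
    show "L * edge_mod (s + K - 1) dvd s + K - 1 - (s' + K - 1)" using d(2) by simp
  qed (use s K_ge in \<open>auto simp: mid_def\<close>)
  ultimately show ?thesis using ed s by simp
qed

lemma card_cell_clauses: "card (xor_clauses (edges (cell s)) b) \<le> 16"
proof -
  have "card (xor_clauses (edges (cell s)) b) \<le> 2 ^ card (edges (cell s))"
    by (rule card_xor_clauses[OF finite_edges_cell])
  also have "\<dots> \<le> 2 ^ 4" by (intro power_increasing card_edges_cell) auto
  finally show ?thesis by simp
qed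

lemma finite_grid: "finite grid"
  unfolding grid_def by (auto intro: finite_xor_clauses finite_edges_cell)

text \<open>Cells with all edges in the middle segment are counted up to identification modulo
  \<open>L * cell_mod s\<close>, the remaining ones individually.\<close>

lemma card_grid:
  assumes q: "\<And>t. p t \<le> q"
  shows "int (card grid) \<le> 16 * (L * q ^ nat (c + 1) + 2 * H + 2 * K)"
proof -
  define M where "M = {s. 0 \<le> s \<and> s + K < N}"
  define R where "R = {- H - K..<0} \<union> {N - K..<N + H}"
  define Z where "Z = (\<lambda>s. edges (cell s)) ` M"
  define B where "B = L * q ^ nat (c + 1)"
  have gb: "0 \<le> s mod (L * cell_mod s) \<and> s mod (L * cell_mod s) < B" for s
  proof -
    have "cell_mod s \<le> q ^ nat (c + 1)"
      unfolding cell_mod_def using c_ge by (intro window_prod_le q) auto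
    then have "L * cell_mod s \<le> B" unfolding B_def using L_pos by (intro mult_left_mono) auto
    moreover have "0 < L * cell_mod s" using L_pos cell_mod_pos by simp
    ultimately show ?thesis
      using pos_mod_bound[of "L * cell_mod s" s] pos_mod_sign[of "L * cell_mod s" s] by linarith
  qed
  have finM: "finite M" by (rule finite_subset[of _ "{0..<N}"]) (use K_pos in \<open>auto simp: M_def\<close>)
  have finZ: "finite Z" using finM by (simp add: Z_def)
  have "card Z \<le> card ((\<lambda>s. s mod (L * cell_mod s)) ` M)"
    unfolding Z_def
  proof (rule card_image_factor)
    show "finite ((\<lambda>s. s mod (L * cell_mod s)) ` M)" by (rule card_mod_image(1)) (rule gb)
    fix s s' assume s: "s \<in> M" "s' \<in> M" "s mod (L * cell_mod s) = s' mod (L * cell_mod s')"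
    have mm: "x mod (L * y) mod K = x mod K" for x y
      using K_dvd_L by (simp add: mod_mod_cancel)
    have r: "s mod K = s' mod K" using arg_cong[OF s(3), of "\<lambda>x. x mod K"] by (simp only: mm)
    then have "cell_mod s' = cell_mod s" using cell_mod_cong[of s s'] by simp
    then have "L * cell_mod s dvd s - s'" using s(3) by (simp add: mod_eq_dvd_iff)
    then show "edges (cell s) = edges (cell s')" using s r by (intro mid_cell_eq) (auto simp: M_def)
  qed
  also have "\<dots> \<le> nat B" by (rule card_mod_image(2)) (rule gb)
  finally have cZ: "card Z \<le> nat B" .
  have "grid \<subseteq> (\<Union>X\<in>Z. xor_clauses X False) \<union> (\<Union>s\<in>R. xor_clauses (edges (cell s)) (charge s))"
  proof
    fix C assume "C \<in> grid"
    then obtain s where s: "- H - K \<le> s" "s < N + H" "C \<in> xor_clauses (edges (cell s)) (charge s)"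
      by (auto simp: grid_def)
    show "C \<in> (\<Union>X\<in>Z. xor_clauses X False) \<union> (\<Union>s\<in>R. xor_clauses (edges (cell s)) (charge s))"
    proof (cases "s \<in> M")
      case True
      then have "\<not> charge s" using D_def K_ge by (auto simp: M_def charge_def H_def)
      then show ?thesis using True s(3) unfolding Z_def by auto
    next
      case False
      then have "s \<in> R" using s by (auto simp: M_def R_def)
      then show ?thesis using s(3) by blast
    qed
  qed
  then have "card grid \<le> card ((\<Union>X\<in>Z. xor_clauses X False) \<union> (\<Union>s\<in>R. xor_clauses (edges (cell s)) (charge s)))"
    by (intro card_mono) (use finM in \<open>auto simp: Z_def R_def intro: finite_xor_clauses finite_edges_cell\<close>)
  also have "\<dots> \<le> card (\<Union>X\<in>Z. xor_clauses X False) + card (\<Union>s\<in>R. xor_clauses (edges (cell s)) (charge s))"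
    by (rule card_Un_le)
  also have "card (\<Union>X\<in>Z. xor_clauses X False) \<le> (\<Sum>X\<in>Z. card (xor_clauses X False))"
    by (rule card_UN_le[OF finZ])
  also have "\<dots> \<le> (\<Sum>X\<in>Z. 16)" by (intro sum_mono) (auto simp: Z_def card_cell_clauses)
  also have "card (\<Union>s\<in>R. xor_clauses (edges (cell s)) (charge s)) \<le> (\<Sum>s\<in>R. card (xor_clauses (edges (cell s)) (charge s)))"
    by (rule card_UN_le) (simp add: R_def)
  also have "\<dots> \<le> (\<Sum>s\<in>R. 16)" by (intro sum_mono card_cell_clauses)
  finally have "card grid \<le> 16 * card Z + 16 * card R" by simp
  then have "int (card grid) \<le> 16 * int (card Z) + 16 * int (card R)" by linarith
  moreover have "int (card R) \<le> 2 * (H + K)"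
  proof -
    have "card R \<le> nat (H + K) + nat (H + K)"
      unfolding R_def by (rule order_trans[OF card_Un_le]) simp
    then show ?thesis using H_ge K_ge by (simp add: nat_le_iff le_nat_iff)
  qed
  moreover have "int (card Z) \<le> B" using cZ gb[of 0] by (simp add: le_nat_iff)
  ultimately have "int (card grid) \<le> 16 * B + 16 * (2 * (H + K))" by linarith
  then show ?thesis by (simp add: B_def)
qed

lemma clause_vars:
  assumes "C \<in> grid"
  obtains s where "- H - K \<le> s" "s < N + H" "var ` C = edges (cell s)" "is_clause C" "card C \<le> 4"
proof -
  obtain s where s: "- H - K \<le> s" "s < N + H" "C \<in> xor_clauses (edges (cell s)) (charge s)"
    using assms by (auto simp: grid_def)
  then obtain Y where Y: "C = lits (edges (cell s)) Y" unfolding xor_clauses_def by blast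
  have "var ` C = edges (cell s)" unfolding Y by (rule var_lits)
  moreover have "is_clause C" unfolding Y by (rule is_clause_lits[OF finite_edges_cell])
  moreover have "card C \<le> 4" unfolding Y card_lits[OF finite_edges_cell] by (rule card_edges_cell)
  ultimately show thesis using that[OF s(1,2)] by blast
qed

lemma edges_memI: "(s, e) \<in> A \<Longrightarrow> present s \<Longrightarrow> edge s e \<in> edges A"
  unfolding edges_def by (rule image_eqI[of _ _ "(s, e)"]) auto

lemma empty_notin_grid: "{} \<notin> grid"
proof
  assume "{} \<in> grid"
  then obtain s where s: "- H - K \<le> s" "s < N + H" "var ` {} = edges (cell s)" by (rule clause_vars)
  have "present s \<or> present (s + K)" using s(1,2) N_pos H_ge K_ge by (auto simp: present_def)
  moreover have "(s, False) \<in> cell s" "(s + K, True) \<in> cell s" by (auto simp: cell_def)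
  ultimately have "edges (cell s) \<noteq> {}" using edges_memI by blast
  then show False using s(3) by simp
qed

lemma grid_vars:
  assumes q: "\<And>t. p t \<le> q"
  shows "finite (formula_vars grid)" "int (card (formula_vars grid)) \<le> 2 * (L * q ^ nat c) + 4 * H"
    "formula_vars grid \<subseteq> range (\<lambda>(s, e). edge s e)"
proof -
  define B where "B = L * q ^ nat c"
  define M where "M = {0..<N}"
  define R where "R = {- H..<0} \<union> {N..<N + H}"
  define g where "g s = s mod (L * edge_mod s)" for s
  have gb: "0 \<le> g s \<and> g s < B" for s
  proof -
    have "edge_mod s \<le> q ^ nat c"
      unfolding edge_mod_def edge_window_def using c_ge by (intro window_prod_le q) auto
    then have "L * edge_mod s \<le> B" unfolding B_def using L_pos by (intro mult_left_mono) auto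
    moreover have "0 < L * edge_mod s" using L_pos edge_mod_pos by simp
    ultimately show ?thesis unfolding g_def
      using pos_mod_bound[of "L * edge_mod s" s] pos_mod_sign[of "L * edge_mod s" s] by linarith
  qed
  have mid_card: "card ((\<lambda>s. edge s e) ` M) \<le> nat B" for e
  proof -
    have "card ((\<lambda>s. edge s e) ` M) \<le> card (g ` M)"
      by (rule card_image_factor) (auto simp: M_def edge_def mid_def g_def)
    also have "\<dots> \<le> nat B" by (rule card_mod_image(2)) (rule gb)
    finally show ?thesis .
  qed
  define G where "G e = (\<lambda>s. edge s e) ` M \<union> (\<lambda>s. edge s e) ` R" for e
  have "formula_vars grid \<subseteq> G False \<union> G True"
  proof
    fix x assume "x \<in> formula_vars grid"
    then obtain C where C: "C \<in> grid" "x \<in> var ` C" unfolding formula_vars_def by blast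
    obtain s where "var ` C = edges (cell s)" by (rule clause_vars[OF C(1)])
    then have "x \<in> edges (cell s)" using C(2) by simp
    then obtain r e where r: "x = edge r e" "present r" unfolding edges_def by auto
    then have "r \<in> M \<or> r \<in> R" by (auto simp: M_def R_def present_def)
    then have "x \<in> G e" unfolding G_def r(1) by blast
    then show "x \<in> G False \<union> G True" by (cases e) auto
  qed
  moreover have finG: "finite (G e)" for e by (simp add: G_def M_def R_def)
  moreover have cG: "card (G e) \<le> nat B + nat (2 * H)" for e
  proof -
    have "card ((\<lambda>s. edge s e) ` R) \<le> card R" by (rule card_image_le) (simp add: R_def)
    also have "\<dots> \<le> nat H + nat H" unfolding R_def by (rule order_trans[OF card_Un_le]) simp
    also have "\<dots> = nat (2 * H)" using H_ge K_ge by simp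
    finally show ?thesis unfolding G_def
      using mid_card[of e] card_Un_le[of "(\<lambda>s. edge s e) ` M" "(\<lambda>s. edge s e) ` R"] by linarith
  qed
  ultimately have "card (formula_vars grid) \<le> card (G False) + card (G True)"
    by (meson card_Un_le card_mono finite_UnI le_trans)
  then have "card (formula_vars grid) \<le> (nat B + nat (2 * H)) + (nat B + nat (2 * H))"
    by (rule order_trans[OF _ add_mono[OF cG cG]])
  then have 1: "int (card (formula_vars grid)) \<le> 2 * (int (nat B) + int (nat (2 * H)))"
    by (simp only: of_nat_le_iff[symmetric, where ?'a = int] of_nat_add mult_2)
  have 2: "int (nat B) = B" "int (nat (2 * H)) = 2 * H" using gb[of 0] H_ge K_ge by auto
  show "int (card (formula_vars grid)) \<le> 2 * (L * q ^ nat c) + 4 * H"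
    using 1 unfolding B_def[symmetric] 2 by simp
  show "finite (formula_vars grid)"
    using \<open>formula_vars grid \<subseteq> G False \<union> G True\<close> finG by (meson finite_UnI finite_subset)
  show "formula_vars grid \<subseteq> range (\<lambda>(s, e). edge s e)"
    using \<open>formula_vars grid \<subseteq> G False \<union> G True\<close> unfolding G_def by force
qed

text \<open>Unit clauses on odd numbers raise the number of variables to \<open>V\<close>. The
  adversary keeps these variables true, so they do not affect the depth.\<close>

lemma padded_grid:
  assumes q: "\<And>t. p t \<le> q" and V: "2 * (L * q ^ nat c) + 4 * H \<le> int V"
  shows "\<exists>X F. F = grid \<union> (\<lambda>x. {Pos x}) ` X \<and> (\<forall>x\<in>X. \<forall>s e. x \<noteq> edge s e) \<and> {} \<notin> F \<and>
    is_cnf 4 F \<and> card (formula_vars F) = V \<and>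
    int (formula_size F) \<le> 64 * (L * q ^ nat (c + 1) + 2 * H + 2 * K) + int V"
proof -
  define \<nu> where "\<nu> = card (formula_vars grid)"
  define X where "X = (\<lambda>i::nat. 2 * i + 1) ` {..<V - \<nu>}"
  define F where "F = grid \<union> (\<lambda>x. {Pos x}) ` X"
  have \<nu>: "\<nu> \<le> V" using grid_vars(2)[OF q] V unfolding \<nu>_def by linarith
  have finX: "finite X" and cX: "card X = V - \<nu>"
    by (auto simp: X_def card_image inj_on_def)
  have odd: "x \<noteq> edge s e" if "x \<in> X" for x s e
  proof -
    have "odd x" using that by (auto simp: X_def)
    moreover have "even (edge s e)" by (simp add: edge_def)
    ultimately show ?thesis by auto
  qed
  have finF: "finite F" using finX finite_grid by (simp add: F_def)
  have "is_cnf 4 F"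
    unfolding is_cnf_def
  proof (intro conjI ballI finF)
    fix C assume C: "C \<in> F"
    show "is_clause C"
      using C clause_vars[of C] unfolding F_def by (auto simp: is_clause_def inj_on_def)
    show "card C \<le> 4" using C clause_vars[of C] unfolding F_def by auto
  qed
  moreover have "formula_vars F = formula_vars grid \<union> X"
  proof -
    have "\<Union> ((\<lambda>x. {Pos x}) ` X) = Pos ` X" by auto
    then show ?thesis
      unfolding formula_vars_def F_def by (simp add: Union_Un_distrib image_Un image_image)
  qed
  moreover have "formula_vars grid \<inter> X = {}"
  proof -
    have "x \<notin> X" if x: "x \<in> formula_vars grid" for x
    proof -
      have "x \<in> range (\<lambda>(s, e). edge s e)" using grid_vars(3)[OF q] x by (rule subsetD)
      then obtain s e where "x = edge s e" by auto
      then show ?thesis using odd by blast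
    qed
    then show ?thesis by blast
  qed
  ultimately have "card (formula_vars F) = V"
    using \<nu> cX finX grid_vars(1)[OF q] by (simp add: card_Un_disjoint \<nu>_def)
  moreover have "int (formula_size F) \<le> 64 * (L * q ^ nat (c + 1) + 2 * H + 2 * K) + int V"
  proof -
    have "formula_size F \<le> (\<Sum>C\<in>grid. card C) + (\<Sum>C\<in>(\<lambda>x. {Pos x}) ` X. card C)"
      unfolding formula_size_def F_def
      using sum.union_inter[OF finite_grid finite_imageI[OF finX], of card "\<lambda>x. {Pos x}"] by linarith
    also have "(\<Sum>C\<in>grid. card C) \<le> (\<Sum>C\<in>grid. 4)"
      by (intro sum_mono) (use clause_vars in blast)
    also have "(\<Sum>C\<in>(\<lambda>x. {Pos x}) ` X. card C) \<le> (\<Sum>C\<in>(\<lambda>x. {Pos x}) ` X. 1)"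
      by (intro sum_mono) auto
    also have "\<dots> \<le> V"
      using card_image_le[OF finX, of "\<lambda>x. {Pos x}"] cX by simp
    finally have "formula_size F \<le> 4 * card grid + V" by simp
    then show ?thesis using card_grid[OF q] by linarith
  qed
  moreover have "{} \<notin> F" using empty_notin_grid by (auto simp: F_def)
  ultimately show ?thesis using \<open>is_cnf 4 F\<close> odd unfolding F_def by blast
qed

end

section \<open>The trade-off\<close>

text \<open>Large and coprime moduli are assumed in the depth claim only, so the rest is available
  for small \<open>n\<close> too, with trivial moduli.\<close>

lemma compressed_grid_formula:
  fixes n k c :: nat and p :: "int \<Rightarrow> int"
  assumes c: "3 \<le> c" "c \<le> k - 1" and n: "3 \<le> n"
    and p: "\<And>t. 1 \<le> p t" "\<And>t. p t \<le> 2 * int n"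
  shows "\<exists>F :: nat clause set. is_cnf 4 F \<and> {} \<notin> F \<and>
    formula_size F \<le> 150 * card (formula_vars F) \<and>
    card (formula_vars F) = 40 * k ^ 2 * (2 * n) ^ (c + 1) \<and>
    (\<exists>\<pi>. refutation F \<pi> \<and> res_width \<pi> = k + 3 \<and> res_size \<pi> \<le> 2806 * (k ^ 2 * (4 * n) ^ k)) \<and>
    ((\<forall>t\<in>{0..<int k + 2}. int n \<le> p t) \<longrightarrow>
     (\<forall>t\<in>{0..<int k + 2}. \<forall>t'\<in>{0..<int k + 2}. t \<noteq> t' \<longrightarrow> coprime (p t) (p t')) \<longrightarrow>
     (\<forall>\<pi>. refutation F \<pi> \<longrightarrow> res_width \<pi> \<le> k + c \<longrightarrow> n ^ k \<le> res_depth \<pi>))"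
proof -
  \<comment> \<open>For \<open>n ^ k\<close> steps, twice the radius in \<open>near\<close> is 14
    K^2 + 24 K^2 n^k, which is less than 64 K^2 n^k.\<close>
  define K N where "K = int k + 2" and "N = 64 * K\<^sup>2 * int n ^ k"
  have k: "4 \<le> k" using c by simp
  have K: "6 \<le> K" using k by (simp add: K_def)
  have Npos: "0 < N" using K n by (simp add: N_def)
  interpret lattice K "int c" N p
    using c k p(1) Npos by unfold_locales (auto simp: K_def N_def power2_eq_square)
  have K2: "4 * K\<^sup>2 \<le> 9 * (int k)\<^sup>2"
  proof -
    have "2 * K \<le> 3 * int k" using k by (simp add: K_def)
    then have "(2 * K)\<^sup>2 \<le> (3 * int k)\<^sup>2" using K by (intro power_mono) auto
    then show ?thesis by (simp add: power_mult_distrib)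
  qed
  have KK: "6 * K \<le> K\<^sup>2" using K by (simp add: power2_eq_square)
  define q where "q = 2 * int n"
  define Q where "Q = q ^ c"
  have Q: "1 \<le> Q" "6 \<le> q"
  proof -
    show "6 \<le> q" using n by (simp add: q_def)
    then show "1 \<le> Q" unfolding Q_def by (intro one_le_power) simp
  qed
  \<comment> \<open>The largest number of variables that is permitted; the bound for the grid alone
    is smaller by a factor of order \<open>n\<close>.\<close>
  define V where "V = 40 * k ^ 2 * (2 * n) ^ (c + 1)"
  have V: "int V = 40 * (int k)\<^sup>2 * (q * Q)" by (simp add: V_def q_def Q_def)
  have kQ: "0 \<le> (int k)\<^sup>2 * Q" "K\<^sup>2 * Q \<ge> K\<^sup>2" "4 * (K\<^sup>2 * Q) \<le> 9 * ((int k)\<^sup>2 * Q)"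
  proof -
    show "0 \<le> (int k)\<^sup>2 * Q" using Q by simp
    show "K\<^sup>2 * Q \<ge> K\<^sup>2" using Q mult_left_mono[of 1 Q "K\<^sup>2"] by simp
    show "4 * (K\<^sup>2 * Q) \<le> 9 * ((int k)\<^sup>2 * Q)" using mult_right_mono[OF K2, of Q] Q by (simp add: mult.assoc)
  qed
  have qkQ: "6 * ((int k)\<^sup>2 * Q) \<le> (int k)\<^sup>2 * (q * Q)"
    using mult_right_mono[OF Q(2) kQ(1)] by (simp add: ac_simps)
  have "2 * (L * q ^ nat (int c)) + 4 * H = 64 * (K\<^sup>2 * Q) + 16 * K\<^sup>2"
    by (simp add: L_def H_def Q_def)
  also have "\<dots> \<le> int V" unfolding V using kQ qkQ by linarith
  finally have V_ge: "2 * (L * q ^ nat (int c)) + 4 * H \<le> int V" .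
  obtain X F where F: "F = grid \<union> (\<lambda>x. {Pos x}) ` X" "\<forall>x\<in>X. \<forall>s e. x \<noteq> edge s e" "{} \<notin> F" "is_cnf 4 F"
    "card (formula_vars F) = V"
    "int (formula_size F) \<le> 64 * (L * q ^ nat (int c + 1) + 2 * H + 2 * K) + int V"
    using padded_grid[of q V] p(2) V_ge unfolding q_def by blast
  have "formula_size F \<le> 150 * V"
  proof -
    have "nat (int c + 1) = Suc c" by simp
    then have e: "64 * (L * q ^ nat (int c + 1) + 2 * H + 2 * K) = 2048 * (K\<^sup>2 * (q * Q)) + 512 * K\<^sup>2 + 128 * K"
      by (simp add: L_def H_def Q_def algebra_simps)
    \<comment> \<open>In units of \<open>V\<close>: 2048 * 9/4 / 40 = 115.2 for the middle segment,
      at most 30 for the ends, and 1 for the padding.\<close>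
    have "K\<^sup>2 \<le> K\<^sup>2 * (q * Q)"
      using Q mult_left_mono[of 1 "q * Q" "K\<^sup>2"] mult_mono[of 1 q 1 Q] by simp
    moreover have "4 * (K\<^sup>2 * (q * Q)) \<le> 9 * ((int k)\<^sup>2 * (q * Q))"
      using mult_right_mono[OF K2, of "q * Q"] Q by (simp add: mult.assoc)
    ultimately have "int (formula_size F) \<le> 150 * int V"
      using F(6) KK unfolding e V by linarith
    then show ?thesis by linarith
  qed
  moreover have "\<exists>\<pi>. refutation F \<pi> \<and> res_width \<pi> = k + 3 \<and> res_size \<pi> \<le> 2806 * (k ^ 2 * (4 * n) ^ k)"
  proof -
    have w: "nat (K + 1) = k + 3" by (simp add: K_def)
    obtain \<pi> where \<pi>: "refutation F \<pi>" "res_width \<pi> = k + 3"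
      "res_size \<pi> \<le> Suc (nat (N + 2 * H + K) * (16 + 2 * 2 ^ (k + 3)))"
      using grid_refutation[of F] F(1) unfolding w by blast
    define r where "r = int n ^ k"
    have r: "1 \<le> r" using n by (simp add: r_def)
    have "N + 2 * H + K = 64 * (K\<^sup>2 * r) + 8 * K\<^sup>2 + K" by (simp add: N_def H_def r_def)
    moreover have "K\<^sup>2 \<le> K\<^sup>2 * r" using r mult_left_mono[of 1 r "K\<^sup>2"] by simp
    moreover have "4 * (K\<^sup>2 * r) \<le> 9 * ((int k)\<^sup>2 * r)"
      using mult_right_mono[OF K2, of r] r by (simp add: mult.assoc)
    \<comment> \<open>(64 + 8 + 1/6) * 9 = 649.5; the factor 4 keeps the ratio 9/4 of the squares
      integral.\<close>
    moreover have "4 * z \<le> 657 * y"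
      if "z = 64 * x + 8 * u + K" "u \<le> x" "4 * x \<le> 9 * y" "6 * K \<le> u" for x y z u :: int
      using that K by linarith
    ultimately have b1: "4 * (N + 2 * H + K) \<le> 657 * ((int k)\<^sup>2 * r)" using KK by blast
    have b2: "0 \<le> N + 2 * H + K" using N_pos D_bounds(4) K by linarith
    have t: "16 \<le> (2::int) ^ k"
      using power_increasing[OF k, of "2::int"] by simp
    then have "16 + 2 * 2 ^ (k + 3) \<le> 17 * (2::int) ^ k" by (simp add: power_add)
    then have "4 * (N + 2 * H + K) * (16 + 2 * 2 ^ (k + 3)) \<le> 657 * ((int k)\<^sup>2 * r) * (17 * 2 ^ k)"
      by (rule mult_mono[OF b1]) (use r in auto)
    moreover have "1 \<le> (int k)\<^sup>2 * r * 2 ^ k"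
    proof -
      have "1 \<le> (int k)\<^sup>2" using k by (simp add: one_le_power)
      then have "1 * 1 \<le> (int k)\<^sup>2 * r" using r by (rule mult_mono) auto
      then have "1 * 1 \<le> (int k)\<^sup>2 * r * 2 ^ k" by (intro mult_mono[of 1 _ 1 "2 ^ k"]) auto
      then show ?thesis by simp
    qed
    moreover have "(int k)\<^sup>2 * r * 2 ^ k \<le> (int k)\<^sup>2 * (4 * int n) ^ k"
    proof -
      have "(2::int) ^ k \<le> 4 ^ k" by (rule power_mono) auto
      then have "r * 2 ^ k \<le> r * 4 ^ k" using r by (intro mult_left_mono) auto
      then have "r * 2 ^ k \<le> (4 * int n) ^ k" by (simp add: r_def power_mult_distrib mult.commute)
      then show ?thesis unfolding mult.assoc by (intro mult_left_mono) auto
    qed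
    moreover have "657 * ((int k)\<^sup>2 * r) * (17 * 2 ^ k) = 11169 * ((int k)\<^sup>2 * r * 2 ^ k)" by simp
    moreover have "4 * (N + 2 * H + K) * (16 + 2 * 2 ^ (k + 3)) = 4 * ((N + 2 * H + K) * (16 + 2 * 2 ^ (k + 3)))"
      by (rule mult.assoc)
    \<comment> \<open>657 * 17 / 4 < 2793, plus 1 for the repeated empty clause.\<close>
    ultimately have "(N + 2 * H + K) * (16 + 2 * 2 ^ (k + 3)) + 1 \<le> 2806 * ((int k)\<^sup>2 * (4 * int n) ^ k)"
      by linarith
    moreover have "int (res_size \<pi>) \<le> (N + 2 * H + K) * (16 + 2 * 2 ^ (k + 3)) + 1"
    proof -
      have "int (res_size \<pi>) \<le> int (Suc (nat (N + 2 * H + K) * (16 + 2 * 2 ^ (k + 3))))"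
        using \<pi>(3) by (simp only: of_nat_le_iff)
      also have "\<dots> = (N + 2 * H + K) * (16 + 2 * 2 ^ (k + 3)) + 1" using b2 by simp
      finally show ?thesis .
    qed
    ultimately have "int (res_size \<pi>) \<le> int (2806 * (k ^ 2 * (4 * n) ^ k))" by simp
    then have "res_size \<pi> \<le> 2806 * (k ^ 2 * (4 * n) ^ k)" by (simp only: of_nat_le_iff)
    then show ?thesis using \<pi> by blast
  qed
  moreover have "n ^ k \<le> res_depth \<pi>"
    if pn: "\<forall>t\<in>{0..<int k + 2}. int n \<le> p t"
      and cop: "\<forall>t\<in>{0..<int k + 2}. \<forall>t'\<in>{0..<int k + 2}. t \<noteq> t' \<longrightarrow> coprime (p t) (p t')"
      and ref: "refutation F \<pi>" and width: "res_width \<pi> \<le> k + c" for \<pi>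
  proof -
    interpret coprime_lattice K "int c" N p
      by unfold_locales (use cop in \<open>auto simp: K_def\<close>)
    define r where "r = int n ^ k"
    have r: "1 \<le> r" using n by (simp add: r_def)
    \<comment> \<open>The two primes beyond \<open>k\<close> contribute n^2 \<ge> 9. In units of K^2
      n^k, \<open>L * P\<close> is then at least 288, against at most 64 + 38 for \<open>N\<close>
      and twice the radius.\<close>
    have "int n ^ (k + 2) = (\<Prod>t\<in>{0..<K}. int n)" by (simp add: K_def nat_add_distrib)
    also have "\<dots> \<le> P" unfolding P_def using pn by (intro prod_mono) (auto simp: K_def)
    finally have "r * (int n * int n) \<le> P" by (simp add: r_def power_add power2_eq_square ac_simps)
    moreover have "r * (3 * 3) \<le> r * (int n * int n)" using r n by (intro mult_left_mono mult_mono) auto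
    ultimately have P: "9 * r \<le> P" by linarith
    have K2r: "K\<^sup>2 \<le> K\<^sup>2 * r" "0 < K\<^sup>2" using r K mult_left_mono[of 1 r "K\<^sup>2"] by auto
    have e: "2 * (H + D + 4 * D * int (n ^ k)) = 14 * K\<^sup>2 + 24 * (K\<^sup>2 * r)"
      by (simp add: H_def D_def r_def algebra_simps)
    have N: "N = 64 * (K\<^sup>2 * r)" by (simp add: N_def r_def)
    have "32 * K\<^sup>2 * (9 * r) \<le> 32 * K\<^sup>2 * P" using P by (intro mult_left_mono) auto
    moreover have "32 * K\<^sup>2 * (9 * r) = 288 * (K\<^sup>2 * r)" by simp
    ultimately have LP: "288 * (K\<^sup>2 * r) \<le> L * P" by (simp only: L_def)
    have X: "x \<in> X \<Longrightarrow> x \<noteq> edge s e" for x s e using F(2) by blast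
    have w: "res_width \<pi> \<le> nat (K + int c - 2)" using width by (simp add: K_def nat_add_distrib)
    show ?thesis
    proof (rule grid_depth[OF ref[unfolded F(1)] w X])
      show "2 * (H + D + 4 * D * int (n ^ k)) < N" unfolding e unfolding N using K2r by linarith
      show "N + 2 * (H + D + 4 * D * int (n ^ k)) < L * P" unfolding e unfolding N using K2r LP by linarith
    qed
  qed
  ultimately show ?thesis
    using F(3-5) unfolding V_def by (intro exI[of _ F]) auto
qed

text \<open>Outside the index range the value 1 keeps the bounds valid for all integers, as the
  locale demands.\<close>

lemma distinct_primes_family:
  fixes n m :: nat
  assumes n: "0 < n" and m: "m \<le> card {q. prime q \<and> n < q \<and> q \<le> 2 * n}"
  shows "\<exists>p :: int \<Rightarrow> int. (\<forall>t. 1 \<le> p t \<and> p t \<le> 2 * int n) \<and> (\<forall>t\<in>{0..<int m}. int n \<le> p t) \<and>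
    (\<forall>t\<in>{0..<int m}. \<forall>t'\<in>{0..<int m}. t \<noteq> t' \<longrightarrow> coprime (p t) (p t'))"
proof -
  let ?Q = "{q. prime q \<and> n < q \<and> q \<le> 2 * n}"
  have "finite ?Q" by (rule finite_subset[of _ "{..2 * n}"]) auto
  then obtain f where f: "f ` {..<m} \<subseteq> ?Q" "inj_on f {..<m}"
    using card_le_inj[of "{..<m}" ?Q] m by auto
  define p where "p t = (if t \<in> {0..<int m} then int (f (nat t)) else 1)" for t
  have mem: "prime (f (nat t)) \<and> n < f (nat t) \<and> f (nat t) \<le> 2 * n" if "t \<in> {0..<int m}" for t
    using f(1) that by (auto simp: image_subset_iff)
  have "coprime (p t) (p t')" if t: "t \<in> {0..<int m}" "t' \<in> {0..<int m}" "t \<noteq> t'" for t t'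
  proof -
    have "nat t \<noteq> nat t'" using t by auto
    then have "f (nat t) \<noteq> f (nat t')" using inj_onD[OF f(2)] t by fastforce
    then have "coprime (f (nat t)) (f (nat t'))" using mem t by (intro primes_coprime) auto
    then show ?thesis using t by (simp add: p_def)
  qed
  moreover have "1 \<le> p t \<and> p t \<le> 2 * int n" for t
    using mem[of t] n by (auto simp: p_def)
  moreover have "int n \<le> p t" if "t \<in> {0..<int m}" for t using mem[OF that] that by (simp add: p_def)
  ultimately show ?thesis by blast
qed

theorem mainTheorem7:
  "\<exists>A B \<delta> :: real. A > 0 \<and> B > 0 \<and> \<delta> > 0 \<and>
    (\<forall>n k c :: nat. 3 \<le> c \<longrightarrow> c \<le> k - 1 \<longrightarrow> real k - 1 < real n / (2 * ln (real n)) \<longrightarrow>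
      (\<exists>F :: nat clause set.
         is_cnf 4 F \<and> \<not> satisfiable F \<and>
         real (formula_size F) \<le> A * real (card (formula_vars F)) \<and>
         2 * k ^ 2 * n ^ (c + 1) \<le> card (formula_vars F) \<and>
         card (formula_vars F) \<le> 40 * k ^ 2 * (2 * n) ^ (c + 1) \<and>
         (\<exists>\<pi>. refutation F \<pi> \<and> res_width \<pi> = k + 3 \<and>
              real (res_size \<pi>) \<le> B * (real k ^ 2 * (4 * real n) ^ k)) \<and>
         (\<forall>\<pi>. refutation F \<pi> \<longrightarrow> res_width \<pi> \<le> k + c \<longrightarrow>
              real (res_depth \<pi>) \<ge> \<delta> * real n ^ k)))"
proof -
  obtain n0 where n0: "\<And>n. n0 \<le> n \<Longrightarrow>
      real n / (2 * ln (real n)) + 4 \<le> real (card {p. prime p \<and> n < p \<and> p \<le> 2 * n})"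
    using eventually_many_primes unfolding eventually_sequentially by blast
  define \<delta> where "\<delta> = 1 / real (Suc n0) ^ Suc n0"
  have "1 \<le> real (Suc n0) ^ Suc n0" by (rule one_le_power) simp
  then have \<delta>: "0 < \<delta>" "\<delta> \<le> 1" unfolding \<delta>_def by (simp_all del: power_Suc of_nat_Suc)
  have "\<exists>F :: nat clause set.
         is_cnf 4 F \<and> \<not> satisfiable F \<and>
         real (formula_size F) \<le> 150 * real (card (formula_vars F)) \<and>
         2 * k ^ 2 * n ^ (c + 1) \<le> card (formula_vars F) \<and>
         card (formula_vars F) \<le> 40 * k ^ 2 * (2 * n) ^ (c + 1) \<and>
         (\<exists>\<pi>. refutation F \<pi> \<and> res_width \<pi> = k + 3 \<and>
              real (res_size \<pi>) \<le> 2806 * (real k ^ 2 * (4 * real n) ^ k)) \<and>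
         (\<forall>\<pi>. refutation F \<pi> \<longrightarrow> res_width \<pi> \<le> k + c \<longrightarrow> real (res_depth \<pi>) \<ge> \<delta> * real n ^ k)"
    if c: "3 \<le> c" "c \<le> k - 1" and kn: "real k - 1 < real n / (2 * ln (real n))" for n k c :: nat
  proof -
    have k: "4 \<le> k" using c by simp
    \<comment> \<open>\<open>k - 1\<close> is at least 3, so the quotient must exceed 3. For
      \<open>n = 0\<close> and \<open>n = 1\<close> the denominator is 0 and the quotient is 0 by
      convention.\<close>
    have n: "3 \<le> n"
    proof (rule ccontr)
      assume "\<not> 3 \<le> n"
      then consider "n = 0" | "n = 1" | "n = 2" by linarith
      then show False
      proof cases
        case 3
        have "real n / (2 * ln (real n)) \<le> 3"
          using ln2_ge_two_thirds 3 by (simp add: field_simps)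
        then show False using kn k by simp
      qed (use kn k in auto)
    qed
    have "1 \<le> ln (real n)"
      using n exp_le by (subst ln_ge_iff) auto
    then have "real n / (2 * ln (real n)) \<le> real n / 2"
      using n by (intro divide_left_mono) auto
    \<comment> \<open>With \<open>k \<le> n\<close>, the power \<open>n ^ k\<close> is bounded by a
      constant for all \<open>n\<close> below \<open>n0\<close>, which allows one
      \<open>\<delta>\<close> for all of them.\<close>
    then have kn': "k \<le> n" using kn k n by linarith
    obtain p :: "int \<Rightarrow> int" where p: "\<forall>t. 1 \<le> p t \<and> p t \<le> 2 * int n"
      and large: "n0 \<le> n \<Longrightarrow> (\<forall>t\<in>{0..<int k + 2}. int n \<le> p t) \<and>
        (\<forall>t\<in>{0..<int k + 2}. \<forall>t'\<in>{0..<int k + 2}. t \<noteq> t' \<longrightarrow> coprime (p t) (p t'))"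
    proof (cases "n0 \<le> n")
      case True
      have "real (k + 2) \<le> real (card {p. prime p \<and> n < p \<and> p \<le> 2 * n})" using n0[OF True] kn by simp
      then have "k + 2 \<le> card {p. prime p \<and> n < p \<and> p \<le> 2 * n}" by (simp only: of_nat_le_iff)
      moreover have "int (k + 2) = int k + 2" by simp
      ultimately show thesis using distinct_primes_family[of n "k + 2"] n that by (metis less_le_trans zero_less_numeral)
    next
      case False
      \<comment> \<open>any moduli will do: \<open>\<delta>\<close> makes the depth bound at most 1\<close>
      show thesis by (rule that[of "\<lambda>_. 1"]) (use n False in auto)
    qed
    have pp: "1 \<le> p t" "p t \<le> 2 * int n" for t using p by auto
    obtain F :: "nat clause set" and \<pi>0 where F: "is_cnf 4 F" "{} \<notin> F" "formula_size F \<le> 150 * card (formula_vars F)"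
      "card (formula_vars F) = 40 * k ^ 2 * (2 * n) ^ (c + 1)"
      and \<pi>0: "refutation F \<pi>0" "res_width \<pi>0 = k + 3" "res_size \<pi>0 \<le> 2806 * (k ^ 2 * (4 * n) ^ k)"
      and deep: "(\<forall>t\<in>{0..<int k + 2}. int n \<le> p t) \<longrightarrow>
       (\<forall>t\<in>{0..<int k + 2}. \<forall>t'\<in>{0..<int k + 2}. t \<noteq> t' \<longrightarrow> coprime (p t) (p t')) \<longrightarrow>
       (\<forall>\<pi>. refutation F \<pi> \<longrightarrow> res_width \<pi> \<le> k + c \<longrightarrow> n ^ k \<le> res_depth \<pi>)"
      using compressed_grid_formula[where p = p, OF c n pp] by (elim exE conjE) (rule that)
    have "\<delta> * real n ^ k \<le> real (res_depth \<pi>)" if \<pi>: "refutation F \<pi>" "res_width \<pi> \<le> k + c" for \<pi>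
    proof (cases "n0 \<le> n")
      case True
      have "\<delta> * real n ^ k \<le> real n ^ k" using \<delta> mult_right_mono[of \<delta> 1 "real n ^ k"] by simp
      also have "\<dots> = real (n ^ k)" by simp
      also have "\<dots> \<le> real (res_depth \<pi>)"
        unfolding of_nat_le_iff
        using mp[OF mp[OF deep conjunct1[OF large[OF True]]] conjunct2[OF large[OF True]]] \<pi> by simp
      finally show ?thesis .
    next
      case False
      have "real n ^ k \<le> real (Suc n0) ^ k" using False by (intro power_mono) auto
      also have "\<dots> \<le> real (Suc n0) ^ Suc n0" using False kn' by (intro power_increasing) auto
      finally have "\<delta> * real n ^ k \<le> 1" unfolding \<delta>_def by (simp add: divide_le_eq del: power_Suc of_nat_Suc)
      also have "1 \<le> real (res_depth \<pi>)" using res_depth_pos[OF \<pi>(1) F(2)] by simp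
      finally show ?thesis .
    qed
    moreover have "\<not> satisfiable F" using refutation_sound[OF \<pi>0(1)] .
    moreover have "real (formula_size F) \<le> 150 * real (card (formula_vars F))"
    proof -
      have "real (formula_size F) \<le> real (150 * card (formula_vars F))" using F(3) by (simp only: of_nat_le_iff)
      then show ?thesis by simp
    qed
    moreover have "2 * k ^ 2 * n ^ (c + 1) \<le> card (formula_vars F)"
      unfolding F(4) by (intro mult_mono power_mono) auto
    moreover have "real (res_size \<pi>0) \<le> 2806 * (real k ^ 2 * (4 * real n) ^ k)"
    proof -
      have "real (res_size \<pi>0) \<le> real (2806 * (k ^ 2 * (4 * n) ^ k))" using \<pi>0(3) by (simp only: of_nat_le_iff)
      then show ?thesis by simp
    qed
    ultimately show ?thesis using F(1,4) \<pi>0(1,2) by (intro exI[of _ F]) auto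
  qed
  then show ?thesis using \<delta>(1)
    by (intro exI[of _ 150] exI[of _ 2806] exI[of _ \<delta>]) auto
qed

end
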